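(* Let $(M,g)$ be a complete Riemannian manifold of dimension $n\ge 3$ with a Hyperbolic conical end $\mathcal{E}\subset\mathscr{C}^n_{Hyp}(N)$, and let $\tilde g=u^{\frac{4}{n-2}}g$ be a conformal metric with $C^\infty$ conformal factor $u:M\to(0,+\infty)$. Let $\tilde S$ denote the scalar curvature of $\tilde g$. Assume that, on $\mathcal{E}$, $$\sup_{x\in N}|\tilde S(r,x)|=\mathcal{O}\big(e^{\alpha(r)}\big)\quad\text{as } r\to+\infty$$ for some function $\alpha:[0,+\infty)\to(0,+\infty)$ satisfying $$\lim_{t\to+\infty}\frac{\alpha(t)}{t}=+\infty.$$ Then, necessarily, $$\limsup_{r\to+\infty}\ e^{\frac{n-2}{4}\alpha(r)}\sup_{\partial\mathcal{E}(r)}u(r,x)=+\infty.$$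
   Context: Let $(N,g_N)$ be a compact Riemannian manifold without boundary of dimension $n-1$. The Hyperbolic cone with section $N$ is $\mathscr{C}^n_{Hyp}(N)=\big((0,+\infty)\times N,\ dr\otimes dr+\sinh^2(r)g_N\big)$. A Hyperbolic conical end is a subset $\mathcal{E}=\mathcal{E}(r_0)=(r_0,+\infty)\times N\subset\mathscr{C}^n_{Hyp}(N)$, $r_0\ge 0$, with the induced metric. "$M$ has a Hyperbolic conical end $\mathcal{E}$" means that one of the ends of $M$ (an unbounded connected component of the complement of a compact set) is isometric to $\mathcal{E}$ and is identified with it. For $r>r_0$, $\mathcal{E}(r)=(r,+\infty)\times N$ and $\partial\mathcal{E}(r)=\{r\}\times N$. All manifolds are connected and without boundary. *)

theory Defs
  imports "HOL-Analysis.Analysis" "HOL-Library.Landau_Symbols"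
begin

text \<open>\<open>Ck_on k S f\<close> is the usual \<open>C\<^sup>k\<close> condition; it is only used for open \<open>S\<close>.\<close>

primrec Ck_on ::
  "nat \<Rightarrow> 'a::real_normed_vector set \<Rightarrow> ('a \<Rightarrow> 'b::real_normed_vector) \<Rightarrow> bool" where
  "Ck_on 0 S f \<longleftrightarrow> continuous_on S f"
| "Ck_on (Suc k) S f \<longleftrightarrow> (\<forall>x\<in>S. f differentiable (at x)) \<and>
     (\<forall>v. Ck_on k S (\<lambda>x. frechet_derivative f (at x) v))"

definition smooth_on ::
  "'a::real_normed_vector set \<Rightarrow> ('a \<Rightarrow> 'b::real_normed_vector) \<Rightarrow> bool" where
  "smooth_on S f \<longleftrightarrow> (\<forall>k. Ck_on k S f)"

text \<open>
  A manifold is given by an indexed atlas. Its underlying space is the union of the chart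
  domains, an open subset of a Hausdorff, second countable ambient type. The dimension is
  the dimension \<open>DIM('e)\<close> of the model space \<open>'e\<close>. Since charts are homeomorphisms onto
  open subsets of \<open>'e\<close>, manifolds have no boundary.
\<close>

record ('i, 'm, 'e) atlas =
  indices :: "'i set"
  chart_dom :: "'i \<Rightarrow> 'm set"
  chart_map :: "'i \<Rightarrow> 'm \<Rightarrow> 'e"

definition carrier :: "('i, 'm, 'e) atlas \<Rightarrow> 'm set" where
  "carrier A = (\<Union>i\<in>indices A. chart_dom A i)"

definition chart_inv :: "('i, 'm, 'e) atlas \<Rightarrow> 'i \<Rightarrow> 'e \<Rightarrow> 'm" where
  "chart_inv A i = inv_into (chart_dom A i) (chart_map A i)"

definition local_rep ::
  "('i, 'm, 'e) atlas \<Rightarrow> ('j, 'k, 'f) atlas \<Rightarrow> ('m \<Rightarrow> 'k) \<Rightarrow> 'i \<Rightarrow> 'j \<Rightarrow> 'e \<Rightarrow> 'f" where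
  "local_rep A B F i j = chart_map B j \<circ> F \<circ> chart_inv A i"

definition smooth_map ::
  "('i, 'm::topological_space, 'e::euclidean_space) atlas \<Rightarrow>
   ('j, 'k::topological_space, 'f::euclidean_space) atlas \<Rightarrow> ('m \<Rightarrow> 'k) \<Rightarrow> bool" where
  "smooth_map A B F \<longleftrightarrow>
     continuous_on (carrier A) F \<and> F ` carrier A \<subseteq> carrier B \<and>
     (\<forall>i\<in>indices A. \<forall>j\<in>indices B.
        smooth_on (chart_map A i ` (chart_dom A i \<inter> F -` chart_dom B j)) (local_rep A B F i j))"

text \<open>For \<open>F = id\<close>, \<open>local_rep A A id i j\<close> is the transition map from chart \<open>i\<close> to chart \<open>j\<close>.\<close>

definition smooth_manifold ::
  "('i, 'm::{t2_space,second_countable_topology}, 'e::euclidean_space) atlas \<Rightarrow> bool" where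
  "smooth_manifold A \<longleftrightarrow>
     (\<forall>i\<in>indices A. open (chart_dom A i) \<and> open (chart_map A i ` chart_dom A i) \<and>
        homeomorphism (chart_dom A i) (chart_map A i ` chart_dom A i)
          (chart_map A i) (chart_inv A i)) \<and>
     (\<forall>i\<in>indices A. \<forall>j\<in>indices A.
        smooth_on (chart_map A i ` (chart_dom A i \<inter> chart_dom A j)) (local_rep A A id i j))"

definition smooth_fun ::
  "('i, 'm, 'e::euclidean_space) atlas \<Rightarrow> ('m \<Rightarrow> real) \<Rightarrow> bool" where
  "smooth_fun A f \<longleftrightarrow>
     (\<forall>i\<in>indices A. smooth_on (chart_map A i ` chart_dom A i) (f \<circ> chart_inv A i))"

definition diffeomorphism ::
  "('i, 'm::topological_space, 'e::euclidean_space) atlas \<Rightarrow>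
   ('j, 'k::topological_space, 'f::euclidean_space) atlas \<Rightarrow> ('m \<Rightarrow> 'k) \<Rightarrow> bool" where
  "diffeomorphism A B F \<longleftrightarrow>
     bij_betw F (carrier A) (carrier B) \<and>
     smooth_map A B F \<and> smooth_map B A (inv_into (carrier A) F)"

definition open_submanifold :: "('i, 'm, 'e) atlas \<Rightarrow> 'm set \<Rightarrow> ('i, 'm, 'e) atlas" where
  "open_submanifold A E =
     \<lparr>indices = indices A, chart_dom = (\<lambda>i. chart_dom A i \<inter> E), chart_map = chart_map A\<rparr>"

text \<open>
  A (0,2)-tensor field is given by its components in every chart: \<open>g i p v w\<close> is the value at
  the point \<open>p\<close> on the two tangent vectors whose coordinates in chart \<open>i\<close> are \<open>v\<close> and \<open>w\<close>.
  \<open>pulls_back\<close> says that \<open>g\<close> is the pullback of \<open>h\<close> under \<open>F\<close>; for \<open>F = id\<close> and \<open>g = h\<close> it is the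
  transformation law of the components under a change of chart.
\<close>

type_synonym ('i, 'm, 'e) tensor2 = "'i \<Rightarrow> 'm \<Rightarrow> 'e \<Rightarrow> 'e \<Rightarrow> real"

definition pulls_back ::
  "('i, 'm, 'e::euclidean_space) atlas \<Rightarrow> ('i, 'm, 'e) tensor2 \<Rightarrow>
   ('j, 'k, 'f::euclidean_space) atlas \<Rightarrow> ('j, 'k, 'f) tensor2 \<Rightarrow> ('m \<Rightarrow> 'k) \<Rightarrow> bool" where
  "pulls_back A g B h F \<longleftrightarrow>
     (\<forall>i\<in>indices A. \<forall>j\<in>indices B. \<forall>p \<in> chart_dom A i \<inter> F -` chart_dom B j. \<forall>v w.
        g i p v w =
          (let D = frechet_derivative (local_rep A B F i j) (at (chart_map A i p))
           in h j (F p) (D v) (D w)))"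

definition riemannian_metric ::
  "('i, 'm, 'e::euclidean_space) atlas \<Rightarrow> ('i, 'm, 'e) tensor2 \<Rightarrow> bool" where
  "riemannian_metric A g \<longleftrightarrow>
     (\<forall>i\<in>indices A. \<forall>p\<in>chart_dom A i.
        bilinear (g i p) \<and> (\<forall>v w. g i p v w = g i p w v) \<and> (\<forall>v. v \<noteq> 0 \<longrightarrow> g i p v v > 0)) \<and>
     (\<forall>i\<in>indices A. \<forall>v w.
        smooth_on (chart_map A i ` chart_dom A i) (\<lambda>x. g i (chart_inv A i x) v w)) \<and>
     pulls_back A g A g id"

definition riemannian_manifold ::
  "('i, 'm::{t2_space,second_countable_topology}, 'e::euclidean_space) atlas \<Rightarrow>
   ('i, 'm, 'e) tensor2 \<Rightarrow> bool" where
  "riemannian_manifold A g \<longleftrightarrow>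
     smooth_manifold A \<and> connected (carrier A) \<and> riemannian_metric A g"

definition riemannian_isometry ::
  "('i, 'm::topological_space, 'e::euclidean_space) atlas \<Rightarrow> ('i, 'm, 'e) tensor2 \<Rightarrow>
   ('j, 'k::topological_space, 'f::euclidean_space) atlas \<Rightarrow> ('j, 'k, 'f) tensor2 \<Rightarrow>
   ('m \<Rightarrow> 'k) \<Rightarrow> bool" where
  "riemannian_isometry A g B h F \<longleftrightarrow> diffeomorphism A B F \<and> pulls_back A g B h F"

definition conformal_metric ::
  "('m \<Rightarrow> real) \<Rightarrow> ('i, 'm, 'e) tensor2 \<Rightarrow> ('i, 'm, 'e) tensor2" where
  "conformal_metric f g = (\<lambda>i p v w. f p * g i p v w)"

definition C1_curve_on ::
  "('i, 'm::topological_space, 'e::euclidean_space) atlas \<Rightarrow> real \<Rightarrow> real \<Rightarrow> (real \<Rightarrow> 'm) \<Rightarrow> bool"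
  where
  "C1_curve_on A a b \<gamma> \<longleftrightarrow>
     continuous_on {a..b} \<gamma> \<and> \<gamma> ` {a..b} \<subseteq> carrier A \<and>
     (\<forall>i\<in>indices A. \<exists>D. continuous_on {t\<in>{a..b}. \<gamma> t \<in> chart_dom A i} D \<and>
        (\<forall>t\<in>{a..b}. \<gamma> t \<in> chart_dom A i \<longrightarrow>
           ((chart_map A i \<circ> \<gamma>) has_vector_derivative D t) (at t within {a..b})))"

definition piecewise_C1_curve ::
  "('i, 'm::topological_space, 'e::euclidean_space) atlas \<Rightarrow> (real \<Rightarrow> 'm) \<Rightarrow> bool" where
  "piecewise_C1_curve A \<gamma> \<longleftrightarrow>
     continuous_on {0..1} \<gamma> \<and> \<gamma> ` {0..1} \<subseteq> carrier A \<and>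
     (\<exists>S. finite S \<and>
        (\<forall>a b. 0 \<le> a \<and> a < b \<and> b \<le> 1 \<and> {a<..<b} \<inter> S = {} \<longrightarrow> C1_curve_on A a b \<gamma>))"

text \<open>By \<open>pulls_back A g A g id\<close> neither the speed here nor the scalar curvature below
  depends on the chosen chart.\<close>

definition some_chart :: "('i, 'm, 'e) atlas \<Rightarrow> 'm \<Rightarrow> 'i" where
  "some_chart A p = (SOME i. i \<in> indices A \<and> p \<in> chart_dom A i)"

definition speed ::
  "('i, 'm, 'e::euclidean_space) atlas \<Rightarrow> ('i, 'm, 'e) tensor2 \<Rightarrow> (real \<Rightarrow> 'm) \<Rightarrow> real \<Rightarrow> real"
  where
  "speed A g \<gamma> t =
     (let i = some_chart A (\<gamma> t); v = vector_derivative (chart_map A i \<circ> \<gamma>) (at t)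
      in sqrt (g i (\<gamma> t) v v))"

definition curve_length ::
  "('i, 'm, 'e::euclidean_space) atlas \<Rightarrow> ('i, 'm, 'e) tensor2 \<Rightarrow> (real \<Rightarrow> 'm) \<Rightarrow> real" where
  "curve_length A g \<gamma> = integral {0..1} (speed A g \<gamma>)"

definition riemannian_dist ::
  "('i, 'm::topological_space, 'e::euclidean_space) atlas \<Rightarrow> ('i, 'm, 'e) tensor2 \<Rightarrow>
   'm \<Rightarrow> 'm \<Rightarrow> real" where
  "riemannian_dist A g p q =
     Inf {curve_length A g \<gamma> |\<gamma>. piecewise_C1_curve A \<gamma> \<and> \<gamma> 0 = p \<and> \<gamma> 1 = q}"

definition complete_metric ::
  "('i, 'm::topological_space, 'e::euclidean_space) atlas \<Rightarrow> ('i, 'm, 'e) tensor2 \<Rightarrow> bool" where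
  "complete_metric A g \<longleftrightarrow>
     (\<forall>s::nat \<Rightarrow> 'm. range s \<subseteq> carrier A \<and>
        (\<forall>\<epsilon>>0. \<exists>k0. \<forall>k\<ge>k0. \<forall>l\<ge>k0. riemannian_dist A g (s k) (s l) < \<epsilon>) \<longrightarrow>
        (\<exists>p\<in>carrier A. (\<lambda>k. riemannian_dist A g (s k) p) \<longlonglongrightarrow> 0))"

definition unbounded_in ::
  "('i, 'm::topological_space, 'e::euclidean_space) atlas \<Rightarrow> ('i, 'm, 'e) tensor2 \<Rightarrow>
   'm set \<Rightarrow> bool" where
  "unbounded_in A g E \<longleftrightarrow> \<not> (\<exists>C. \<forall>p\<in>E. \<forall>q\<in>E. riemannian_dist A g p q \<le> C)"

text \<open>
  Below, \<open>h x v w\<close> is a metric on an open subset of the model space \<open>'e\<close>, the coordinate vector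
  fields are the elements of \<open>Basis\<close>, and indices range over \<open>Basis\<close>.
  \<open>christoffel h x i j k\<close> is \<open>\<Gamma>\<^sup>k\<^sub>i\<^sub>j\<close>. \<open>riemann h x i j k l\<close> is the \<open>l\<close>-th component of
  \<open>R(\<partial>\<^sub>i, \<partial>\<^sub>j)\<partial>\<^sub>k = \<nabla>\<^sub>i\<nabla>\<^sub>j\<partial>\<^sub>k - \<nabla>\<^sub>j\<nabla>\<^sub>i\<partial>\<^sub>k\<close>. \<open>ricci h x j k\<close> is the trace of
  \<open>X \<mapsto> R(X, \<partial>\<^sub>j)\<partial>\<^sub>k\<close>. With these signs round spheres have positive scalar curvature.
\<close>

definition partial_deriv :: "('e::euclidean_space \<Rightarrow> real) \<Rightarrow> 'e \<Rightarrow> 'e \<Rightarrow> real" where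
  "partial_deriv f i x = frechet_derivative f (at x) i"

text \<open>The inverse matrix of \<open>h x\<close>, via the inverse of the map \<open>v \<mapsto> \<Sum>b. h x v b *\<^sub>R b\<close>.\<close>

definition inverse_metric ::
  "('e::euclidean_space \<Rightarrow> 'e \<Rightarrow> 'e \<Rightarrow> real) \<Rightarrow> 'e \<Rightarrow> 'e \<Rightarrow> 'e \<Rightarrow> real" where
  "inverse_metric h x k l = inv (\<lambda>v. \<Sum>b\<in>Basis. h x v b *\<^sub>R b) k \<bullet> l"

definition christoffel ::
  "('e::euclidean_space \<Rightarrow> 'e \<Rightarrow> 'e \<Rightarrow> real) \<Rightarrow> 'e \<Rightarrow> 'e \<Rightarrow> 'e \<Rightarrow> 'e \<Rightarrow> real" where
  "christoffel h x i j k =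
     (1 / 2) * (\<Sum>l\<in>Basis. inverse_metric h x k l *
        (partial_deriv (\<lambda>y. h y j l) i x + partial_deriv (\<lambda>y. h y i l) j x
         - partial_deriv (\<lambda>y. h y i j) l x))"

definition riemann ::
  "('e::euclidean_space \<Rightarrow> 'e \<Rightarrow> 'e \<Rightarrow> real) \<Rightarrow> 'e \<Rightarrow> 'e \<Rightarrow> 'e \<Rightarrow> 'e \<Rightarrow> 'e \<Rightarrow> real" where
  "riemann h x i j k l =
     partial_deriv (\<lambda>y. christoffel h y j k l) i x - partial_deriv (\<lambda>y. christoffel h y i k l) j x
     + (\<Sum>m\<in>Basis. christoffel h x j k m * christoffel h x i m l
                   - christoffel h x i k m * christoffel h x j m l)"

definition ricci ::
  "('e::euclidean_space \<Rightarrow> 'e \<Rightarrow> 'e \<Rightarrow> real) \<Rightarrow> 'e \<Rightarrow> 'e \<Rightarrow> 'e \<Rightarrow> real" where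
  "ricci h x j k = (\<Sum>i\<in>Basis. riemann h x i j k i)"

definition coord_scalar_curvature ::
  "('e::euclidean_space \<Rightarrow> 'e \<Rightarrow> 'e \<Rightarrow> real) \<Rightarrow> 'e \<Rightarrow> real" where
  "coord_scalar_curvature h x =
     (\<Sum>j\<in>Basis. \<Sum>k\<in>Basis. inverse_metric h x j k * ricci h x j k)"

definition scalar_curvature ::
  "('i, 'm, 'e::euclidean_space) atlas \<Rightarrow> ('i, 'm, 'e) tensor2 \<Rightarrow> 'm \<Rightarrow> real" where
  "scalar_curvature A g p =
     (let i = some_chart A p
      in coord_scalar_curvature (\<lambda>x. g i (chart_inv A i x)) (chart_map A i p))"

definition hyp_cone :: "('j, 'k, 'f) atlas \<Rightarrow> ('j, real \<times> 'k, real \<times> 'f) atlas" where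
  "hyp_cone N =
     \<lparr>indices = indices N,
      chart_dom = (\<lambda>j. {0<..} \<times> chart_dom N j),
      chart_map = (\<lambda>j (r, x). (r, chart_map N j x))\<rparr>"

definition hyp_cone_metric ::
  "('j, 'k, 'f) tensor2 \<Rightarrow> ('j, real \<times> 'k, real \<times> 'f) tensor2" where
  "hyp_cone_metric gN = (\<lambda>j (r, x) (a, v) (b, w). a * b + (sinh r)\<^sup>2 * gN j x v w)"

definition truncated_hyp_cone ::
  "('j, 'k, 'f) atlas \<Rightarrow> real \<Rightarrow> ('j, real \<times> 'k, real \<times> 'f) atlas" where
  "truncated_hyp_cone N r0 = open_submanifold (hyp_cone N) ({r0<..} \<times> carrier N)"

definition is_end ::
  "('i, 'm::topological_space, 'e::euclidean_space) atlas \<Rightarrow> ('i, 'm, 'e) tensor2 \<Rightarrow>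
   'm set \<Rightarrow> bool" where
  "is_end A g E \<longleftrightarrow>
     (\<exists>K. compact K \<and> K \<subseteq> carrier A \<and> E \<in> components (carrier A - K)) \<and> unbounded_in A g E"

text \<open>\<open>F\<close> is the isometry by which the end \<open>E\<close> of the manifold is identified with
  \<open>(r0, \<infinity>) \<times> N\<close>.\<close>

definition hyperbolic_conical_end ::
  "('i, 'm::topological_space, 'e::euclidean_space) atlas \<Rightarrow> ('i, 'm, 'e) tensor2 \<Rightarrow>
   ('j, 'k::topological_space, 'f::euclidean_space) atlas \<Rightarrow> ('j, 'k, 'f) tensor2 \<Rightarrow>
   real \<Rightarrow> 'm set \<Rightarrow> (real \<times> 'k \<Rightarrow> 'm) \<Rightarrow> bool" where
  "hyperbolic_conical_end A g N gN r0 E F \<longleftrightarrow>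
     r0 \<ge> 0 \<and> is_end A g E \<and>
     riemannian_isometry (truncated_hyp_cone N r0) (hyp_cone_metric gN) (open_submanifold A E) g F"

end

(* The idea. A bounded limsup gives u^(4/(n-2)) <= C e^(-alpha) on the end, hence a bound
   u^(4/(n-2)) |S~| <= C0. By the conformal change formula this says, at points where u is compared
   with a radial function, that u is a supersolution of a linear equation with bounded coefficients.
   The maximum principle, with the radial barrier e^(-Kr) - e^(-KR) on [r1, R), yields
   u >= eps e^(-Kr) for some K, which contradicts alpha(r) / r --> infinity.

   No warped-product curvature is needed: dr^2 + sinh^2 r gN = sinh^2 r (dr^2 / sinh^2 r + gN), and
   the metric in brackets has the scalar curvature of gN because its radial factor is flat. So the
   conformal metric is e^(2w) (dr^2 / sinh^2 r + gN) with w = 2/(n-2) ln u + ln sinh r. *)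

theory Submission
  imports Defs
begin

text \<open>Nothing is known about u near infinity, so the comparison is made on bounded regions:
  the barrier vanishes at R, which keeps the minimum of the quotient of u by the barrier away from
  the outer end, while K does not depend on R. At such a minimum the Hessian of the logarithm of the
  quotient has nonnegative trace, and what remains is an ordinary differential expression in r. The
  factor 2/(n-2) in front of ln u makes the squares of the logarithmic derivative of the barrier
  cancel there, so that a large K wins.

  The obstacle is that \<open>scalar_curvature\<close> is a coordinate formula taken in an
  arbitrarily chosen chart of M. It is therefore rewritten with the vector-valued expressions
  \<open>Gam\<close> and \<open>Riem\<close>, which accept arbitrary vectors in place of basis
  indices; invariance under local isometries and the conformal transformation law become identities
  between them. Smoothness is a condition on iterated derivatives in fixed directions, so families
  of linear maps are treated by expanding their arguments in \<open>Basis\<close>.\<close>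

section \<open>Calculus of \<open>Ck_on\<close>\<close>

abbreviation dderiv ::
  "('a::real_normed_vector \<Rightarrow> 'b::real_normed_vector) \<Rightarrow> 'a \<Rightarrow> 'a \<Rightarrow> 'b" where
  "dderiv f x \<equiv> frechet_derivative f (at x)"

lemma dderivI: "(f has_derivative f') (at x) \<Longrightarrow> dderiv f x = f'"
  by (metis frechet_derivative_at)

lemma Ck_on_imp_continuous_on: "Ck_on k S f \<Longrightarrow> continuous_on S f"
  by (cases k) (auto intro!: continuous_at_imp_continuous_on differentiable_imp_continuous_within)

lemma Ck_on_SucD: "Ck_on (Suc k) S f \<Longrightarrow> Ck_on k S f"
proof (induction k arbitrary: f)
  case 0
  show ?case using Ck_on_imp_continuous_on[OF 0] by simp
next
  case (Suc k)
  then show ?case by (metis Ck_on.simps(2))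
qed

text \<open>On an open set agreement holds near each point, so the derivatives taken
  \<open>at x\<close> agree as well and the induction can pass to
  \<open>dderiv f x v\<close>.\<close>

lemma Ck_on_cong:
  assumes "open S" and "\<And>x. x \<in> S \<Longrightarrow> f x = g x" and "Ck_on k S f"
  shows "Ck_on k S g"
  using assms(2,3)
proof (induction k arbitrary: f g)
  case 0
  then show ?case by (auto cong: continuous_on_cong)
next
  case (Suc k)
  have d: "(g has_derivative dderiv f x) (at x)" if "x \<in> S" for x
  proof -
    have "(f has_derivative dderiv f x) (at x)"
      using Suc.prems that by (auto simp: frechet_derivative_works[symmetric])
    then show ?thesis
      using has_derivative_transform_within_open[OF _ assms(1) that] Suc.prems(1) by metis
  qed
  have "Ck_on k S (\<lambda>x. dderiv g x v)" for v
    by (rule Suc.IH[of "\<lambda>x. dderiv f x v"]) (use Suc.prems(2) d dderivI in \<open>fastforce+\<close>)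
  then show ?case using d by (auto simp: differentiable_def)
qed

lemma Ck_on_subset: "Ck_on k S f \<Longrightarrow> T \<subseteq> S \<Longrightarrow> Ck_on k T f"
  by (induction k arbitrary: f) (auto intro: continuous_on_subset)

text \<open>Regularity is local. This glues smoothness over the pieces of a coordinate domain that
  are mapped into single charts.\<close>

lemma Ck_on_UN:
  assumes "\<And>i. i \<in> I \<Longrightarrow> open (S i)" and "\<And>i. i \<in> I \<Longrightarrow> Ck_on k (S i) f"
  shows "Ck_on k (\<Union>i\<in>I. S i) f"
  using assms
  by (induction k arbitrary: f) (auto intro: continuous_on_open_UN)

lemma Ck_on_const: "Ck_on k S (\<lambda>x. c)"
  by (induction k arbitrary: c) auto

lemma Ck_on_SucI:
  assumes "open S" and "\<And>x. x \<in> S \<Longrightarrow> (f has_derivative f' x) (at x)"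
    and "\<And>v. Ck_on k S (\<lambda>x. f' x v)"
  shows "Ck_on (Suc k) S f"
proof -
  have "Ck_on k S (\<lambda>x. dderiv f x v)" for v
    using assms dderivI by (intro Ck_on_cong[OF assms(1) _ assms(3)[of v]]) fastforce
  then show ?thesis using assms(2) by (auto simp: differentiable_def)
qed

lemma Ck_on_SucE:
  assumes "Ck_on (Suc k) S f"
  shows "\<And>x. x \<in> S \<Longrightarrow> (f has_derivative dderiv f x) (at x)"
    and "\<And>v. Ck_on k S (\<lambda>x. dderiv f x v)" and "Ck_on k S f"
  using assms Ck_on_SucD[OF assms] by (auto simp: frechet_derivative_works[symmetric])

lemma Ck_on_add:
  assumes "open S" "Ck_on k S f" "Ck_on k S g" shows "Ck_on k S (\<lambda>x. f x + g x)"
  using assms(2,3)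
proof (induction k arbitrary: f g)
  case (Suc k)
  show ?case
    by (rule Ck_on_SucI[OF assms(1)]) (rule has_derivative_add Ck_on_SucE[OF Suc.prems(1)]
      Ck_on_SucE[OF Suc.prems(2)] Suc.IH | assumption)+
qed (auto intro: continuous_intros)

lemma (in bounded_linear) Ck_on_bounded_linear:
  assumes "open S" "Ck_on k S g" shows "Ck_on k S (\<lambda>x. f (g x))"
  using assms(2)
proof (induction k arbitrary: g)
  case (Suc k)
  show ?case
    by (rule Ck_on_SucI[OF assms(1)])
      (rule has_derivative Ck_on_SucE[OF Suc.prems] Suc.IH | assumption)+
qed (auto intro: continuous_on)

lemma (in bounded_bilinear) Ck_on_bounded_bilinear:
  assumes "open S" "Ck_on k S f" "Ck_on k S g" shows "Ck_on k S (\<lambda>x. prod (f x) (g x))"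
  using assms(2,3)
proof (induction k arbitrary: f g)
  case (Suc k)
  show ?case
    by (rule Ck_on_SucI[OF assms(1)])
      (rule FDERIV Ck_on_SucE[OF Suc.prems(1)] Ck_on_SucE[OF Suc.prems(2)] Ck_on_add[OF assms(1)]
        Suc.IH | assumption)+
qed (auto intro: continuous_on)

lemma Ck_on_sum:
  assumes "open S" "finite I" "\<And>i. i \<in> I \<Longrightarrow> Ck_on k S (f i)"
  shows "Ck_on k S (\<lambda>x. \<Sum>i\<in>I. f i x)"
  using assms(2,3)
  by (induction I rule: finite_induct) (auto intro: Ck_on_add[OF assms(1)] Ck_on_const)

lemma Ck_on_id:
  assumes "open S" shows "Ck_on k S (\<lambda>x. x)"
  by (cases k) (auto intro: Ck_on_const)

text \<open>In the chain rule the argument \<open>dderiv f x v\<close> of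
  \<open>dderiv g (f x)\<close> varies with x, whereas \<open>Ck_on\<close> only controls
  derivatives in fixed directions. Expanding this argument in \<open>Basis\<close> leaves products
  of components of \<open>dderiv f x v\<close> with \<open>dderiv g (f x) b\<close> for fixed b, to
  which the induction hypothesis applies.\<close>

lemma Ck_on_compose:
  fixes f :: "'a::real_normed_vector \<Rightarrow> 'b::euclidean_space"
  assumes "open S" "open T" "f ` S \<subseteq> T" "Ck_on k S f" "Ck_on k T g"
  shows "Ck_on k S (\<lambda>x. g (f x))"
  using assms(4,5)
proof (induction k arbitrary: g)
  case 0
  then show ?case using continuous_on_compose2 assms(3) by (metis Ck_on.simps(1))
next
  case (Suc k)
  have *: "((\<lambda>x. g (f x)) has_derivative
      (\<lambda>v. \<Sum>b\<in>Basis. (dderiv f x v \<bullet> b) *\<^sub>R dderiv g (f x) b)) (at x)" if "x \<in> S" for x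
  proof -
    have g: "(g has_derivative dderiv g (f x)) (at (f x))"
      using Ck_on_SucE(1)[OF Suc.prems(2)] assms(3) that by blast
    have "((\<lambda>x. g (f x)) has_derivative (\<lambda>v. dderiv g (f x) (dderiv f x v))) (at x)"
      by (rule has_derivative_compose[OF Ck_on_SucE(1)[OF Suc.prems(1) that] g])
    then show ?thesis
    proof (rule has_derivative_eq_rhs, intro ext)
      fix v
      let ?w = "dderiv f x v"
      have "dderiv g (f x) ?w = dderiv g (f x) (\<Sum>b\<in>Basis. (?w \<bullet> b) *\<^sub>R b)"
        by (simp only: euclidean_representation)
      also have "\<dots> = (\<Sum>b\<in>Basis. (?w \<bullet> b) *\<^sub>R dderiv g (f x) b)"
        using has_derivative_linear[OF g] by (simp only: linear_sum linear_cmul)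
      finally show "dderiv g (f x) ?w = (\<Sum>b\<in>Basis. (?w \<bullet> b) *\<^sub>R dderiv g (f x) b)" .
    qed
  qed
  have f: "Ck_on k S (\<lambda>x. dderiv f x v \<bullet> b)" for v b
    by (rule bounded_linear.Ck_on_bounded_linear[OF bounded_linear_inner_left assms(1)
          Ck_on_SucE(2)[OF Suc.prems(1)]])
  have g: "Ck_on k S (\<lambda>x. dderiv g (f x) b)" for b
    by (rule Suc.IH[OF Ck_on_SucE(3)[OF Suc.prems(1)] Ck_on_SucE(2)[OF Suc.prems(2)]])
  have "Ck_on k S (\<lambda>x. \<Sum>b\<in>Basis. (dderiv f x v \<bullet> b) *\<^sub>R dderiv g (f x) b)" for v
    by (rule Ck_on_sum[OF assms(1) finite_Basis],
        rule bounded_bilinear.Ck_on_bounded_bilinear[OF bounded_bilinear_scaleR assms(1) f g])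
  with * show ?case
    by (rule Ck_on_SucI[OF assms(1), where f'="\<lambda>x v. \<Sum>b\<in>Basis. (dderiv f x v \<bullet> b) *\<^sub>R dderiv g (f x) b"])
qed

subsection \<open>Smooth functions\<close>

lemma smooth_on_imp_continuous_on: "smooth_on S f \<Longrightarrow> continuous_on S f"
  unfolding smooth_on_def using Ck_on_imp_continuous_on by blast

lemma smooth_on_has_derivative:
  "smooth_on S f \<Longrightarrow> x \<in> S \<Longrightarrow> (f has_derivative dderiv f x) (at x)"
  unfolding smooth_on_def using Ck_on_SucE(1) by blast

lemma smooth_on_dderiv: "smooth_on S f \<Longrightarrow> smooth_on S (\<lambda>x. dderiv f x v)"
  unfolding smooth_on_def using Ck_on_SucE(2) by blast

lemma smooth_on_cong:
  "open S \<Longrightarrow> (\<And>x. x \<in> S \<Longrightarrow> f x = g x) \<Longrightarrow> smooth_on S f \<Longrightarrow> smooth_on S g"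
  unfolding smooth_on_def using Ck_on_cong by blast

lemma smooth_on_subset: "smooth_on S f \<Longrightarrow> T \<subseteq> S \<Longrightarrow> smooth_on T f"
  unfolding smooth_on_def using Ck_on_subset by blast

lemma smooth_on_UN:
  "(\<And>i. i \<in> I \<Longrightarrow> open (S i)) \<Longrightarrow> (\<And>i. i \<in> I \<Longrightarrow> smooth_on (S i) f) \<Longrightarrow>
    smooth_on (\<Union>i\<in>I. S i) f"
  unfolding smooth_on_def by (auto intro: Ck_on_UN)

lemma smooth_on_const: "smooth_on S (\<lambda>x. c)"
  unfolding smooth_on_def using Ck_on_const by blast

lemma smooth_on_id: "open S \<Longrightarrow> smooth_on S (\<lambda>x. x)"
  unfolding smooth_on_def using Ck_on_id by blast

lemma smooth_on_add: "open S \<Longrightarrow> smooth_on S f \<Longrightarrow> smooth_on S g \<Longrightarrow> smooth_on S (\<lambda>x. f x + g x)"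
  unfolding smooth_on_def using Ck_on_add by blast

lemma smooth_on_sum:
  "open S \<Longrightarrow> finite I \<Longrightarrow> (\<And>i. i \<in> I \<Longrightarrow> smooth_on S (f i)) \<Longrightarrow> smooth_on S (\<lambda>x. \<Sum>i\<in>I. f i x)"
  unfolding smooth_on_def using Ck_on_sum by blast

lemma smooth_on_bounded_linear:
  "open S \<Longrightarrow> bounded_linear L \<Longrightarrow> smooth_on S f \<Longrightarrow> smooth_on S (\<lambda>x. L (f x))"
  unfolding smooth_on_def using bounded_linear.Ck_on_bounded_linear by blast

lemma smooth_on_bounded_bilinear:
  "open S \<Longrightarrow> bounded_bilinear B \<Longrightarrow> smooth_on S f \<Longrightarrow> smooth_on S g \<Longrightarrow>
    smooth_on S (\<lambda>x. B (f x) (g x))"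
  unfolding smooth_on_def using bounded_bilinear.Ck_on_bounded_bilinear by blast

lemmas smooth_on_mult =
  smooth_on_bounded_bilinear[OF _ bounded_bilinear_mult[where 'a=real]]
lemmas smooth_on_scaleR = smooth_on_bounded_bilinear[OF _ bounded_bilinear_scaleR]
lemmas smooth_on_inner = smooth_on_bounded_bilinear[OF _ bounded_bilinear_inner]

lemma smooth_on_minus: "open S \<Longrightarrow> smooth_on S f \<Longrightarrow> smooth_on S (\<lambda>x. - f x)"
  by (rule smooth_on_bounded_linear[OF _ bounded_linear_minus[OF bounded_linear_ident]])

lemma smooth_on_diff: "open S \<Longrightarrow> smooth_on S f \<Longrightarrow> smooth_on S g \<Longrightarrow> smooth_on S (\<lambda>x. f x - g x)"
  using smooth_on_add[of S f "\<lambda>x. - g x"] smooth_on_minus[of S g] by simp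

lemma smooth_on_compose:
  fixes f :: "'a::real_normed_vector \<Rightarrow> 'b::euclidean_space"
  shows "open S \<Longrightarrow> open T \<Longrightarrow> f ` S \<subseteq> T \<Longrightarrow> smooth_on S f \<Longrightarrow> smooth_on T g \<Longrightarrow>
    smooth_on S (\<lambda>x. g (f x))"
  unfolding smooth_on_def using Ck_on_compose by blast

lemma smooth_on_exp: "smooth_on UNIV (exp :: real \<Rightarrow> real)"
proof -
  have "Ck_on k UNIV (exp :: real \<Rightarrow> real)" for k
  proof (induction k)
    case (Suc k)
    show ?case
      by (rule Ck_on_SucI[where f'="\<lambda>x v. v *\<^sub>R exp x"])
        (auto intro!: derivative_eq_intros bounded_linear.Ck_on_bounded_linear[OF bounded_linear_scaleR_right] Suc
          bounded_linear.Ck_on_bounded_linear[OF bounded_linear_mult_right])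
  qed (auto intro: continuous_intros)
  then show ?thesis by (simp add: smooth_on_def)
qed

text \<open>The derivative is a polynomial in \<open>inverse\<close> itself, so each order of
  regularity yields the next.\<close>

lemma smooth_on_inverse: "smooth_on {0<..} (inverse :: real \<Rightarrow> real)"
proof -
  have "Ck_on k {0<..} (inverse :: real \<Rightarrow> real)" for k
  proof (induction k)
    case (Suc k)
    have "Ck_on k {0<..} (\<lambda>x. (- v) * (inverse x * inverse x))" for v :: real
      by (intro bounded_linear.Ck_on_bounded_linear[OF bounded_linear_mult_right]
          bounded_bilinear.Ck_on_bounded_bilinear[OF bounded_bilinear_mult] Suc open_greaterThan)
    then show ?case
      by (intro Ck_on_SucI[where f'="\<lambda>x v. (- v) * (inverse x * inverse x)"])
        (auto intro!: derivative_eq_intros)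
  qed (auto intro!: continuous_intros)
  then show ?thesis by (simp add: smooth_on_def)
qed

lemma smooth_on_ln: "smooth_on {0<..} (ln :: real \<Rightarrow> real)"
proof -
  have "Ck_on k {0<..} (ln :: real \<Rightarrow> real)" for k
  proof (cases k)
    case (Suc k)
    have "Ck_on k {0<..} (\<lambda>x. v * inverse x)" for v :: real
      using smooth_on_inverse unfolding smooth_on_def
      by (intro bounded_linear.Ck_on_bounded_linear[OF bounded_linear_mult_right]) auto
    then show ?thesis unfolding Suc
      by (intro Ck_on_SucI[where f'="\<lambda>x v. v * inverse x"])
        (auto intro!: derivative_eq_intros)
  qed (auto intro!: continuous_intros)
  then show ?thesis by (simp add: smooth_on_def)
qed

lemma smooth_on_exp_compose: "open S \<Longrightarrow> smooth_on S f \<Longrightarrow> smooth_on S (\<lambda>x. exp (f x :: real))"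
  using smooth_on_compose[OF _ open_UNIV _ _ smooth_on_exp] by blast

lemma smooth_on_ln_compose:
  "open S \<Longrightarrow> smooth_on S f \<Longrightarrow> (\<And>x. x \<in> S \<Longrightarrow> f x > 0) \<Longrightarrow> smooth_on S (\<lambda>x. ln (f x :: real))"
  using smooth_on_compose[OF _ open_greaterThan _ _ smooth_on_ln] by blast

lemma smooth_on_inverse_compose:
  "open S \<Longrightarrow> smooth_on S f \<Longrightarrow> (\<And>x. x \<in> S \<Longrightarrow> f x > 0) \<Longrightarrow> smooth_on S (\<lambda>x. inverse (f x :: real))"
  using smooth_on_compose[OF _ open_greaterThan _ _ smooth_on_inverse] by blast

lemma smooth_on_sinh_compose:
  "open S \<Longrightarrow> smooth_on S f \<Longrightarrow> smooth_on S (\<lambda>x. sinh (f x :: real))"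
  unfolding sinh_def scaleR_conv_of_real
  by (intro smooth_on_mult smooth_on_const smooth_on_diff smooth_on_exp_compose smooth_on_minus)

subsection \<open>Second derivatives\<close>

lemma smooth_on_line_deriv:
  fixes k :: "'a::real_normed_vector \<Rightarrow> real"
  assumes "smooth_on U k" "y + a *\<^sub>R z \<in> U"
  shows "((\<lambda>a. k (y + a *\<^sub>R z)) has_real_derivative dderiv k (y + a *\<^sub>R z) z) (at a)"
proof -
  note k = smooth_on_has_derivative[OF assms]
  have "((\<lambda>a. k (y + a *\<^sub>R z)) has_derivative (\<lambda>t. dderiv k (y + a *\<^sub>R z) (t *\<^sub>R z))) (at a)"
    by (rule has_derivative_compose[of "\<lambda>a. y + a *\<^sub>R z" "\<lambda>t. t *\<^sub>R z" a UNIV k, OF _ k])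
      (auto intro!: derivative_eq_intros)
  then show ?thesis
    by (simp add: has_field_derivative_def mult_commute_abs linear_cmul[OF has_derivative_linear[OF k]])
qed

text \<open>The second difference over the parallelogram spanned by s v and s w does not depend on
  the order of v and w. Two applications of the mean value theorem, one in each direction, turn it
  into a second derivative at an intermediate point.\<close>

lemma smooth_on_mixed_mvt:
  fixes f :: "'a::real_normed_vector \<Rightarrow> real"
  assumes f: "smooth_on U f" and s: "s > 0"
    and U: "\<And>a b. 0 \<le> a \<Longrightarrow> a \<le> s \<Longrightarrow> 0 \<le> b \<Longrightarrow> b \<le> s \<Longrightarrow> x + a *\<^sub>R v + b *\<^sub>R w \<in> U"
  shows "\<exists>a b. 0 < a \<and> a < s \<and> 0 < b \<and> b < s \<and>
    f (x + s *\<^sub>R v + s *\<^sub>R w) - f (x + s *\<^sub>R v) - f (x + s *\<^sub>R w) + f x =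
    s * s * dderiv (\<lambda>y. dderiv f y v) (x + a *\<^sub>R v + b *\<^sub>R w) w"
proof -
  \<comment> \<open>The difference in direction w, as a function of the position along v.\<close>
  define p where "p = (\<lambda>a. f (x + s *\<^sub>R w + a *\<^sub>R v) - f (x + a *\<^sub>R v))"
  have "\<exists>a. 0 < a \<and> a < s \<and> p s - p 0 = (s - 0) *
      (dderiv f (x + s *\<^sub>R w + a *\<^sub>R v) v - dderiv f (x + a *\<^sub>R v) v)"
    unfolding p_def
  proof (rule MVT2[OF s])
    fix a assume "0 \<le> a" "a \<le> s"
    then show "((\<lambda>a. f (x + s *\<^sub>R w + a *\<^sub>R v) - f (x + a *\<^sub>R v)) has_real_derivative
         dderiv f (x + s *\<^sub>R w + a *\<^sub>R v) v - dderiv f (x + a *\<^sub>R v) v) (at a)"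
      using U[of a s] U[of a 0] s f by (intro DERIV_diff smooth_on_line_deriv f) (auto simp: algebra_simps)
  qed
  then obtain a where a: "0 < a" "a < s" "p s - p 0 = s *
      (dderiv f (x + s *\<^sub>R w + a *\<^sub>R v) v - dderiv f (x + a *\<^sub>R v) v)" by auto
  have "\<exists>b. 0 < b \<and> b < s \<and>
     dderiv f (x + a *\<^sub>R v + s *\<^sub>R w) v - dderiv f (x + a *\<^sub>R v + 0 *\<^sub>R w) v =
     (s - 0) * dderiv (\<lambda>y. dderiv f y v) (x + a *\<^sub>R v + b *\<^sub>R w) w"
    by (rule MVT2[OF s]) (use a U in \<open>auto intro!: smooth_on_line_deriv smooth_on_dderiv f\<close>)
  then obtain b where "0 < b" "b < s"
     "dderiv f (x + a *\<^sub>R v + s *\<^sub>R w) v - dderiv f (x + a *\<^sub>R v + 0 *\<^sub>R w) v =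
     s * dderiv (\<lambda>y. dderiv f y v) (x + a *\<^sub>R v + b *\<^sub>R w) w" by auto
  then show ?thesis using a unfolding p_def by (intro exI[of _ a] exI[of _ b]) (auto simp: algebra_simps)
qed

text \<open>Schwarz's theorem: for both orders the same second difference equals s * s times a mixed
  derivative near x, so by continuity the two mixed derivatives at x cannot differ.\<close>

lemma smooth_on_dderiv_commute_real:
  fixes f :: "'a::real_normed_vector \<Rightarrow> real"
  assumes "open U" "x \<in> U" and f: "smooth_on U f"
  shows "dderiv (\<lambda>y. dderiv f y v) x w = dderiv (\<lambda>y. dderiv f y w) x v"
proof (rule ccontr)
  define P where "P = (\<lambda>y. dderiv (\<lambda>y. dderiv f y v) y w)"
  define Q where "Q = (\<lambda>y. dderiv (\<lambda>y. dderiv f y w) y v)"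
  assume "dderiv (\<lambda>y. dderiv f y v) x w \<noteq> dderiv (\<lambda>y. dderiv f y w) x v"
  then have e: "\<bar>P x - Q x\<bar> / 2 > 0" (is "?e > 0") by (simp add: P_def Q_def)
  have "continuous_on U P" "continuous_on U Q"
    unfolding P_def Q_def by (intro smooth_on_imp_continuous_on smooth_on_dderiv f)+
  then obtain d1 d2 where d: "d1 > 0" "d2 > 0"
    "\<And>y. y \<in> U \<Longrightarrow> dist y x < d1 \<Longrightarrow> dist (P y) (P x) < ?e"
    "\<And>y. y \<in> U \<Longrightarrow> dist y x < d2 \<Longrightarrow> dist (Q y) (Q x) < ?e"
    using assms(2) e unfolding continuous_on_iff by metis
  obtain d0 where d0: "d0 > 0" "ball x d0 \<subseteq> U" using assms open_contains_ball by blast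
  define r where "r = min d0 (min d1 d2)"
  have r: "r > 0" using d d0 by (auto simp: r_def)
  \<comment> \<open>Chosen so that the whole parallelogram lies within r of x; the summand 1 keeps
    the denominator positive when v and w both vanish.\<close>
  define s where "s = r / (2 * (norm v + norm w + 1))"
  have s: "s > 0" using r unfolding s_def by (auto intro!: divide_pos_pos add_nonneg_pos)
  have near: "dist (x + a *\<^sub>R v + b *\<^sub>R w) x < r" if "0 \<le> a" "a \<le> s" "0 \<le> b" "b \<le> s" for a b
  proof -
    have "norm (a *\<^sub>R v + b *\<^sub>R w) \<le> s * norm v + s * norm w"
      using that by (intro norm_triangle_le) (auto intro!: add_mono mult_right_mono)
    also have "\<dots> \<le> s * (norm v + norm w + 1)" using s by (simp add: algebra_simps)
    also have "\<dots> = r / 2" unfolding s_def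
      using add_pos_nonneg[OF zero_less_one, of "norm v + norm w"] by (auto simp: divide_simps)
    also have "\<dots> < r" using r by simp
    finally show ?thesis by (simp add: dist_norm add.assoc)
  qed
  then have U: "x + a *\<^sub>R v + b *\<^sub>R w \<in> U" if "0 \<le> a" "a \<le> s" "0 \<le> b" "b \<le> s" for a b
    using that d0 by (force simp: r_def dist_commute)
  have U': "x + a *\<^sub>R w + b *\<^sub>R v \<in> U" if "0 \<le> a" "a \<le> s" "0 \<le> b" "b \<le> s" for a b
    using U[of b a] that by (simp add: algebra_simps)
  obtain a b where ab: "0 < a" "a < s" "0 < b" "b < s"
    "f (x + s *\<^sub>R v + s *\<^sub>R w) - f (x + s *\<^sub>R v) - f (x + s *\<^sub>R w) + f x =
      s * s * P (x + a *\<^sub>R v + b *\<^sub>R w)"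
    using smooth_on_mixed_mvt[OF f s U] unfolding P_def by blast
  obtain a' b' where ab': "0 < a'" "a' < s" "0 < b'" "b' < s"
    "f (x + s *\<^sub>R w + s *\<^sub>R v) - f (x + s *\<^sub>R w) - f (x + s *\<^sub>R v) + f x =
      s * s * Q (x + a' *\<^sub>R w + b' *\<^sub>R v)"
    using smooth_on_mixed_mvt[OF f s U'] unfolding Q_def by blast
  have "s * s * P (x + a *\<^sub>R v + b *\<^sub>R w) = s * s * Q (x + a' *\<^sub>R w + b' *\<^sub>R v)"
    using ab(5) ab'(5) by (simp add: algebra_simps)
  then have "P (x + a *\<^sub>R v + b *\<^sub>R w) = Q (x + b' *\<^sub>R v + a' *\<^sub>R w)"
    using s by (simp add: algebra_simps)
  moreover have "dist (P (x + a *\<^sub>R v + b *\<^sub>R w)) (P x) < ?e"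
    using near[of a b] U[of a b] ab d by (auto simp: r_def)
  moreover have "dist (Q (x + b' *\<^sub>R v + a' *\<^sub>R w)) (Q x) < ?e"
    using near[of b' a'] U[of b' a'] ab' d by (auto simp: r_def)
  ultimately show False by (auto simp: dist_real_def abs_if split: if_splits)
qed

lemma dderiv_inner_left:
  assumes "smooth_on U f" "x \<in> U"
  shows "dderiv (\<lambda>y. f y \<bullet> c) x v = dderiv f x v \<bullet> c"
  using dderivI[OF bounded_linear.has_derivative[OF bounded_linear_inner_left
      smooth_on_has_derivative[OF assms], of c]] by simp

lemma smooth_on_dderiv_commute:
  fixes f :: "'a::real_normed_vector \<Rightarrow> 'b::euclidean_space"
  assumes "open U" "x \<in> U" and f: "smooth_on U f"
  shows "dderiv (\<lambda>y. dderiv f y v) x w = dderiv (\<lambda>y. dderiv f y w) x v"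
proof (rule euclidean_eqI)
  fix c :: 'b assume "c \<in> Basis"
  have g: "smooth_on U (\<lambda>y. f y \<bullet> c)" by (intro smooth_on_inner smooth_on_const assms)
  have "dderiv (\<lambda>y. dderiv f y v) x w \<bullet> c = dderiv (\<lambda>y. dderiv (\<lambda>y. f y \<bullet> c) y v) x w" for v w
  proof -
    have "dderiv (\<lambda>y. dderiv f y v \<bullet> c) x w = dderiv (\<lambda>y. dderiv (\<lambda>y. f y \<bullet> c) y v) x w"
      by (rule fun_cong[of _ _ w], rule frechet_derivative_transform_within_open[of _ _ U])
       (use assms dderiv_inner_left[OF f]
         differentiableI[OF smooth_on_has_derivative[OF smooth_on_inner[OF assms(1)
            smooth_on_dderiv[OF f] smooth_on_const]]] in auto)
    then show ?thesis using dderiv_inner_left[OF smooth_on_dderiv[OF f] assms(2)] by metis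
  qed
  then show "dderiv (\<lambda>y. dderiv f y v) x w \<bullet> c = dderiv (\<lambda>y. dderiv f y w) x v \<bullet> c"
    using smooth_on_dderiv_commute_real[OF assms(1,2) g] by metis
qed

text \<open>Along the line through x in direction v, a negative second derivative would make the
  first derivative negative just to the right of 0, and the mean value theorem would then produce a
  value below the minimum.\<close>

lemma local_min_second_deriv_nonneg:
  fixes f :: "'a::euclidean_space \<Rightarrow> real"
  assumes U: "open U" "x \<in> U" and f: "smooth_on U f" and min: "\<And>y. y \<in> U \<Longrightarrow> f x \<le> f y"
  shows "dderiv f x v = 0" and "dderiv (\<lambda>y. dderiv f y v) x v \<ge> 0"
proof -
  have "eventually (\<lambda>y. f x \<le> f y) (at x)"
    using eventually_at_in_open'[OF U] by eventually_elim (rule min)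
  then have 0: "dderiv f x = (\<lambda>h. 0)"
    using has_derivative_local_min[OF smooth_on_has_derivative[OF f U(2)]] by simp
  then show "dderiv f x v = 0" by simp
  define I where "I = (\<lambda>a. x + a *\<^sub>R v) -` U"
  have I: "open I" "0 \<in> I" unfolding I_def
    using U by (auto intro!: continuous_open_vimage continuous_intros)
  have d: "((\<lambda>a. k (x + a *\<^sub>R v)) has_real_derivative dderiv k (x + a *\<^sub>R v) v) (at a)"
    if "smooth_on U k" "a \<in> I" for k a
    by (rule smooth_on_line_deriv[OF that(1)]) (use that(2) in \<open>simp add: I_def\<close>)
  show "dderiv (\<lambda>y. dderiv f y v) x v \<ge> 0"
  proof (rule ccontr)
    assume "\<not> ?thesis"
    then have "dderiv (\<lambda>y. dderiv f y v) (x + 0 *\<^sub>R v) v < 0" by simp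
    then have "\<exists>e1>0. \<forall>h>0. h < e1 \<longrightarrow>
        dderiv f (x + (0 + h) *\<^sub>R v) v < dderiv f (x + 0 *\<^sub>R v) v"
      by (rule DERIV_neg_dec_right[OF d[OF smooth_on_dderiv[OF f, of v] I(2)]])
    then obtain e1 where e1: "e1 > 0"
      "\<forall>h>0. h < e1 \<longrightarrow> dderiv f (x + (0 + h) *\<^sub>R v) v < dderiv f (x + 0 *\<^sub>R v) v" by blast
    have e1': "dderiv f (x + h *\<^sub>R v) v < 0" if "0 < h" "h < e1" for h
      using e1(2) that by (simp add: 0)
    obtain e2 where e2: "e2 > 0" "ball 0 e2 \<subseteq> I" using I open_contains_ball by blast
    define h where "h = min e1 e2 / 2"
    have h: "0 < h" "h < e1" "h < e2" using e1 e2 by (auto simp: h_def)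
    have hI: "a \<in> I" if "0 \<le> a" "a \<le> h" for a using that e2 h by force
    have "\<exists>z>0. z < h \<and>
        f (x + h *\<^sub>R v) - f (x + 0 *\<^sub>R v) = (h - 0) * dderiv f (x + z *\<^sub>R v) v"
      by (rule MVT2[OF h(1)]) (rule d[OF f hI])
    then obtain z where z: "0 < z" "z < h"
        "f (x + h *\<^sub>R v) - f x = h * dderiv f (x + z *\<^sub>R v) v" by auto
    have "h * dderiv f (x + z *\<^sub>R v) v < 0"
      using e1'[of z] z h by (auto intro: mult_pos_neg)
    then have "f (x + h *\<^sub>R v) < f x" using z(3) by simp
    moreover have "x + h *\<^sub>R v \<in> U" using hI[of h] h by (simp add: I_def)
    ultimately show False using min[of "x + h *\<^sub>R v"] by simp
  qed
qed

subsection \<open>Families of linear maps depending smoothly on a point\<close>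

lemma dderiv_cong:
  assumes "open U" "x \<in> U" "smooth_on U f" "\<And>y. y \<in> U \<Longrightarrow> f y = g y"
  shows "dderiv f x = dderiv g x"
  by (rule frechet_derivative_transform_within_open[OF
        differentiableI[OF smooth_on_has_derivative[OF assms(3,2)]] assms(1,2,4)])

text \<open>Differentiation in the parameter commutes with linear operations on the argument; this
  makes the derivatives of a metric and of \<open>Gam\<close> multilinear in all their
  slots.\<close>

lemma linear_dderiv_param:
  assumes U: "open U" "x \<in> U" and lin: "\<And>y. y \<in> U \<Longrightarrow> linear (F y)"
    and smooth: "\<And>w. smooth_on U (\<lambda>y. F y w)"
  shows "linear (\<lambda>w. dderiv (\<lambda>y. F y w) x v)"
proof (rule linearI)
  note d = smooth_on_has_derivative[OF smooth U(2)]
  fix a b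
  have "dderiv (\<lambda>y. F y (a + b)) x = dderiv (\<lambda>y. F y a + F y b) x"
    by (rule dderiv_cong[OF U smooth]) (simp add: linear_add lin)
  also have "\<dots> = (\<lambda>v. dderiv (\<lambda>y. F y a) x v + dderiv (\<lambda>y. F y b) x v)"
    by (intro dderivI has_derivative_add d)
  finally show "dderiv (\<lambda>y. F y (a + b)) x v = dderiv (\<lambda>y. F y a) x v + dderiv (\<lambda>y. F y b) x v"
    by simp
next
  note d = smooth_on_has_derivative[OF smooth U(2)]
  fix r :: real and a
  have "dderiv (\<lambda>y. F y (r *\<^sub>R a)) x = dderiv (\<lambda>y. r *\<^sub>R F y a) x"
    by (rule dderiv_cong[OF U smooth]) (simp add: linear_cmul lin)
  also have "\<dots> = (\<lambda>v. r *\<^sub>R dderiv (\<lambda>y. F y a) x v)"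
    by (intro dderivI has_derivative_scaleR_right d)
  finally show "dderiv (\<lambda>y. F y (r *\<^sub>R a)) x v = r *\<^sub>R dderiv (\<lambda>y. F y a) x v"
    by simp
qed

lemma linear_euclidean_expand:
  fixes f :: "'b::euclidean_space \<Rightarrow> 'c::real_vector"
  assumes "linear f" shows "f w = (\<Sum>b\<in>Basis. (w \<bullet> b) *\<^sub>R f b)"
proof -
  have "f w = f (\<Sum>b\<in>Basis. (w \<bullet> b) *\<^sub>R b)" by (simp only: euclidean_representation)
  also have "\<dots> = (\<Sum>b\<in>Basis. (w \<bullet> b) *\<^sub>R f b)" using assms by (simp only: linear_sum linear_cmul)
  finally show ?thesis .
qed

lemma smooth_on_apply:
  fixes g :: "'a::real_normed_vector \<Rightarrow> 'b::euclidean_space"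
  assumes U: "open U" and lin: "\<And>y. y \<in> U \<Longrightarrow> linear (F y)"
    and smooth: "\<And>w. smooth_on U (\<lambda>y. F y w)" and g: "smooth_on U g"
  shows "smooth_on U (\<lambda>y. F y (g y))"
proof (rule smooth_on_cong[OF U])
  show "smooth_on U (\<lambda>y. \<Sum>b\<in>Basis. (g y \<bullet> b) *\<^sub>R F y b)"
    by (intro smooth_on_sum finite_Basis smooth_on_scaleR smooth_on_inner U g smooth smooth_on_const)
qed (rule linear_euclidean_expand[OF lin, symmetric])

text \<open>Product rule for evaluation. Smoothness of \<open>F y w\<close> for each fixed w
  suffices, since w enters through finitely many coordinates.\<close>

lemma has_derivative_apply:
  fixes g :: "'a::real_normed_vector \<Rightarrow> 'b::euclidean_space"
  assumes U: "open U" "x \<in> U" and lin: "\<And>y. y \<in> U \<Longrightarrow> linear (F y)"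
    and smooth: "\<And>w. smooth_on U (\<lambda>y. F y w)" and g: "(g has_derivative g') (at x)"
  shows "((\<lambda>y. F y (g y)) has_derivative (\<lambda>v. dderiv (\<lambda>y. F y (g x)) x v + F x (g' v))) (at x)"
proof (rule has_derivative_transform_within_open[OF _ U])
  have "((\<lambda>y. \<Sum>b\<in>Basis. (g y \<bullet> b) *\<^sub>R F y b) has_derivative
     (\<lambda>v. \<Sum>b\<in>Basis. (g x \<bullet> b) *\<^sub>R dderiv (\<lambda>y. F y b) x v + (g' v \<bullet> b) *\<^sub>R F x b)) (at x)"
    by (intro has_derivative_sum has_derivative_scaleR has_derivative_inner_left g
        smooth_on_has_derivative[OF smooth U(2)])
  moreover have "(\<Sum>b\<in>Basis. (g x \<bullet> b) *\<^sub>R dderiv (\<lambda>y. F y b) x v + (g' v \<bullet> b) *\<^sub>R F x b)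
      = dderiv (\<lambda>y. F y (g x)) x v + F x (g' v)" for v
    unfolding sum.distrib
    using linear_euclidean_expand[OF linear_dderiv_param[OF U lin smooth], of "g x" v]
      linear_euclidean_expand[OF lin[OF U(2)], of "g' v"] by simp
  ultimately show "((\<lambda>y. \<Sum>b\<in>Basis. (g y \<bullet> b) *\<^sub>R F y b) has_derivative
     (\<lambda>v. dderiv (\<lambda>y. F y (g x)) x v + F x (g' v))) (at x)" by simp
qed (rule linear_euclidean_expand[OF lin, symmetric])

text \<open>Where one factor vanishes, the product rule asks only for continuity of the other. This
  allows an inverse matrix to be differentiated when only its continuity has been
  established.\<close>

lemma has_derivative_mult_vanishing:
  fixes a g :: "'a::real_normed_vector \<Rightarrow> real"
  assumes a: "(a has_derivative a') (at x)" "a x = 0" and g: "isCont g x"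
  shows "((\<lambda>y. a y * g y) has_derivative (\<lambda>v. a' v * g x)) (at x)"
  unfolding has_derivative_iff_norm
proof
  interpret a': bounded_linear a' using a(1) by (rule has_derivative_bounded_linear)
  show "bounded_linear (\<lambda>v. a' v * g x)"
    by (rule bounded_linear_compose[OF bounded_linear_mult_left a'.bounded_linear])
  obtain K where K: "\<And>v. norm (a' v) \<le> norm v * K" using a'.bounded by blast
  have lim: "((\<lambda>y. norm (a y - a x - a' (y - x)) / norm (y - x) * \<bar>g y\<bar> + \<bar>K\<bar> * \<bar>g y - g x\<bar>)
      \<longlongrightarrow> 0 * \<bar>g x\<bar> + \<bar>K\<bar> * \<bar>g x - g x\<bar>) (at x)"
    using a(1) g unfolding has_derivative_iff_norm isCont_def by (intro tendsto_intros) auto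
  show "((\<lambda>y. norm (a y * g y - a x * g x - a' (y - x) * g x) / norm (y - x)) \<longlongrightarrow> 0) (at x)"
  proof (rule tendsto_sandwich[OF _ _ tendsto_const])
    show "((\<lambda>y. norm (a y - a x - a' (y - x)) / norm (y - x) * \<bar>g y\<bar> + \<bar>K\<bar> * \<bar>g y - g x\<bar>)
      \<longlongrightarrow> 0) (at x)" using lim by simp
    have "norm (a y * g y - a x * g x - a' (y - x) * g x) / norm (y - x)
        \<le> norm (a y - a x - a' (y - x)) / norm (y - x) * \<bar>g y\<bar> + \<bar>K\<bar> * \<bar>g y - g x\<bar>"
      if "y \<noteq> x" for y
    proof -
      have "norm (a y * g y - a x * g x - a' (y - x) * g x)
          = norm ((a y - a x - a' (y - x)) * g y + a' (y - x) * (g y - g x))"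
        using a(2) by (simp add: algebra_simps)
      also have "\<dots> \<le> norm (a y - a x - a' (y - x)) * \<bar>g y\<bar> + norm (a' (y - x)) * \<bar>g y - g x\<bar>"
        by (rule norm_triangle_le) (simp add: abs_mult)
      also have "norm (a' (y - x)) * \<bar>g y - g x\<bar> \<le> (norm (y - x) * \<bar>K\<bar>) * \<bar>g y - g x\<bar>"
        by (rule mult_right_mono) (use K[of "y - x"] mult_left_mono[OF abs_ge_self[of K] norm_ge_zero[of "y - x"]] in linarith, simp)
      finally show ?thesis using that by (simp add: field_simps)
    qed
    then show "\<forall>\<^sub>F y in at x. norm (a y * g y - a x * g x - a' (y - x) * g x) / norm (y - x)
        \<le> norm (a y - a x - a' (y - x)) / norm (y - x) * \<bar>g y\<bar> + \<bar>K\<bar> * \<bar>g y - g x\<bar>"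
      by (auto simp: eventually_at_filter)
  qed simp
qed

subsection \<open>Metrics in a coordinate domain\<close>

text \<open>Index raising: the vector that represents the functional given by the Euclidean inner
  product with w. The body is the inverse map occurring in \<open>inverse_metric\<close>.\<close>

definition sharp :: "('e::euclidean_space \<Rightarrow> 'e \<Rightarrow> 'e \<Rightarrow> real) \<Rightarrow> 'e \<Rightarrow> 'e \<Rightarrow> 'e" where
  "sharp h x w = inv (\<lambda>v. \<Sum>b\<in>Basis. h x v b *\<^sub>R b) w"

text \<open>\<open>christoffel\<close> makes sense for arbitrary vectors in its first two slots, so
  \<open>Gam\<close> is the Christoffel map as a vector-valued bilinear map, free of basis indices
  there.\<close>

definition Gam :: "('e::euclidean_space \<Rightarrow> 'e \<Rightarrow> 'e \<Rightarrow> real) \<Rightarrow> 'e \<Rightarrow> 'e \<Rightarrow> 'e \<Rightarrow> 'e" where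
  "Gam h x v w = (\<Sum>k\<in>Basis. christoffel h x v w k *\<^sub>R k)"

text \<open>The curvature R(v, w) z for constant coordinate vector fields v, w and z.\<close>

definition Riem :: "('e::euclidean_space \<Rightarrow> 'e \<Rightarrow> 'e \<Rightarrow> real) \<Rightarrow> 'e \<Rightarrow> 'e \<Rightarrow> 'e \<Rightarrow> 'e \<Rightarrow> 'e" where
  "Riem h x v w z = dderiv (\<lambda>y. Gam h y w z) x v - dderiv (\<lambda>y. Gam h y v z) x w
     + Gam h x v (Gam h x w z) - Gam h x w (Gam h x v z)"

definition Ric :: "('e::euclidean_space \<Rightarrow> 'e \<Rightarrow> 'e \<Rightarrow> real) \<Rightarrow> 'e \<Rightarrow> 'e \<Rightarrow> 'e \<Rightarrow> real" where
  "Ric h x w z = (\<Sum>i\<in>Basis. Riem h x i w z \<bullet> i)"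

text \<open>A Riemannian metric on one coordinate domain. All curvature identities are proved in
  this setting, and atlases enter only afterwards.\<close>

locale coord_metric =
  fixes U :: "'e::euclidean_space set" and h :: "'e \<Rightarrow> 'e \<Rightarrow> 'e \<Rightarrow> real"
  assumes open_U: "open U"
    and bilin: "x \<in> U \<Longrightarrow> bilinear (h x)"
    and sym: "x \<in> U \<Longrightarrow> h x v w = h x w v"
    and pos: "x \<in> U \<Longrightarrow> v \<noteq> 0 \<Longrightarrow> h x v v > 0"
    and smooth: "smooth_on U (\<lambda>x. h x v w)"
begin

lemma lin1: "x \<in> U \<Longrightarrow> linear (\<lambda>v. h x v w)"
  and lin2: "x \<in> U \<Longrightarrow> linear (h x v)"
  using bilin unfolding bilinear_def by auto

lemma nondegenerate:
  assumes "x \<in> U" "\<And>z. h x v z = h x w z" shows "v = w"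
proof -
  have "h x (v - w) (v - w) = 0"
    using assms linear_diff[OF lin1[OF assms(1)]] by simp
  then show ?thesis using pos[OF assms(1), of "v - w"] by fastforce
qed

lemma flat_inner:
  assumes "x \<in> U" shows "(\<Sum>b\<in>Basis. h x v b *\<^sub>R b) \<bullet> w = h x v w"
  using linear_euclidean_expand[OF lin2[OF assms], of v w]
  by (simp add: inner_sum_left inner_commute[of w] mult.commute)

text \<open>Lowering an index is injective by positivity, hence surjective in finite dimension, so
  \<open>inv\<close> is a genuine inverse.\<close>

lemma h_sharp:
  assumes "x \<in> U" shows "h x (sharp h x w) z = w \<bullet> z"
proof -
  let ?f = "\<lambda>v. \<Sum>b\<in>Basis. h x v b *\<^sub>R b"
  have lin: "linear ?f"
    by (intro linearI) (simp_all add: linear_add[OF lin1[OF assms]] linear_cmul[OF lin1[OF assms]]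
        scaleR_add_left sum.distrib scaleR_sum_right)
  have "inj ?f"
    by (rule injI, rule nondegenerate[OF assms]) (metis flat_inner[OF assms])
  then have "surj ?f" by (rule linear_inj_imp_surj[OF lin])
  then have "?f (sharp h x w) = w" unfolding sharp_def by (rule surj_f_inv_f)
  then show ?thesis using flat_inner[OF assms, of "sharp h x w" z] by simp
qed

lemma sharp_unique:
  assumes "x \<in> U" "\<And>z. h x v z = w \<bullet> z" shows "sharp h x w = v"
  by (rule nondegenerate[OF assms(1)]) (simp add: h_sharp assms)

lemma linear_sharp: assumes "x \<in> U" shows "linear (sharp h x)"
  by (rule linearI; rule sharp_unique[OF assms])
    (simp_all add: linear_add[OF lin1[OF assms]] linear_cmul[OF lin1[OF assms]] h_sharp[OF assms]
      inner_add_left)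

lemma sharp_commute: assumes "x \<in> U" shows "sharp h x v \<bullet> w = sharp h x w \<bullet> v"
  by (metis h_sharp[OF assms] sym[OF assms] inner_commute)

lemma sharp_pos: assumes "x \<in> U" "v \<noteq> 0" shows "sharp h x v \<bullet> v > 0"
proof -
  have "sharp h x v \<noteq> 0"
    using h_sharp[OF assms(1), of v v] assms linear_0[OF lin1[OF assms(1)]] by auto
  then show ?thesis using pos[OF assms(1)] h_sharp[OF assms(1)] by (metis inner_commute)
qed

text \<open>\<open>H\<^sub>y\<^sup>-\<^sup>1 - H\<^sub>x\<^sup>-\<^sup>1 = H\<^sub>x\<^sup>-\<^sup>1 (H\<^sub>x - H\<^sub>y) H\<^sub>y\<^sup>-\<^sup>1\<close> for the matrices \<open>H\<close> of \<open>h\<close>; only the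
  last factor of the right-hand side is the unknown function, so continuity and then
  differentiability of the inverse follow.\<close>

lemma sharp_diff:
  assumes "x \<in> U" "y \<in> U"
  shows "sharp h y w - sharp h x w =
    (\<Sum>b\<in>Basis. \<Sum>c\<in>Basis. ((h x c b - h y c b) * (sharp h y w \<bullet> c)) *\<^sub>R sharp h x b)"
    (is "?l = ?r")
proof -
  have "sharp h x (\<Sum>b\<in>Basis. (\<Sum>c\<in>Basis. (h x c b - h y c b) * (sharp h y w \<bullet> c)) *\<^sub>R b) = ?l"
  proof (rule sharp_unique[OF assms(1)])
    fix z
    have *: "(\<Sum>b\<in>Basis. (\<Sum>c\<in>Basis. h u c b * (sharp h y w \<bullet> c)) * (z \<bullet> b)) = h u (sharp h y w) z"
      if "u \<in> U" for u
    proof -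
      have "(\<Sum>c\<in>Basis. h u c b * (sharp h y w \<bullet> c)) = h u (sharp h y w) b" for b
        using linear_euclidean_expand[OF lin1[OF that], of "sharp h y w" b] by (simp add: mult.commute)
      then show ?thesis
        using linear_euclidean_expand[OF lin2[OF that], of "sharp h y w" z] by (simp add: mult.commute)
    qed
    have "(\<Sum>b\<in>Basis. (\<Sum>c\<in>Basis. (h x c b - h y c b) * (sharp h y w \<bullet> c)) *\<^sub>R b) \<bullet> z
        = (\<Sum>b\<in>Basis. (\<Sum>c\<in>Basis. h x c b * (sharp h y w \<bullet> c)) * (z \<bullet> b))
          - (\<Sum>b\<in>Basis. (\<Sum>c\<in>Basis. h y c b * (sharp h y w \<bullet> c)) * (z \<bullet> b))"
      by (simp add: inner_sum_left left_diff_distrib sum_subtractf inner_commute[of z])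
    then show "h x (sharp h y w - sharp h x w) z =
        (\<Sum>b\<in>Basis. (\<Sum>c\<in>Basis. (h x c b - h y c b) * (sharp h y w \<bullet> c)) *\<^sub>R b) \<bullet> z"
      unfolding *[OF assms(1)] *[OF assms(2)]
      by (simp add: linear_diff[OF lin1[OF assms(1)]] h_sharp assms)
  qed
  then show ?thesis
    using linear_sharp[OF assms(1)] by (simp add: linear_sum linear_cmul scaleR_sum_left)
qed

lemma isCont_sharp:
  assumes x: "x \<in> U" shows "isCont (\<lambda>y. sharp h y w) x"
proof -
  define e where "e = (\<lambda>y. \<Sum>b\<in>Basis. \<Sum>c\<in>Basis. \<bar>h x c b - h y c b\<bar> * norm (sharp h x b))"
  have "isCont (\<lambda>y. h y c b) x" for c b
    using smooth_on_imp_continuous_on[OF smooth] x open_U continuous_on_eq_continuous_at by blast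
  then have "(e \<longlongrightarrow> (\<Sum>b\<in>Basis. \<Sum>c\<in>Basis. \<bar>h x c b - h x c b\<bar> * norm (sharp h x b))) (at x)"
    unfolding e_def isCont_def by (intro tendsto_intros) auto
  then have e0: "(e \<longlongrightarrow> 0) (at x)" by simp
  have bound: "norm (sharp h y w - sharp h x w) \<le> e y * norm (sharp h y w)" if "y \<in> U" for y
  proof -
    have "norm (sharp h y w - sharp h x w) \<le>
      (\<Sum>b\<in>Basis. \<Sum>c\<in>Basis. norm (((h x c b - h y c b) * (sharp h y w \<bullet> c)) *\<^sub>R sharp h x b))"
      unfolding sharp_diff[OF x that] by (intro order.trans[OF norm_sum] sum_mono) simp
    also have "\<dots> \<le> (\<Sum>b\<in>Basis. \<Sum>c\<in>Basis. \<bar>h x c b - h y c b\<bar> * norm (sharp h x b) * norm (sharp h y w))"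
    proof (intro sum_mono)
      fix b c :: 'e assume "c \<in> Basis"
      then have "\<bar>h x c b - h y c b\<bar> * norm (sharp h x b) * \<bar>sharp h y w \<bullet> c\<bar>
          \<le> \<bar>h x c b - h y c b\<bar> * norm (sharp h x b) * norm (sharp h y w)"
        by (intro mult_left_mono Basis_le_norm mult_nonneg_nonneg) auto
      then show "norm (((h x c b - h y c b) * (sharp h y w \<bullet> c)) *\<^sub>R sharp h x b)
          \<le> \<bar>h x c b - h y c b\<bar> * norm (sharp h x b) * norm (sharp h y w)"
        by (simp add: abs_mult mult.commute mult.left_commute)
    qed
    also have "\<dots> = e y * norm (sharp h y w)" by (simp add: e_def sum_distrib_right)
    finally show ?thesis .
  qed
  have "((\<lambda>y. sharp h y w - sharp h x w) \<longlongrightarrow> 0) (at x)"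
  proof (rule Lim_null_comparison)
    show "((\<lambda>y. 2 * e y * norm (sharp h x w)) \<longlongrightarrow> 0) (at x)"
      using tendsto_mult[OF tendsto_mult[OF tendsto_const[of 2] e0] tendsto_const[of "norm (sharp h x w)"]] by simp
    \<comment> \<open>Below 1/2 the term \<open>e y * norm (sharp h y w)\<close> can be absorbed,
      which bounds the unknown vector by twice \<open>norm (sharp h x w)\<close>.\<close>
    have "eventually (\<lambda>y. e y < 1 / 2) (at x)" using order_tendstoD(2)[OF e0, of "1/2"] by simp
    then show "eventually (\<lambda>y. norm (sharp h y w - sharp h x w) \<le> 2 * e y * norm (sharp h x w)) (at x)"
      using eventually_at_in_open'[OF open_U x]
    proof eventually_elim
      case (elim y)
      have e: "e y \<ge> 0" unfolding e_def by (intro sum_nonneg) auto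
      have "norm (sharp h y w) \<le> norm (sharp h x w) + norm (sharp h y w - sharp h x w)"
        using norm_triangle_ineq[of "sharp h x w" "sharp h y w - sharp h x w"] by simp
      also have "\<dots> \<le> norm (sharp h x w) + e y * norm (sharp h y w)" using bound elim by simp
      also have "\<dots> \<le> norm (sharp h x w) + 1/2 * norm (sharp h y w)"
        using elim mult_right_mono[of "e y" "1/2" "norm (sharp h y w)"] by simp
      finally have "norm (sharp h y w) \<le> 2 * norm (sharp h x w)" by simp
      then have "e y * norm (sharp h y w) \<le> e y * (2 * norm (sharp h x w))"
        by (rule mult_left_mono[OF _ e])
      with bound[OF elim(2)] show ?case by linarith
    qed
  qed
  then show ?thesis unfolding isCont_def by (rule LIM_zero_cancel)
qed

text \<open>In \<open>sharp_diff\<close> the factor \<open>h x c b - h y c b\<close> vanishes at y =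
  x, so continuity of \<open>sharp\<close> is enough. The formula is that of matrix calculus: the
  derivative of the inverse of H is minus the inverse times dH times the inverse.\<close>

lemma has_derivative_sharp:
  assumes x: "x \<in> U"
  shows "((\<lambda>y. sharp h y w) has_derivative (\<lambda>v. \<Sum>b\<in>Basis. \<Sum>c\<in>Basis.
    (- dderiv (\<lambda>y. h y c b) x v * (sharp h x w \<bullet> c)) *\<^sub>R sharp h x b)) (at x)"
proof -
  have "((\<lambda>y. (h x c b - h y c b) * (sharp h y w \<bullet> c)) has_derivative
      (\<lambda>v. - dderiv (\<lambda>y. h y c b) x v * (sharp h x w \<bullet> c))) (at x)" for b c
  proof (rule has_derivative_mult_vanishing)
    show "((\<lambda>y. h x c b - h y c b) has_derivative (\<lambda>v. - dderiv (\<lambda>y. h y c b) x v)) (at x)"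
      using has_derivative_diff[OF has_derivative_const smooth_on_has_derivative[OF smooth x]] by simp
    show "isCont (\<lambda>y. sharp h y w \<bullet> c) x" by (intro continuous_intros isCont_sharp x)
  qed simp
  note d = this
  have "((\<lambda>y. sharp h x w + (\<Sum>b\<in>Basis. \<Sum>c\<in>Basis. ((h x c b - h y c b) * (sharp h y w \<bullet> c)) *\<^sub>R sharp h x b))
    has_derivative (\<lambda>v. 0 + (\<Sum>b\<in>Basis. \<Sum>c\<in>Basis.
    (- dderiv (\<lambda>y. h y c b) x v * (sharp h x w \<bullet> c)) *\<^sub>R sharp h x b))) (at x)"
    by (intro has_derivative_add has_derivative_const has_derivative_sum has_derivative_scaleR_left d)
  then have "((\<lambda>y. sharp h y w)
    has_derivative (\<lambda>v. 0 + (\<Sum>b\<in>Basis. \<Sum>c\<in>Basis.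
    (- dderiv (\<lambda>y. h y c b) x v * (sharp h x w \<bullet> c)) *\<^sub>R sharp h x b))) (at x)"
    by (rule has_derivative_transform_within_open[OF _ open_U x]) (simp add: sharp_diff[OF x, symmetric])
  then show ?thesis by simp
qed

text \<open>Bootstrapping: the derivative of \<open>sharp\<close> is built from \<open>sharp\<close>
  and derivatives of the metric, so order k implies order k + 1.\<close>

lemma smooth_sharp: "smooth_on U (\<lambda>x. sharp h x w)"
proof -
  have "Ck_on k U (\<lambda>x. sharp h x w)" for k
  proof (induction k arbitrary: w)
    case 0
    show ?case using isCont_sharp by (simp add: continuous_at_imp_continuous_on)
  next
    case (Suc k)
    have d: "Ck_on k U (\<lambda>x. - dderiv (\<lambda>y. h y c b) x v)" for b c v
      using smooth_on_minus[OF open_U smooth_on_dderiv[OF smooth]] unfolding smooth_on_def by blast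
    have i: "Ck_on k U (\<lambda>x. sharp h x w \<bullet> c)" for c
      by (rule bounded_linear.Ck_on_bounded_linear[OF bounded_linear_inner_left open_U Suc])
    note m = bounded_bilinear.Ck_on_bounded_bilinear[OF bounded_bilinear_mult open_U d i]
    note s = bounded_bilinear.Ck_on_bounded_bilinear[OF bounded_bilinear_scaleR open_U m Suc]
    have "Ck_on k U (\<lambda>x. \<Sum>b\<in>Basis. \<Sum>c\<in>Basis.
        (- dderiv (\<lambda>y. h y c b) x v * (sharp h x w \<bullet> c)) *\<^sub>R sharp h x b)" for v
      by (rule Ck_on_sum[OF open_U finite_Basis], rule Ck_on_sum[OF open_U finite_Basis], rule s)
    with has_derivative_sharp show ?case by (rule Ck_on_SucI[OF open_U])
  qed
  then show ?thesis by (simp add: smooth_on_def)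
qed

section \<open>Levi-Civita connection and curvature in coordinates\<close>

abbreviation dh :: "'e \<Rightarrow> 'e \<Rightarrow> 'e \<Rightarrow> 'e \<Rightarrow> real" where
  "dh x v w z \<equiv> dderiv (\<lambda>y. h y w z) x v"

lemma dh_lin1: "x \<in> U \<Longrightarrow> linear (\<lambda>v. dh x v w z)"
  using has_derivative_linear[OF smooth_on_has_derivative[OF smooth]] .

lemma dh_lin2: "x \<in> U \<Longrightarrow> linear (\<lambda>w. dh x v w z)"
  by (rule linear_dderiv_param[OF open_U _ lin1 smooth])

lemma dh_lin3: "x \<in> U \<Longrightarrow> linear (\<lambda>z. dh x v w z)"
  by (rule linear_dderiv_param[OF open_U _ lin2 smooth])

lemma dh_sym: "x \<in> U \<Longrightarrow> dh x v w z = dh x v z w"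
  by (rule fun_cong, rule dderiv_cong[OF open_U _ smooth sym])

lemma Gam_inner: "k \<in> Basis \<Longrightarrow> Gam h x v w \<bullet> k = christoffel h x v w k"
  unfolding Gam_def by (simp add: inner_sum_left inner_Basis if_distrib cong: if_cong)

text \<open>The Koszul formula for constant vector fields. Lowering the index removes the inverse
  matrix from the definition of the Christoffel symbols, and linearity in z extends the result from
  basis vectors to all z.\<close>

lemma h_Gam:
  assumes x: "x \<in> U"
  shows "h x (Gam h x v w) z = 1 / 2 * (dh x v w z + dh x w v z - dh x z v w)"
proof -
  define c where "c = (\<lambda>z. dh x v w z + dh x w v z - dh x z v w)"
  have lin: "linear c"
    unfolding c_def by (intro linear_compose_add linear_compose_sub dh_lin1 dh_lin3 x)
  have "Gam h x v w = sharp h x ((1 / 2) *\<^sub>R (\<Sum>l\<in>Basis. c l *\<^sub>R l))"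
  proof (rule euclidean_eqI)
    fix k :: 'e assume "k \<in> Basis"
    have "sharp h x ((1 / 2) *\<^sub>R (\<Sum>l\<in>Basis. c l *\<^sub>R l)) \<bullet> k
        = 1 / 2 * (\<Sum>l\<in>Basis. (sharp h x k \<bullet> l) * c l)"
      unfolding sharp_commute[OF x, of _ k] by (simp add: inner_sum_right mult.commute)
    then show "Gam h x v w \<bullet> k = sharp h x ((1 / 2) *\<^sub>R (\<Sum>l\<in>Basis. c l *\<^sub>R l)) \<bullet> k"
      unfolding Gam_inner[OF \<open>k \<in> Basis\<close>] christoffel_def partial_deriv_def
        inverse_metric_def sharp_def c_def by simp
  qed
  then have "h x (Gam h x v w) z = 1 / 2 * (\<Sum>l\<in>Basis. c l * (l \<bullet> z))"
    using h_sharp[OF x] by (simp add: inner_sum_left)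
  also have "(\<Sum>l\<in>Basis. c l * (l \<bullet> z)) = c z"
    using linear_euclidean_expand[OF lin, of z] by (simp add: inner_commute mult.commute)
  finally show ?thesis unfolding c_def .
qed

text \<open>By nondegeneracy any explicit candidate for \<open>Gam\<close> can be verified through
  the Koszul formula, without inverting a matrix.\<close>

lemma Gam_unique:
  assumes "x \<in> U" "\<And>z. h x V z = 1 / 2 * (dh x v w z + dh x w v z - dh x z v w)"
  shows "Gam h x v w = V"
  by (rule nondegenerate[OF assms(1)]) (simp add: h_Gam assms)

lemma Gam_sym: "x \<in> U \<Longrightarrow> Gam h x v w = Gam h x w v"
  by (rule Gam_unique) (simp_all add: h_Gam dh_sym[of x w v])

lemma Gam_lin2: assumes x: "x \<in> U" shows "linear (Gam h x v)"
  by (rule linearI; rule Gam_unique[OF x])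
    (simp_all add: linear_add[OF lin1[OF x]] linear_cmul[OF lin1[OF x]] h_Gam[OF x]
      linear_add[OF dh_lin1[OF x]] linear_cmul[OF dh_lin1[OF x]]
      linear_add[OF dh_lin2[OF x]] linear_cmul[OF dh_lin2[OF x]]
      linear_add[OF dh_lin3[OF x]] linear_cmul[OF dh_lin3[OF x]] algebra_simps)

lemma Gam_lin1: assumes x: "x \<in> U" shows "linear (\<lambda>v. Gam h x v w)"
  using Gam_lin2[OF x, of w] unfolding Gam_sym[OF x, of _ w] .

lemma metric_compatible:
  assumes x: "x \<in> U"
  shows "dh x v w z = h x (Gam h x v w) z + h x w (Gam h x v z)"
  unfolding sym[OF x, of w] h_Gam[OF x] using dh_sym[OF x, of z w v] by (simp add: field_simps)

lemma smooth_christoffel: "smooth_on U (\<lambda>x. christoffel h x v w k)"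
  unfolding christoffel_def partial_deriv_def inverse_metric_def sharp_def[symmetric]
  by (intro smooth_on_mult smooth_on_const smooth_on_sum finite_Basis open_U smooth_on_inner
      smooth_sharp smooth_on_add smooth_on_diff smooth_on_dderiv smooth)

lemma smooth_Gam: "smooth_on U (\<lambda>x. Gam h x v w)"
  unfolding Gam_def
  by (intro smooth_on_sum finite_Basis open_U smooth_on_scaleR smooth_on_const smooth_christoffel)

lemma Riem_lin3: assumes x: "x \<in> U" shows "linear (Riem h x v w)"
proof -
  have "linear (\<lambda>z. dderiv (\<lambda>y. Gam h y w z) x v)" for v w
    by (rule linear_dderiv_param[OF open_U x Gam_lin2 smooth_Gam])
  moreover have "linear (\<lambda>z. Gam h x v (Gam h x w z))" for v w
    using linear_compose[OF Gam_lin2[OF x] Gam_lin2[OF x]] by (simp add: o_def)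
  ultimately have "linear (\<lambda>z. Riem h x v w z)"
    unfolding Riem_def by (intro linear_compose_add linear_compose_sub)
  then show ?thesis by simp
qed

lemma Ric_lin2: "x \<in> U \<Longrightarrow> linear (Ric h x w)"
  unfolding Ric_def by (intro linear_compose_sum ballI bounded_linear.linear
    bounded_linear_inner_left_comp Riem_lin3[unfolded linear_conv_bounded_linear])

lemma riemann_eq_Riem:
  assumes x: "x \<in> U" and l: "l \<in> Basis"
  shows "riemann h x i j k l = Riem h x i j k \<bullet> l"
proof -
  have d: "partial_deriv (\<lambda>y. christoffel h y j k l) i x = dderiv (\<lambda>y. Gam h y j k) x i \<bullet> l" for i j
    unfolding partial_deriv_def Gam_inner[OF l, symmetric] by (rule dderiv_inner_left[OF smooth_Gam x])
  have "(\<Sum>m\<in>Basis. christoffel h x j k m * christoffel h x i m l) = Gam h x i (Gam h x j k) \<bullet> l"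
    for i j
    using linear_euclidean_expand[OF Gam_lin2[OF x], of i "Gam h x j k"]
    by (simp add: inner_sum_left Gam_inner[symmetric] l)
  then show ?thesis
    unfolding riemann_def d Riem_def by (simp add: inner_diff_left inner_add_left sum_subtractf)
qed

lemma coord_scalar_curvature_eq:
  assumes x: "x \<in> U"
  shows "coord_scalar_curvature h x = (\<Sum>j\<in>Basis. Ric h x j (sharp h x j))"
proof -
  have "ricci h x j k = Ric h x j k" for j k
    unfolding ricci_def Ric_def by (intro sum.cong refl riemann_eq_Riem x)
  then show ?thesis
    unfolding coord_scalar_curvature_def inverse_metric_def sharp_def[symmetric]
    by (simp add: linear_euclidean_expand[OF Ric_lin2[OF x], of _ "sharp h x _"])
qed

lemma continuous_on_coord_scalar_curvature: "continuous_on U (coord_scalar_curvature h)"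
proof -
  have "smooth_on U (\<lambda>x. coord_scalar_curvature h x)"
    unfolding coord_scalar_curvature_def inverse_metric_def sharp_def[symmetric] ricci_def riemann_def
      partial_deriv_def
    by (intro smooth_on_mult smooth_on_const smooth_on_sum finite_Basis open_U smooth_on_inner
      smooth_sharp smooth_on_add smooth_on_diff smooth_on_dderiv smooth_christoffel)
  then show ?thesis using smooth_on_imp_continuous_on by simp
qed

end

subsection \<open>Conformal change of the scalar curvature\<close>

text \<open>The trace of the rank-one endomorphism that sends v to f v times u.\<close>

lemma trace_rank_one:
  fixes f :: "'e::euclidean_space \<Rightarrow> real"
  assumes "linear f" shows "(\<Sum>i\<in>Basis. f i * (u \<bullet> i)) = f u"
  using linear_euclidean_expand[OF assms, of u] by (simp add: mult.commute)

lemma trace_id: "(\<Sum>i\<in>(Basis::'e::euclidean_space set). i \<bullet> i) = real DIM('e)"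
  by simp

locale conformal_change = coord_metric U h for U :: "'e::euclidean_space set" and h +
  fixes \<omega> :: "'e \<Rightarrow> real"
  assumes smooth_\<omega>: "smooth_on U \<omega>"
begin

abbreviation h' :: "'e \<Rightarrow> 'e \<Rightarrow> 'e \<Rightarrow> real" where
  "h' \<equiv> \<lambda>x v w. exp (2 * \<omega> x) * h x v w"

definition grad :: "'e \<Rightarrow> 'e" where
  "grad x = sharp h x (\<Sum>b\<in>Basis. dderiv \<omega> x b *\<^sub>R b)"

text \<open>The covariant Hessian of \<omega> with respect to \<open>h\<close>.\<close>

definition hess :: "'e \<Rightarrow> 'e \<Rightarrow> 'e \<Rightarrow> real" where
  "hess x v w = dderiv (\<lambda>y. dderiv \<omega> y w) x v - dderiv \<omega> x (Gam h x v w)"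

text \<open>The covariant derivative of the gradient in direction v, that is, the Hessian with one
  index raised. Differentiating the gradient in the conformal Christoffel map produces this
  form.\<close>

definition hess_op :: "'e \<Rightarrow> 'e \<Rightarrow> 'e" where
  "hess_op x v = dderiv grad x v + Gam h x v (grad x)"

sublocale conf: coord_metric U h'
proof
  show "open U" by (rule open_U)
  show "bilinear (h' x)" if "x \<in> U" for x
    using lin1[OF that] lin2[OF that] unfolding bilinear_def
    by (auto intro!: linear_compose_scale_right[where 'b=real, simplified])
  show "h' x v w = h' x w v" if "x \<in> U" for x v w using sym[OF that] by simp
  show "h' x v v > 0" if "x \<in> U" "v \<noteq> 0" for x v using pos[OF that] by simp
  show "smooth_on U (\<lambda>x. h' x v w)" for v w
    by (intro smooth_on_mult open_U smooth_on_exp_compose smooth_on_const smooth_\<omega> smooth)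
qed

lemma d\<omega>_lin: "x \<in> U \<Longrightarrow> linear (dderiv \<omega> x)"
  using has_derivative_linear[OF smooth_on_has_derivative[OF smooth_\<omega>]] .

lemma h_grad: assumes x: "x \<in> U" shows "h x (grad x) z = dderiv \<omega> x z"
  unfolding grad_def h_sharp[OF x] using linear_euclidean_expand[OF d\<omega>_lin[OF x], of z]
  by (simp add: inner_sum_left inner_commute[of z] mult.commute)

lemma smooth_grad: "smooth_on U grad"
proof -
  have "smooth_on U (\<lambda>x. \<Sum>b\<in>Basis. dderiv \<omega> x b *\<^sub>R b)"
    by (intro smooth_on_sum smooth_on_scaleR smooth_on_dderiv smooth_\<omega> smooth_on_const open_U finite_Basis)
  then have "smooth_on U (\<lambda>x. grad x)"
    unfolding grad_def by (rule smooth_on_apply[OF open_U linear_sharp smooth_sharp, rotated])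
  then show ?thesis by simp
qed

lemma dh': 
  assumes x: "x \<in> U"
  shows "conf.dh x v w z = exp (2 * \<omega> x) * (2 * dderiv \<omega> x v * h x w z + dh x v w z)"
proof -
  note d\<omega> = smooth_on_has_derivative[OF smooth_\<omega> x] and dh = smooth_on_has_derivative[OF smooth x]
  have "((\<lambda>y. exp (2 * \<omega> y) * h y w z) has_derivative
     (\<lambda>v. exp (2 * \<omega> x) * (2 * dderiv \<omega> x v * h x w z + dh x v w z))) (at x)"
    by (rule has_derivative_eq_rhs, (rule derivative_intros d\<omega> dh)+) (auto simp: algebra_simps)
  then show ?thesis by (simp add: dderivI)
qed

text \<open>The classical difference between the two connections, verified by substitution into the
  Koszul formula for \<open>h'\<close>.\<close>

lemma Gam_conf:
  assumes x: "x \<in> U"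
  shows "Gam h' x v w = Gam h x v w + dderiv \<omega> x v *\<^sub>R w + dderiv \<omega> x w *\<^sub>R v - h x v w *\<^sub>R grad x"
  by (rule conf.Gam_unique[OF x])
    (simp only: dh'[OF x] linear_add[OF lin1[OF x]] linear_diff[OF lin1[OF x]]
      linear_cmul[OF lin1[OF x]] h_Gam[OF x] h_grad[OF x], simp add: field_simps)

lemma dderiv2_lin: "x \<in> U \<Longrightarrow> linear (\<lambda>w. dderiv (\<lambda>y. dderiv \<omega> y w) x v)"
  by (rule linear_dderiv_param[OF open_U _ d\<omega>_lin smooth_on_dderiv[OF smooth_\<omega>]])

lemma hess_sym: "x \<in> U \<Longrightarrow> hess x v w = hess x w v"
  unfolding hess_def
  by (simp add: Gam_sym[of x v w] smooth_on_dderiv_commute[OF open_U _ smooth_\<omega>, of x v w])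

lemma hess_lin2: "x \<in> U \<Longrightarrow> linear (hess x v)"
  using linear_compose_sub[OF dderiv2_lin[of x v] linear_compose[OF Gam_lin2[of x v] d\<omega>_lin[of x]]]
  unfolding hess_def o_def by simp

lemma hess_lin1: "x \<in> U \<Longrightarrow> linear (\<lambda>v. hess x v w)"
  using hess_lin2[of x w] hess_sym[of x _ w] by simp

text \<open>Differentiate the identity \<open>h y (grad y) z = dderiv \<omega> y z\<close> and
  eliminate the derivative of the metric by metric compatibility.\<close>

lemma h_hess_op: assumes x: "x \<in> U" shows "h x (hess_op x v) z = hess x v z"
proof -
  have "dderiv (\<lambda>y. h y (grad y) z) x = (\<lambda>v. dh x v (grad x) z + h x (dderiv grad x v) z)"
    by (intro dderivI has_derivative_apply[OF open_U x lin1 smooth]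
        smooth_on_has_derivative[OF smooth_grad x])
  moreover have "dderiv (\<lambda>y. dderiv \<omega> y z) x = dderiv (\<lambda>y. h y (grad y) z) x"
    by (rule dderiv_cong[OF open_U x smooth_on_dderiv[OF smooth_\<omega>]]) (simp add: h_grad)
  ultimately have "dderiv (\<lambda>y. dderiv \<omega> y z) x v = dh x v (grad x) z + h x (dderiv grad x v) z"
    by simp
  then show ?thesis
    unfolding hess_op_def hess_def using metric_compatible[OF x, of "grad x" z v]
    by (simp add: linear_add[OF lin1[OF x]] h_grad[OF x])
qed

lemma dderiv_Gam_conf:
  assumes x: "x \<in> U"
  shows "dderiv (\<lambda>y. Gam h' y w z) x v = dderiv (\<lambda>y. Gam h y w z) x v
    + dderiv (\<lambda>y. dderiv \<omega> y w) x v *\<^sub>R z + dderiv (\<lambda>y. dderiv \<omega> y z) x v *\<^sub>R w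
    - dh x v w z *\<^sub>R grad x - h x w z *\<^sub>R dderiv grad x v"
proof -
  have "dderiv (\<lambda>y. Gam h' y w z) x = dderiv (\<lambda>y. Gam h y w z + dderiv \<omega> y w *\<^sub>R z
      + dderiv \<omega> y z *\<^sub>R w - h y w z *\<^sub>R grad y) x"
    by (rule dderiv_cong[OF open_U x conf.smooth_Gam Gam_conf])
  also have "\<dots> = (\<lambda>v. dderiv (\<lambda>y. Gam h y w z) x v
    + dderiv (\<lambda>y. dderiv \<omega> y w) x v *\<^sub>R z + dderiv (\<lambda>y. dderiv \<omega> y z) x v *\<^sub>R w
    - (h x w z *\<^sub>R dderiv grad x v + dh x v w z *\<^sub>R grad x))"
    by (intro dderivI has_derivative_diff has_derivative_add has_derivative_scaleR
        has_derivative_scaleR_left smooth_on_has_derivative[OF _ x] smooth_Gam smooth_on_dderiv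
        smooth_\<omega> smooth smooth_grad)
  finally show ?thesis by simp
qed

text \<open>Substitute \<open>Gam_conf\<close> into the definition of the curvature. Derivatives of
  \<open>h\<close> are removed by metric compatibility, and the second derivatives of \<omega> then
  combine with Christoffel terms to form \<open>hess\<close> and \<open>hess_op\<close>.\<close>

lemma Riem_conf:
  assumes x: "x \<in> U"
  defines "p \<equiv> dderiv \<omega> x"
  shows "Riem h' x v w z = Riem h x v w z + hess x v z *\<^sub>R w - hess x w z *\<^sub>R v
    - h x w z *\<^sub>R hess_op x v + h x v z *\<^sub>R hess_op x w
    + (p z * p w) *\<^sub>R v - (p z * p v) *\<^sub>R w
    - (p (grad x) * h x w z) *\<^sub>R v + (p (grad x) * h x v z) *\<^sub>R w
    + (p v * h x w z - p w * h x v z) *\<^sub>R grad x"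
proof -
  have p: "linear p" unfolding p_def by (rule d\<omega>_lin[OF x])
  note lin = linear_add[OF Gam_lin2[OF x]] linear_diff[OF Gam_lin2[OF x]] linear_cmul[OF Gam_lin2[OF x]]
    linear_add[OF p] linear_diff[OF p] linear_cmul[OF p]
    linear_add[OF lin2[OF x]] linear_diff[OF lin2[OF x]] linear_cmul[OF lin2[OF x]]
  have hg: "h x u (grad x) = p u" for u using h_grad[OF x, of u] sym[OF x] by (simp add: p_def)
  have GG: "Gam h' x v (Gam h' x w z) = Gam h x v (Gam h x w z)
      + p w *\<^sub>R Gam h x v z + p z *\<^sub>R Gam h x v w - h x w z *\<^sub>R Gam h x v (grad x)
      + p v *\<^sub>R Gam h x w z + (p v * p w) *\<^sub>R z + (p v * p z) *\<^sub>R w - (p v * h x w z) *\<^sub>R grad x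
      + (p (Gam h x w z) + p w * p z + p w * p z - h x w z * p (grad x)) *\<^sub>R v
      - (h x v (Gam h x w z) + p w * h x v z + p z * h x v w - h x w z * p v) *\<^sub>R grad x" for v w
    unfolding Gam_conf[OF x] lin p_def[symmetric] hg by (simp add: algebra_simps)
  \<comment> \<open>Symmetry of second derivatives cancels the terms proportional to z.\<close>
  have W: "dderiv (\<lambda>y. dderiv \<omega> y w) x v = dderiv (\<lambda>y. dderiv \<omega> y v) x w"
    by (rule smooth_on_dderiv_commute[OF open_U x smooth_\<omega>])
  show ?thesis
    unfolding Riem_def dderiv_Gam_conf[OF x] GG W metric_compatible[OF x] hess_def hess_op_def
      p_def[symmetric] Gam_sym[OF x, of w v] sym[OF x, of w v] sym[OF x, of "Gam h x _ _" w]
      sym[OF x, of "Gam h x _ _" v]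
    by (simp add: algebra_simps) (simp only: mult_2_right distrib_left scaleR_add_left add_ac)
qed

text \<open>Trace \<open>Riem_conf\<close> over its first slot: a multiple of the traced vector
  contributes n times its coefficient, while terms that contain it only as an argument are of rank
  one and contribute a single evaluation.\<close>

lemma Ric_conf:
  assumes x: "x \<in> U"
  defines "p \<equiv> dderiv \<omega> x" and "n \<equiv> real DIM('e)"
  shows "Ric h' x w z = Ric h x w z - (n - 2) * hess x w z
    - h x w z * (\<Sum>i\<in>Basis. hess x i (sharp h x i)) + (n - 2) * (p w * p z) - (n - 2) * p (grad x) * h x w z"
proof -
  have tr: "(\<Sum>i\<in>Basis. hess_op x i \<bullet> i) = (\<Sum>i\<in>Basis. hess x i (sharp h x i))"
    using h_sharp[OF x] h_hess_op[OF x] sym[OF x] by (metis (no_types) inner_commute)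
  have "Ric h' x w z = (\<Sum>i\<in>Basis. Riem h x i w z \<bullet> i + hess x i z * (w \<bullet> i) - hess x w z * (i \<bullet> i)
    - h x w z * (hess_op x i \<bullet> i) + h x i z * (hess_op x w \<bullet> i)
    + (p z * p w) * (i \<bullet> i) - p z * (p i * (w \<bullet> i))
    - (p (grad x) * h x w z) * (i \<bullet> i) + p (grad x) * (h x i z * (w \<bullet> i))
    + h x w z * (p i * (grad x \<bullet> i)) - p w * (h x i z * (grad x \<bullet> i)))"
    unfolding Ric_def Riem_conf[OF x] p_def[symmetric]
    by (intro sum.cong refl) (simp add: inner_add_left inner_diff_left algebra_simps)
  also have "\<dots> = Ric h x w z + hess x w z - n * hess x w z - h x w z * (\<Sum>i\<in>Basis. hess_op x i \<bullet> i)
    + h x (hess_op x w) z + n * (p z * p w) - p z * p w - n * (p (grad x) * h x w z)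
    + p (grad x) * h x w z + h x w z * p (grad x) - p w * h x (grad x) z"
    unfolding sum.distrib sum_subtractf sum_distrib_left[symmetric]
      trace_rank_one[OF lin1[OF x]] trace_rank_one[OF hess_lin1[OF x]] p_def
      trace_rank_one[OF d\<omega>_lin[OF x]] trace_id n_def Ric_def by simp
  finally show ?thesis
    unfolding tr h_hess_op[OF x] h_grad[OF x] p_def[symmetric] by (simp add: algebra_simps)
qed

lemma sharp_conf: "x \<in> U \<Longrightarrow> sharp h' x w = exp (- 2 * \<omega> x) *\<^sub>R sharp h x w"
  by (rule conf.sharp_unique) (simp_all add: linear_cmul[OF lin1] h_sharp mult_exp_exp flip: mult.assoc)

text \<open>The sum over \<open>hess\<close> is the Laplacian of \<omega> and
  \<open>dderiv \<omega> x (grad x)\<close> is the squared length of its gradient, both for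
  \<open>h\<close>. Tracing the Ricci formula once more adds n Laplacians to the n - 2 already
  there, which explains the coefficient 2 (n - 1).\<close>

theorem coord_scalar_curvature_conf:
  assumes x: "x \<in> U"
  defines "n \<equiv> real DIM('e)"
  shows "exp (2 * \<omega> x) * coord_scalar_curvature h' x = coord_scalar_curvature h x
    - 2 * (n - 1) * (\<Sum>i\<in>Basis. hess x i (sharp h x i))
    - (n - 1) * (n - 2) * dderiv \<omega> x (grad x)"
proof -
  let ?p = "dderiv \<omega> x" and ?s = "sharp h x"
  have hs: "h x j (?s j) = j \<bullet> j" for j using h_sharp[OF x, of j j] sym[OF x] by simp
  have ps: "(\<Sum>j\<in>Basis. ?p j * ?p (?s j)) = ?p (grad x)"
  proof -
    have "?p (?s j) = grad x \<bullet> j" for j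
      using h_grad[OF x, of "?s j"] h_sharp[OF x, of j "grad x"] sym[OF x] by (metis inner_commute)
    then show ?thesis using trace_rank_one[OF d\<omega>_lin[OF x]] by simp
  qed
  have "Ric h' x j (sharp h' x j) = exp (- 2 * \<omega> x) * Ric h' x j (?s j)" for j
    by (simp add: sharp_conf[OF x] linear_cmul[OF conf.Ric_lin2[OF x]])
  then have "exp (2 * \<omega> x) * coord_scalar_curvature h' x = (\<Sum>j\<in>Basis. Ric h' x j (?s j))"
    unfolding conf.coord_scalar_curvature_eq[OF x] by (simp add: sum_distrib_left mult_exp_exp flip: mult.assoc)
  also have "\<dots> = coord_scalar_curvature h x - (n - 2) * (\<Sum>i\<in>Basis. hess x i (?s i))
     - n * (\<Sum>i\<in>Basis. hess x i (?s i)) + (n - 2) * ?p (grad x) - (n - 2) * ?p (grad x) * n"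
    unfolding Ric_conf[OF x] n_def[symmetric] coord_scalar_curvature_eq[OF x] sum.distrib sum_subtractf hs
      sum_distrib_left[symmetric] sum_distrib_right[symmetric] trace_id ps by (simp add: n_def)
  finally show ?thesis by (simp add: algebra_simps)
qed

end

subsection \<open>Invariance of the scalar curvature under isometries\<close>

text \<open>Chain and product rule combined, in the form needed to differentiate the pullback
  identities of a metric and of a Christoffel map.\<close>

lemma has_derivative_bilinear_compose:
  fixes \<phi> :: "'a::euclidean_space \<Rightarrow> 'b::euclidean_space"
    and B :: "'b \<Rightarrow> 'c::euclidean_space \<Rightarrow> 'd::euclidean_space \<Rightarrow> 'f::euclidean_space"
  assumes U: "open U" "x \<in> U" and U': "open U'" "\<phi> ` U \<subseteq> U'"
    and lin1: "\<And>y b. y \<in> U' \<Longrightarrow> linear (\<lambda>a. B y a b)"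
    and lin2: "\<And>y a. y \<in> U' \<Longrightarrow> linear (B y a)"
    and B: "\<And>a b. smooth_on U' (\<lambda>y. B y a b)"
    and \<phi>: "smooth_on U \<phi>" and f: "smooth_on U f" and g: "smooth_on U g"
  shows "((\<lambda>y. B (\<phi> y) (f y) (g y)) has_derivative
    (\<lambda>v. dderiv (\<lambda>y. B y (f x) (g x)) (\<phi> x) (dderiv \<phi> x v)
       + B (\<phi> x) (f x) (dderiv g x v) + B (\<phi> x) (dderiv f x v) (g x))) (at x)"
proof -
  have \<phi>U: "\<phi> y \<in> U'" if "y \<in> U" for y using that U' by auto
  have s: "smooth_on U (\<lambda>y. B (\<phi> y) a b)" for a b
    by (rule smooth_on_compose[OF U(1) U' \<phi> B])
  have l2: "linear (B (\<phi> y) a)" if "y \<in> U" for y a by (rule lin2[OF \<phi>U[OF that]])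
  have l1: "linear (\<lambda>a. B (\<phi> y) a b)" if "y \<in> U" for y b by (rule lin1[OF \<phi>U[OF that]])
  have s1: "smooth_on U (\<lambda>y. B (\<phi> y) a (g y))" for a
    by (rule smooth_on_apply[where F="\<lambda>y. B (\<phi> y) a", OF U(1) l2 s g])
  have 1: "((\<lambda>y. B (\<phi> y) (f y) (g y)) has_derivative
      (\<lambda>v. dderiv (\<lambda>y. B (\<phi> y) (f x) (g y)) x v + B (\<phi> x) (dderiv f x v) (g x))) (at x)"
    by (rule has_derivative_apply[where F="\<lambda>y a. B (\<phi> y) a (g y)", OF U l1 s1
          smooth_on_has_derivative[OF f U(2)]])
  have 2: "dderiv (\<lambda>y. B (\<phi> y) (f x) (g y)) x =
      (\<lambda>v. dderiv (\<lambda>y. B (\<phi> y) (f x) (g x)) x v + B (\<phi> x) (f x) (dderiv g x v))"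
    by (intro dderivI has_derivative_apply[where F="\<lambda>y. B (\<phi> y) (f x)", OF U l2 s]
          smooth_on_has_derivative[OF g U(2)])
  have 3: "dderiv (\<lambda>y. B (\<phi> y) (f x) (g x)) x =
      (\<lambda>v. dderiv (\<lambda>y. B y (f x) (g x)) (\<phi> x) (dderiv \<phi> x v))"
    by (rule dderivI, rule has_derivative_compose[OF smooth_on_has_derivative[OF \<phi> U(2)]
          smooth_on_has_derivative[OF B \<phi>U[OF U(2)]]])
  show ?thesis using 1 unfolding 2 3 .
qed

context coord_metric
begin

lemma Riem_antisym: "Riem h x v w z = - Riem h x w v z"
  unfolding Riem_def by simp

lemma Riem_lin2: assumes x: "x \<in> U" shows "linear (\<lambda>w. Riem h x v w z)"
proof -
  have "linear (\<lambda>w. dderiv (\<lambda>y. Gam h y w z) x v)"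
    by (rule linear_dderiv_param[OF open_U x Gam_lin1 smooth_Gam])
  moreover have "linear (\<lambda>w. dderiv (\<lambda>y. Gam h y v z) x w)"
    using has_derivative_linear[OF smooth_on_has_derivative[OF smooth_Gam x]] by simp
  moreover have "linear (\<lambda>w. Gam h x v (Gam h x w z))"
    using linear_compose[OF Gam_lin1[OF x] Gam_lin2[OF x]] by (simp add: o_def)
  ultimately show ?thesis
    unfolding Riem_def by (intro linear_compose_add linear_compose_sub Gam_lin1[OF x])
qed

lemma Riem_lin1: assumes x: "x \<in> U" shows "linear (\<lambda>v. Riem h x v w z)"
  using linear_compose_neg[OF Riem_lin2[OF x]] by (subst Riem_antisym)

lemma Ric_lin1: "x \<in> U \<Longrightarrow> linear (\<lambda>w. Ric h x w z)"
  unfolding Ric_def by (intro linear_compose_sum ballI bounded_linear.linear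
    bounded_linear_inner_left_comp Riem_lin2[unfolded linear_conv_bounded_linear])

text \<open>The raised index moves to the other slot by the symmetry of the inverse matrix.\<close>

lemma coord_scalar_curvature_eq_left:
  assumes x: "x \<in> U"
  shows "coord_scalar_curvature h x = (\<Sum>j\<in>Basis. Ric h x (sharp h x j) j)"
proof -
  have "(\<Sum>j\<in>Basis. Ric h x j (sharp h x j)) = (\<Sum>j\<in>Basis. \<Sum>k\<in>Basis. (sharp h x j \<bullet> k) * Ric h x j k)"
    by (intro sum.cong refl) (subst linear_euclidean_expand[OF Ric_lin2[OF x]], simp)
  also have "\<dots> = (\<Sum>k\<in>Basis. \<Sum>j\<in>Basis. Ric h x j k * (sharp h x k \<bullet> j))"
    by (subst sum.swap) (simp add: sharp_commute[OF x] mult.commute)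
  also have "\<dots> = (\<Sum>k\<in>Basis. Ric h x (sharp h x k) k)"
    by (intro sum.cong refl trace_rank_one[OF Ric_lin1[OF x]])
  finally show ?thesis unfolding coord_scalar_curvature_eq[OF x] .
qed

end

text \<open>Invariance of the trace under conjugation, for an isomorphism between two possibly
  different spaces.\<close>

lemma trace_similar:
  fixes A :: "'a::euclidean_space \<Rightarrow> 'b::euclidean_space"
  assumes A: "linear A" and C: "linear C" and AC: "\<And>y. A (C y) = y" and T: "linear T"
  shows "(\<Sum>i\<in>Basis. C (T (A i)) \<bullet> i) = (\<Sum>b\<in>Basis. T b \<bullet> b)"
proof -
  have "(\<Sum>i\<in>Basis. C (T (A i)) \<bullet> i) = (\<Sum>i\<in>Basis. \<Sum>b\<in>Basis. (T (A i) \<bullet> b) * (C b \<bullet> i))"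
    by (intro sum.cong refl) (subst linear_euclidean_expand[OF C], simp add: inner_sum_left)
  also have "\<dots> = (\<Sum>b\<in>Basis. \<Sum>i\<in>Basis. (T (A i) \<bullet> b) * (C b \<bullet> i))" by (rule sum.swap)
  also have "\<dots> = (\<Sum>b\<in>Basis. T (A (C b)) \<bullet> b)"
  proof (intro sum.cong refl trace_rank_one)
    fix b :: 'b
    have "linear (\<lambda>i. T (A i))" using linear_compose[OF A T] by (simp add: o_def)
    then show "linear (\<lambda>i. T (A i) \<bullet> b)"
      by (intro bounded_linear.linear bounded_linear_inner_left_comp) (simp add: linear_conv_bounded_linear)
  qed
  finally show ?thesis by (simp add: AC)
qed

text \<open>\<phi> is a local isometry between coordinate domains; equality of dimensions turns
  injectivity of its differential into invertibility.\<close>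

locale coord_isometry = coord_metric U h + target: coord_metric U' h'
  for U :: "'a::euclidean_space set" and h and U' :: "'b::euclidean_space set" and h' +
  fixes \<phi> :: "'a \<Rightarrow> 'b"
  assumes smooth_\<phi>: "smooth_on U \<phi>" and \<phi>_U: "\<phi> ` U \<subseteq> U'" and dims: "DIM('a) = DIM('b)"
    and pullback: "x \<in> U \<Longrightarrow> h x v w = h' (\<phi> x) (dderiv \<phi> x v) (dderiv \<phi> x w)"
begin

lemma \<phi>_mem: "x \<in> U \<Longrightarrow> \<phi> x \<in> U'"
  using \<phi>_U by auto

lemma d\<phi>_lin: "x \<in> U \<Longrightarrow> linear (dderiv \<phi> x)"
  using has_derivative_linear[OF smooth_on_has_derivative[OF smooth_\<phi>]] .

lemma d\<phi>_inv:
  assumes x: "x \<in> U"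
  obtains C where "linear C" "\<And>v. C (dderiv \<phi> x v) = v" "\<And>y. dderiv \<phi> x (C y) = y"
proof -
  have "v = 0" if "dderiv \<phi> x v = 0" for v
  proof (rule ccontr)
    assume "v \<noteq> 0"
    then have "h' (\<phi> x) (dderiv \<phi> x v) (dderiv \<phi> x v) > 0" using pos[OF x] pullback[OF x] by simp
    then show False using that linear_0[OF target.lin1[OF \<phi>_mem[OF x]]] by simp
  qed
  then have inj: "inj (dderiv \<phi> x)" using linear_injective_0[OF d\<phi>_lin[OF x]] by blast
  then obtain C where C: "linear C" "C \<circ> dderiv \<phi> x = id"
    using linear_injective_left_inverse[OF d\<phi>_lin[OF x]] by blast
  have "dim (range (dderiv \<phi> x)) = dim (UNIV :: 'a set)"
    by (rule dim_image_eq[OF d\<phi>_lin[OF x]]) (simp add: inj)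
  then have "dim (range (dderiv \<phi> x)) = DIM('b)" using dims by simp
  then have "span (range (dderiv \<phi> x)) = UNIV" by (simp only: dim_eq_full)
  moreover have "span (range (dderiv \<phi> x)) = range (dderiv \<phi> x)"
    by (simp only: span_eq_iff linear_subspace_image[OF d\<phi>_lin[OF x] subspace_UNIV])
  ultimately have "surj (dderiv \<phi> x)" by simp
  have C1: "C (dderiv \<phi> x v) = v" for v using C(2) by (simp add: fun_eq_iff)
  moreover have "dderiv \<phi> x (C y) = y" for y
  proof -
    obtain v where "y = dderiv \<phi> x v" using \<open>surj (dderiv \<phi> x)\<close> by (rule surjE)
    then show ?thesis using C1 by simp
  qed
  ultimately show thesis using that C(1) by simp
qed

abbreviation D2 :: "'a \<Rightarrow> 'a \<Rightarrow> 'a \<Rightarrow> 'b" where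
  "D2 x v w \<equiv> dderiv (\<lambda>y. dderiv \<phi> y w) x v"

lemma D2_sym: "x \<in> U \<Longrightarrow> D2 x v w = D2 x w v"
  by (rule smooth_on_dderiv_commute[OF open_U _ smooth_\<phi>])

lemma dh_pullback:
  assumes x: "x \<in> U"
  shows "dh x v w z = target.dh (\<phi> x) (dderiv \<phi> x v) (dderiv \<phi> x w) (dderiv \<phi> x z)
    + h' (\<phi> x) (dderiv \<phi> x w) (D2 x v z) + h' (\<phi> x) (D2 x v w) (dderiv \<phi> x z)"
proof -
  have "dderiv (\<lambda>y. h y w z) x = dderiv (\<lambda>y. h' (\<phi> y) (dderiv \<phi> y w) (dderiv \<phi> y z)) x"
    by (rule dderiv_cong[OF open_U x smooth pullback])
  also have "\<dots> = (\<lambda>v. target.dh (\<phi> x) (dderiv \<phi> x v) (dderiv \<phi> x w) (dderiv \<phi> x z)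
    + h' (\<phi> x) (dderiv \<phi> x w) (D2 x v z) + h' (\<phi> x) (D2 x v w) (dderiv \<phi> x z))"
    by (rule dderivI, rule has_derivative_bilinear_compose[OF open_U x target.open_U \<phi>_U target.lin1
          target.lin2 target.smooth smooth_\<phi> smooth_on_dderiv[OF smooth_\<phi>] smooth_on_dderiv[OF smooth_\<phi>]])
  finally show ?thesis by simp
qed

text \<open>The transformation law of Christoffel symbols. Every test vector has the form
  \<open>dderiv \<phi> x z\<close>, and in the Koszul formula the second derivatives of \<phi>,
  being symmetric, cancel except for \<open>D2 x v w\<close>.\<close>

lemma Gam_pullback:
  assumes x: "x \<in> U"
  shows "dderiv \<phi> x (Gam h x v w) = D2 x v w + Gam h' (\<phi> x) (dderiv \<phi> x v) (dderiv \<phi> x w)"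
proof (rule target.nondegenerate[OF \<phi>_mem[OF x]])
  fix y
  obtain z where y: "y = dderiv \<phi> x z" using d\<phi>_inv[OF x] by metis
  have "h' (\<phi> x) (dderiv \<phi> x (Gam h x v w)) y = h x (Gam h x v w) z"
    using pullback[OF x] y by simp
  also have "\<dots> = h' (\<phi> x) (D2 x v w + Gam h' (\<phi> x) (dderiv \<phi> x v) (dderiv \<phi> x w)) y"
    unfolding h_Gam[OF x] dh_pullback[OF x] y linear_add[OF target.lin1[OF \<phi>_mem[OF x]]]
      target.h_Gam[OF \<phi>_mem[OF x]] D2_sym[OF x, of w v] D2_sym[OF x, of z]
      target.sym[OF \<phi>_mem[OF x], of _ "D2 x _ _"]
    by (simp add: field_simps)
  finally show "h' (\<phi> x) (dderiv \<phi> x (Gam h x v w)) y =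
     h' (\<phi> x) (D2 x v w + Gam h' (\<phi> x) (dderiv \<phi> x v) (dderiv \<phi> x w)) y" .
qed

text \<open>The derivative of \<open>Gam_pullback\<close> in direction v, with the product rule
  applied to both sides.\<close>

lemma dGam_pullback:
  assumes x: "x \<in> U"
  shows "D2 x v (Gam h x w z) + dderiv \<phi> x (dderiv (\<lambda>y. Gam h y w z) x v) =
    dderiv (\<lambda>y. D2 y w z) x v
    + (dderiv (\<lambda>y. Gam h' y (dderiv \<phi> x w) (dderiv \<phi> x z)) (\<phi> x) (dderiv \<phi> x v)
       + Gam h' (\<phi> x) (dderiv \<phi> x w) (D2 x v z) + Gam h' (\<phi> x) (D2 x v w) (dderiv \<phi> x z))"
proof -
  have s: "smooth_on U (\<lambda>y. dderiv \<phi> y (Gam h y w z))"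
    by (rule smooth_on_apply[OF open_U d\<phi>_lin smooth_on_dderiv[OF smooth_\<phi>] smooth_Gam])
  have "dderiv (\<lambda>y. dderiv \<phi> y (Gam h y w z)) x = dderiv (\<lambda>y. D2 y w z
      + Gam h' (\<phi> y) (dderiv \<phi> y w) (dderiv \<phi> y z)) x"
    by (rule dderiv_cong[OF open_U x s Gam_pullback])
  also have "\<dots> = (\<lambda>v. dderiv (\<lambda>y. D2 y w z) x v
    + (dderiv (\<lambda>y. Gam h' y (dderiv \<phi> x w) (dderiv \<phi> x z)) (\<phi> x) (dderiv \<phi> x v)
       + Gam h' (\<phi> x) (dderiv \<phi> x w) (D2 x v z) + Gam h' (\<phi> x) (D2 x v w) (dderiv \<phi> x z)))"
    by (rule dderivI, rule has_derivative_add,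
        rule smooth_on_has_derivative[OF smooth_on_dderiv[OF smooth_on_dderiv[OF smooth_\<phi>]] x],
        rule has_derivative_bilinear_compose[OF open_U x target.open_U \<phi>_U target.Gam_lin1
          target.Gam_lin2 target.smooth_Gam smooth_\<phi> smooth_on_dderiv[OF smooth_\<phi>] smooth_on_dderiv[OF smooth_\<phi>]])
  finally have 1: "dderiv (\<lambda>y. dderiv \<phi> y (Gam h y w z)) x v = dderiv (\<lambda>y. D2 y w z) x v
    + (dderiv (\<lambda>y. Gam h' y (dderiv \<phi> x w) (dderiv \<phi> x z)) (\<phi> x) (dderiv \<phi> x v)
       + Gam h' (\<phi> x) (dderiv \<phi> x w) (D2 x v z) + Gam h' (\<phi> x) (D2 x v w) (dderiv \<phi> x z))"
    by simp
  have "dderiv (\<lambda>y. dderiv \<phi> y (Gam h y w z)) x =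
      (\<lambda>v. D2 x v (Gam h x w z) + dderiv \<phi> x (dderiv (\<lambda>y. Gam h y w z) x v))"
    by (rule dderivI, rule has_derivative_apply[OF open_U x d\<phi>_lin smooth_on_dderiv[OF smooth_\<phi>]
          smooth_on_has_derivative[OF smooth_Gam x]])
  with 1 show ?thesis by simp
qed

text \<open>Antisymmetrizing \<open>dGam_pullback\<close> in v and w cancels the third derivatives
  of \<phi>; rewriting with \<open>Gam_pullback\<close> then accounts for the second derivatives, so
  curvature is tensorial.\<close>

lemma Riem_pullback:
  assumes x: "x \<in> U"
  shows "dderiv \<phi> x (Riem h x v w z) =
    Riem h' (\<phi> x) (dderiv \<phi> x v) (dderiv \<phi> x w) (dderiv \<phi> x z)"
proof -
  note lin = linear_add[OF d\<phi>_lin[OF x]] linear_diff[OF d\<phi>_lin[OF x]]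
    linear_add[OF target.Gam_lin2[OF \<phi>_mem[OF x]]] 
  have D3: "dderiv (\<lambda>y. D2 y w z) x v = dderiv (\<lambda>y. D2 y v z) x w"
    by (rule smooth_on_dderiv_commute[OF open_U x smooth_on_dderiv[OF smooth_\<phi>]])
  show ?thesis
    \<comment> \<open>Adding one equation to the reversed equation with v and w exchanged takes
      their difference without rearranging either.\<close>
    using arg_cong2[of _ _ _ _ "(+)", OF dGam_pullback[OF x, of w z v] dGam_pullback[OF x, of v z w, symmetric]]
    unfolding Riem_def lin Gam_pullback[OF x] D3 D2_sym[OF x, of w v]
      target.Gam_sym[OF \<phi>_mem[OF x], of "D2 x _ _"]
    by (simp add: algebra_simps)
qed

lemma Ric_pullback:
  assumes x: "x \<in> U"
  shows "Ric h x w z = Ric h' (\<phi> x) (dderiv \<phi> x w) (dderiv \<phi> x z)"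
proof -
  obtain C where C: "linear C" "\<And>v. C (dderiv \<phi> x v) = v" "\<And>y. dderiv \<phi> x (C y) = y"
    using d\<phi>_inv[OF x] by blast
  have "Riem h x i w z = C (Riem h' (\<phi> x) (dderiv \<phi> x i) (dderiv \<phi> x w) (dderiv \<phi> x z))" for i
    using Riem_pullback[OF x, of i w z] C(2) by metis
  then show ?thesis unfolding Ric_def
    using trace_similar[OF d\<phi>_lin[OF x] C(1,3) target.Riem_lin1[OF \<phi>_mem[OF x]]] by simp
qed

theorem coord_scalar_curvature_pullback:
  assumes x: "x \<in> U"
  shows "coord_scalar_curvature h x = coord_scalar_curvature h' (\<phi> x)"
proof -
  let ?A = "dderiv \<phi> x" and ?R = "Ric h' (\<phi> x)" and ?s = "sharp h x" and ?s' = "sharp h' (\<phi> x)"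
  note y = \<phi>_mem[OF x]
  obtain C where C: "linear C" "\<And>v. C (?A v) = v" "\<And>y. ?A (C y) = y"
    using d\<phi>_inv[OF x] by blast
  \<comment> \<open>With respect to the Euclidean inner products, the differential composed with
    \<open>sharp\<close> has as transpose the inverse differential composed with
    \<open>sharp\<close> of the target. This moves the trace from one space to the other.\<close>
  have s: "?A (?s j) \<bullet> b = C (?s' b) \<bullet> j" for j b
  proof -
    have "?A (?s j) \<bullet> b = h' (\<phi> x) (?s' b) (?A (?s j))"
      using target.h_sharp[OF y, of b] by (simp add: inner_commute)
    also have "\<dots> = h x (C (?s' b)) (?s j)" using pullback[OF x] C(3) by simp
    also have "\<dots> = C (?s' b) \<bullet> j" using h_sharp[OF x] sym[OF x] by (metis inner_commute)
    finally show ?thesis .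
  qed
  have "coord_scalar_curvature h x = (\<Sum>j\<in>Basis. ?R (?A j) (?A (?s j)))"
    unfolding coord_scalar_curvature_eq[OF x] Ric_pullback[OF x] ..
  also have "\<dots> = (\<Sum>j\<in>Basis. \<Sum>b\<in>Basis. (?A (?s j) \<bullet> b) * ?R (?A j) b)"
    by (intro sum.cong refl) (subst linear_euclidean_expand[OF target.Ric_lin2[OF y]], simp)
  also have "\<dots> = (\<Sum>b\<in>Basis. \<Sum>j\<in>Basis. ?R (?A j) b * (C (?s' b) \<bullet> j))"
    by (subst sum.swap) (simp add: s mult.commute)
  also have "\<dots> = (\<Sum>b\<in>Basis. ?R (?A (C (?s' b))) b)"
    using linear_compose[OF d\<phi>_lin[OF x] target.Ric_lin1[OF y]]
    by (intro sum.cong refl trace_rank_one) (simp add: o_def)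
  finally show ?thesis unfolding C(3) target.coord_scalar_curvature_eq_left[OF y] .
qed

end

subsection \<open>Traces of positive semidefinite forms\<close>

lemma sum2_insert:
  fixes f :: "'i \<Rightarrow> 'i \<Rightarrow> real"
  assumes "finite B" "b \<notin> B"
  shows "(\<Sum>i\<in>insert b B. \<Sum>j\<in>insert b B. f i j)
    = f b b + (\<Sum>i\<in>B. f i b) + (\<Sum>j\<in>B. f b j) + (\<Sum>i\<in>B. \<Sum>j\<in>B. f i j)"
  using assms by (simp add: sum.distrib)

text \<open>Splitting off the rank-one part \<open>P i b * P j b / P b b\<close> leaves a form that
  is zero in row and column b and still positive definite on B. The rank-one part pairs with
  \<open>Q\<close> to a value of its quadratic form, so no diagonalization is involved.\<close>

lemma sum_mult_psd_nonneg:
  fixes P Q :: "'i \<Rightarrow> 'i \<Rightarrow> real"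
  assumes "finite B" and "\<And>i j. P i j = P j i"
    and "\<And>c. \<exists>i\<in>B. c i \<noteq> 0 \<Longrightarrow> (\<Sum>i\<in>B. \<Sum>j\<in>B. c i * c j * P i j) > 0"
    and "\<And>c. (\<Sum>i\<in>B. \<Sum>j\<in>B. c i * c j * Q i j) \<ge> 0"
  shows "(\<Sum>i\<in>B. \<Sum>j\<in>B. P i j * Q i j) \<ge> 0"
  using assms
proof (induction B arbitrary: P rule: finite_induct)
  case (insert b B)
  let ?I = "insert b B"
  note P_sym = insert.prems(1) and P_pos = insert.prems(2) and Q_psd = insert.prems(3)
  note ins = sum2_insert[OF insert.hyps]
  have p: "P b b > 0"
  proof -
    define e where "e = (\<lambda>i. if i = b then 1 else 0 :: real)"
    have e: "e b = 1" "\<And>i. i \<in> B \<Longrightarrow> e i = 0" using insert.hyps(2) by (auto simp: e_def)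
    have "(\<Sum>i\<in>?I. \<Sum>j\<in>?I. e i * e j * P i j) > 0" by (rule P_pos) (simp add: e(1))
    also have "(\<Sum>i\<in>?I. \<Sum>j\<in>?I. e i * e j * P i j) = P b b"
      unfolding ins by (simp add: e)
    finally show ?thesis .
  qed
  \<comment> \<open>Schur complement: one step of a Cholesky decomposition of \<open>P\<close>.\<close>
  define P' where "P' = (\<lambda>i j. P i j - P i b * P j b / P b b)"
  have "(\<Sum>i\<in>B. \<Sum>j\<in>B. P' i j * Q i j) \<ge> 0"
  proof (rule insert.IH)
    show "P' i j = P' j i" for i j unfolding P'_def P_sym[of i j] by (simp only: mult.commute)
    fix c assume c: "\<exists>i\<in>B. c i \<noteq> (0::real)"
    define S where "S = (\<Sum>i\<in>B. c i * P i b)"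
    \<comment> \<open>The value at b minimizes the quadratic form of \<open>P\<close> in that
      coordinate; the minimum is the quadratic form of the Schur complement at c.\<close>
    define c' where "c' = c(b := - S / P b b)"
    have c'B: "c' i = c i" if "i \<in> B" for i using that insert.hyps(2) by (auto simp: c'_def)
    have c'b: "c' b = - S / P b b" by (simp add: c'_def)
    have "(\<Sum>i\<in>B. c' i * c' b * P i b) = (\<Sum>i\<in>B. (- S / P b b) * (c i * P i b))"
      by (intro sum.cong refl) (simp add: c'B c'b)
    then have 1: "(\<Sum>i\<in>B. c' i * c' b * P i b) = - S / P b b * S"
      by (simp only: S_def sum_distrib_left[symmetric])
    have 2: "(\<Sum>j\<in>B. c' b * c' j * P b j) = - S / P b b * S"
      unfolding 1[symmetric] by (intro sum.cong refl) (simp only: P_sym[of b] mult.commute[of "c' b"])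
    have SS: "S * S / P b b = (\<Sum>i\<in>B. \<Sum>j\<in>B. c i * P i b * (c j * P j b) / P b b)"
      unfolding S_def by (simp only: sum_product sum_divide_distrib)
    have 3: "(\<Sum>i\<in>B. \<Sum>j\<in>B. c i * c j * P' i j)
        = (\<Sum>i\<in>B. \<Sum>j\<in>B. c i * c j * P i j) - S * S / P b b"
      unfolding SS sum_subtractf[symmetric]
      by (intro sum.cong refl) (simp add: P'_def algebra_simps)
    have "(\<Sum>i\<in>?I. \<Sum>j\<in>?I. c' i * c' j * P i j) > 0"
      using c c'B by (intro P_pos) auto
    also have "(\<Sum>i\<in>?I. \<Sum>j\<in>?I. c' i * c' j * P i j) =
        c' b * c' b * P b b + (- S / P b b * S) + (- S / P b b * S) + (\<Sum>i\<in>B. \<Sum>j\<in>B. c i * c j * P i j)"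
      unfolding ins 1 2 by (simp add: c'B)
    also have "\<dots> = (\<Sum>i\<in>B. \<Sum>j\<in>B. c i * c j * P' i j)"
      unfolding 3 c'b using p by (simp add: field_simps)
    finally show "(\<Sum>i\<in>B. \<Sum>j\<in>B. c i * c j * P' i j) > 0" .
  next
    fix c :: "'i \<Rightarrow> real"
    define c' where "c' = c(b := 0)"
    have c': "c' i = c i" if "i \<in> B" for i using that insert.hyps(2) by (auto simp: c'_def)
    have c'b: "c' b = 0" by (simp add: c'_def)
    have "(\<Sum>i\<in>?I. \<Sum>j\<in>?I. c' i * c' j * Q i j) \<ge> 0" by (rule Q_psd)
    then show "(\<Sum>i\<in>B. \<Sum>j\<in>B. c i * c j * Q i j) \<ge> 0" unfolding ins by (simp add: c' c'b)
  qed
  moreover have P'b: "P' b j = 0" "P' j b = 0" for j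
    using p P_sym[of b j] by (simp_all add: P'_def)
  ultimately have "(\<Sum>i\<in>?I. \<Sum>j\<in>?I. P' i j * Q i j) \<ge> 0" unfolding ins P'b by simp
  moreover have "(\<Sum>i\<in>?I. \<Sum>j\<in>?I. P i b * P j b * Q i j) / P b b \<ge> 0"
    by (rule divide_nonneg_pos[OF Q_psd p])
  moreover have "(\<Sum>i\<in>?I. \<Sum>j\<in>?I. P i j * Q i j) = (\<Sum>i\<in>?I. \<Sum>j\<in>?I. P' i j * Q i j)
      + (\<Sum>i\<in>?I. \<Sum>j\<in>?I. P i b * P j b * Q i j) / P b b"
    unfolding sum_divide_distrib sum.distrib[symmetric] P'_def
    by (intro sum.cong refl) (simp add: algebra_simps)
  ultimately show ?case by linarith
qed simp

text \<open>With the inverse metric as the positive definite matrix, this gives the sign of the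
  Laplacian at a minimum.\<close>

lemma (in coord_metric) trace_psd_nonneg:
  assumes x: "x \<in> U" and Q: "bilinear Q" and psd: "\<And>v. Q v v \<ge> (0::real)"
  shows "(\<Sum>i\<in>Basis. Q i (sharp h x i)) \<ge> 0"
proof -
  have Q2: "linear (Q v)" and Q1: "linear (\<lambda>v. Q v w)" for v w using Q by (auto simp: bilinear_def)
  have quad: "B v v = (\<Sum>i\<in>Basis. \<Sum>j\<in>Basis. (v \<bullet> i) * (v \<bullet> j) * B i j)"
    if "\<And>v. linear (B v)" "\<And>w. linear (\<lambda>v. B v w)" for B :: "'e \<Rightarrow> 'e \<Rightarrow> real" and v
    by (subst linear_euclidean_expand[OF that(2)], subst linear_euclidean_expand[OF that(1)])
      (simp add: sum_distrib_left mult_ac)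
  have vec: "(\<Sum>k\<in>Basis. c k *\<^sub>R k) \<bullet> i = c i" if "i \<in> Basis" for c :: "'e \<Rightarrow> real" and i
    using that by (simp add: inner_sum_left inner_Basis if_distrib cong: if_cong)
  have s2: "linear (\<lambda>w. sharp h x v \<bullet> w)" for v
    by (intro bounded_linear.linear bounded_linear_inner_right)
  have s1: "linear (\<lambda>v. sharp h x v \<bullet> w)" for w by (subst sharp_commute[OF x]) (rule s2)
  have "(\<Sum>i\<in>Basis. \<Sum>j\<in>Basis. (sharp h x i \<bullet> j) * Q i j) \<ge> 0"
  proof (rule sum_mult_psd_nonneg)
    fix c :: "'e \<Rightarrow> real"
    let ?v = "\<Sum>k\<in>Basis. c k *\<^sub>R k"
    have "(\<Sum>i\<in>Basis. \<Sum>j\<in>Basis. c i * c j * Q i j) = Q ?v ?v"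
      unfolding quad[OF Q2 Q1, of ?v] by (intro sum.cong refl) (simp only: vec)
    then show "(\<Sum>i\<in>Basis. \<Sum>j\<in>Basis. c i * c j * Q i j) \<ge> 0" using psd by simp
    have "(\<Sum>i\<in>Basis. \<Sum>j\<in>Basis. c i * c j * (sharp h x i \<bullet> j)) = sharp h x ?v \<bullet> ?v"
      unfolding quad[OF s2 s1, of ?v] by (intro sum.cong refl) (simp only: vec)
    moreover assume "\<exists>i\<in>Basis. c i \<noteq> 0"
    then have "?v \<noteq> 0" using vec by (metis inner_zero_left)
    ultimately show "(\<Sum>i\<in>Basis. \<Sum>j\<in>Basis. c i * c j * (sharp h x i \<bullet> j)) > 0"
      using sharp_pos[OF x] by simp
  qed (simp_all add: sharp_commute[OF x])
  then show ?thesis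
    by (subst linear_euclidean_expand[OF Q2]) simp
qed

subsection \<open>The hyperbolic cone is conformal to a product\<close>

definition cyl :: "('f::euclidean_space \<Rightarrow> 'f \<Rightarrow> 'f \<Rightarrow> real) \<Rightarrow>
    real \<times> 'f \<Rightarrow> real \<times> 'f \<Rightarrow> real \<times> 'f \<Rightarrow> real" where
  "cyl k x v w = inverse ((sinh (fst x))\<^sup>2) * (fst v * fst w) + k (snd x) (snd v) (snd w)"

lemma sum_Basis_real_prod:
  fixes f :: "real \<times> 'f::euclidean_space \<Rightarrow> 'b::comm_monoid_add"
  shows "sum f Basis = f (1, 0) + (\<Sum>i\<in>Basis. f (0, i))"
proof -
  have "inj_on (\<lambda>v. (0::real, v::'f)) Basis" by (auto intro!: inj_onI)
  moreover have "(1::real, 0::'f) \<notin> (\<lambda>v. (0, v)) ` Basis" by auto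
  ultimately show ?thesis unfolding Basis_prod_def by (simp add: sum.reindex)
qed

lemma smooth_on_fst: "open S \<Longrightarrow> smooth_on S fst"
  and smooth_on_snd: "open S \<Longrightarrow> smooth_on S snd"
  using smooth_on_bounded_linear[OF _ bounded_linear_fst smooth_on_id]
    smooth_on_bounded_linear[OF _ bounded_linear_snd smooth_on_id] by auto

locale cylinder = base: coord_metric V k
  for V :: "'f::euclidean_space set" and k +
  fixes r0 :: real assumes r0: "r0 \<ge> 0"
begin

abbreviation W :: "(real \<times> 'f) set" where "W \<equiv> {r0<..} \<times> V"

lemma open_W: "open W" using base.open_U by (auto intro: open_Times)

lemma sinh_pos: "x \<in> W \<Longrightarrow> sinh (fst x) > 0"
  using r0 by auto

lemma has_derivative_cyl:
  assumes x: "x \<in> W"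
  shows "((\<lambda>x. cyl k x v w) has_derivative (\<lambda>z. - 2 * cosh (fst x) / sinh (fst x) ^ 3 * fst z * (fst v * fst w)
    + base.dh (snd x) (snd z) (snd v) (snd w))) (at x)"
proof -
  have y: "snd x \<in> V" using x by auto
  have 1: "((\<lambda>r. inverse ((sinh r)\<^sup>2)) has_real_derivative - 2 * cosh (fst x) / sinh (fst x) ^ 3) (at (fst x))"
    using sinh_pos[OF x] by (auto intro!: derivative_eq_intros simp: field_simps power2_eq_square power3_eq_cube)
  have 2: "((\<lambda>x. inverse ((sinh (fst x))\<^sup>2)) has_derivative
      (\<lambda>z. - 2 * cosh (fst x) / sinh (fst x) ^ 3 * fst z)) (at x)"
    using has_derivative_compose[OF bounded_linear_imp_has_derivative[OF bounded_linear_fst]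
        1[unfolded has_field_derivative_def]] .
  have 3: "((\<lambda>x. k (snd x) (snd v) (snd w)) has_derivative (\<lambda>z. base.dh (snd x) (snd z) (snd v) (snd w))) (at x)"
    by (rule has_derivative_compose[OF bounded_linear_imp_has_derivative[OF bounded_linear_snd]
        smooth_on_has_derivative[OF base.smooth y]])
  show ?thesis unfolding cyl_def by (intro has_derivative_add has_derivative_mult_left 2 3)
qed

sublocale coord_metric W "cyl k"
proof
  show "open W" by (rule open_W)
  fix x assume x: "x \<in> W"
  then have y: "snd x \<in> V" by auto
  show "cyl k x v w = cyl k x w v" for v w
    unfolding cyl_def using base.sym[OF y, of "snd v" "snd w"] by (simp add: mult.commute)
  show "bilinear (cyl k x)"
    unfolding bilinear_def
    by (auto intro!: linearI simp: cyl_def linear_add[OF base.lin1[OF y]] linear_add[OF base.lin2[OF y]]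
        linear_cmul[OF base.lin1[OF y]] linear_cmul[OF base.lin2[OF y]] algebra_simps)
  show "cyl k x v v > 0" if "v \<noteq> 0" for v
  proof (cases "snd v = 0")
    case True
    then have "fst v \<noteq> 0" using that by (simp add: prod_eq_iff)
    then have "fst v * fst v > 0" by (auto simp: zero_less_mult_iff)
    then show ?thesis
      unfolding cyl_def using True sinh_pos[OF x] linear_0[OF base.lin2[OF y]] by simp
  next
    case False
    then show ?thesis unfolding cyl_def using base.pos[OF y False]
      by (intro add_nonneg_pos mult_nonneg_nonneg[OF _ zero_le_square]) auto
  qed
next
  show "smooth_on W (\<lambda>x. cyl k x v w)" for v w
    unfolding cyl_def power2_eq_square
  proof (intro smooth_on_add smooth_on_mult smooth_on_const smooth_on_inverse_compose open_W
      smooth_on_sinh_compose smooth_on_fst)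
    show "sinh (fst x) * sinh (fst x) > 0" if "x \<in> W" for x using sinh_pos[OF that] by simp
    show "smooth_on W (\<lambda>x. k (snd x) (snd v) (snd w))"
      by (rule smooth_on_compose[OF open_W base.open_U _ smooth_on_snd[OF open_W] base.smooth]) auto
  qed
qed

lemma dh_cyl: "x \<in> W \<Longrightarrow> dh x z v w = - 2 * cosh (fst x) / sinh (fst x) ^ 3 * fst z * (fst v * fst w)
    + base.dh (snd x) (snd z) (snd v) (snd w)"
  using dderivI[OF has_derivative_cyl] by simp

text \<open>The connection splits, and the only radial symbol is minus coth r, the logarithmic
  derivative of 1 / sinh r.\<close>

lemma Gam_cyl:
  assumes x: "x \<in> W"
  shows "Gam (cyl k) x v w = (- (cosh (fst x) / sinh (fst x)) * (fst v * fst w), Gam k (snd x) (snd v) (snd w))"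
proof (rule Gam_unique[OF x])
  fix z
  have y: "snd x \<in> V" using x by auto
  show "cyl k x (- (cosh (fst x) / sinh (fst x)) * (fst v * fst w), Gam k (snd x) (snd v) (snd w)) z =
      1 / 2 * (dh x v w z + dh x w v z - dh x z v w)"
    unfolding dh_cyl[OF x] unfolding cyl_def fst_conv snd_conv base.h_Gam[OF y] using sinh_pos[OF x]
    by (simp add: field_simps power2_eq_square power3_eq_cube)
qed

lemma sharp_cyl:
  assumes x: "x \<in> W"
  shows "sharp (cyl k) x w = ((sinh (fst x))\<^sup>2 * fst w, sharp k (snd x) (snd w))"
proof (rule sharp_unique[OF x])
  have y: "snd x \<in> V" using x by auto
  show "cyl k x ((sinh (fst x))\<^sup>2 * fst w, sharp k (snd x) (snd w)) z = w \<bullet> z" for z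
    unfolding cyl_def fst_conv snd_conv base.h_sharp[OF y] inner_prod_def using sinh_pos[OF x] by simp
qed

lemma dderiv_Gam_cyl:
  assumes x: "x \<in> W"
  shows "dderiv (\<lambda>y. Gam (cyl k) y v w) x z =
    ((1 / (sinh (fst x))\<^sup>2) * fst z * (fst v * fst w), dderiv (\<lambda>y. Gam k y (snd v) (snd w)) (snd x) (snd z))"
proof -
  have y: "snd x \<in> V" using x by auto
  have 1: "((\<lambda>r. - (cosh r / sinh r)) has_real_derivative 1 / (sinh (fst x))\<^sup>2) (at (fst x))"
    using sinh_pos[OF x] cosh_square_eq[of "fst x"]
    by (auto intro!: derivative_eq_intros simp: field_simps power2_eq_square)
  have 2: "((\<lambda>x. - (cosh (fst x) / sinh (fst x))) has_derivative
      (\<lambda>z. (1 / (sinh (fst x))\<^sup>2) * fst z)) (at x)"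
    using has_derivative_compose[OF bounded_linear_imp_has_derivative[OF bounded_linear_fst]
        1[unfolded has_field_derivative_def]] .
  have 3: "((\<lambda>x. Gam k (snd x) (snd v) (snd w)) has_derivative
      (\<lambda>z. dderiv (\<lambda>y. Gam k y (snd v) (snd w)) (snd x) (snd z))) (at x)"
    by (rule has_derivative_compose[OF bounded_linear_imp_has_derivative[OF bounded_linear_snd]
        smooth_on_has_derivative[OF base.smooth_Gam y]])
  have "dderiv (\<lambda>y. Gam (cyl k) y v w) x = dderiv (\<lambda>x. (- (cosh (fst x) / sinh (fst x)) * (fst v * fst w),
      Gam k (snd x) (snd v) (snd w))) x"
    by (rule dderiv_cong[OF open_W x smooth_Gam Gam_cyl])
  also have "\<dots> = (\<lambda>z. ((1 / (sinh (fst x))\<^sup>2) * fst z * (fst v * fst w),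
      dderiv (\<lambda>y. Gam k y (snd v) (snd w)) (snd x) (snd z)))"
    by (intro dderivI has_derivative_Pair has_derivative_mult_left 2 3)
  finally show ?thesis by simp
qed

text \<open>The radial parts of the Christoffel products and derivatives are symmetric in v and w,
  so they disappear on antisymmetrizing.\<close>

lemma Riem_cyl:
  assumes x: "x \<in> W"
  shows "Riem (cyl k) x v w z = (0, Riem k (snd x) (snd v) (snd w) (snd z))"
  unfolding Riem_def dderiv_Gam_cyl[OF x] Gam_cyl[OF x] by simp

lemma coord_scalar_curvature_cyl:
  assumes x: "x \<in> W"
  shows "coord_scalar_curvature (cyl k) x = coord_scalar_curvature k (snd x)"
proof -
  have y: "snd x \<in> V" using x by auto
  have "Ric (cyl k) x w z = Ric k (snd x) (snd w) (snd z)" for w z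
    unfolding Ric_def Riem_cyl[OF x] sum_Basis_real_prod by (simp add: inner_prod_def)
  then show ?thesis
    unfolding coord_scalar_curvature_eq[OF x] base.coord_scalar_curvature_eq[OF y] sum_Basis_real_prod
      sharp_cyl[OF x] using linear_0[OF base.Ric_lin1[OF y]] by simp
qed

end

text \<open>At a minimum of \<open>\<omega> - \<Psi>\<close>, where \<open>\<Psi>\<close> depends on the radius only, the conformal metric
  has at most the scalar curvature it would have with \<open>\<Psi>\<close> in place of \<open>\<omega>\<close>.\<close>

lemma (in cylinder) scalar_curvature_at_min:
  fixes \<Psi> d1 :: "real \<Rightarrow> real" and d2 :: real
  assumes \<omega>: "smooth_on W \<omega>" and J: "open J" "smooth_on J \<Psi>"
    and d1: "\<And>t. t \<in> J \<Longrightarrow> (\<Psi> has_real_derivative d1 t) (at t)"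
    and d2: "(d1 has_real_derivative d2) (at r)"
    and X: "open X" "(r, y) \<in> X" "X \<subseteq> W" "fst ` X \<subseteq> J"
    and min: "\<And>x. x \<in> X \<Longrightarrow> \<omega> (r, y) - \<Psi> r \<le> \<omega> x - \<Psi> (fst x)"
  defines "n \<equiv> real DIM('f) + 1"
  shows "exp (2 * \<omega> (r, y)) * coord_scalar_curvature (\<lambda>x v w. exp (2 * \<omega> x) * cyl k x v w) (r, y)
    \<le> coord_scalar_curvature k y
      - (sinh r)\<^sup>2 * (n - 1) * (2 * (d2 + cosh r / sinh r * d1 r) + (n - 2) * (d1 r)\<^sup>2)"
proof -
  interpret cc: conformal_change W "cyl k" \<omega> by unfold_locales (rule \<omega>)
  let ?p = "(r, y)"
  have p: "?p \<in> W" and rJ: "r \<in> J" using X by force+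
  have s: "sinh r > 0" using sinh_pos[OF p] by simp
  define f where "f = (\<lambda>x. \<omega> x - \<Psi> (fst x))"
  have smooth_\<Psi>: "smooth_on X (\<lambda>x. \<Psi> (fst x))"
    by (rule smooth_on_compose[OF X(1) J(1) X(4) smooth_on_fst[OF X(1)] J(2)])
  have \<omega>X: "smooth_on X \<omega>" by (rule smooth_on_subset[OF \<omega> X(3)])
  have f: "smooth_on X f" unfolding f_def by (rule smooth_on_diff[OF X(1) \<omega>X smooth_\<Psi>])
  have d\<Psi>: "((\<lambda>x. \<Psi> (fst x)) has_derivative (\<lambda>v. d1 (fst x) * fst v)) (at x)" if "x \<in> X" for x
    using has_derivative_compose[OF bounded_linear_imp_has_derivative[OF bounded_linear_fst],
        of \<Psi> "(*) (d1 (fst x))" x UNIV] d1[of "fst x", unfolded has_field_derivative_def] X(4) that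
    by (simp add: image_subset_iff)
  have df: "dderiv f x v = dderiv \<omega> x v - d1 (fst x) * fst v" if "x \<in> X" for x v
    unfolding f_def
    using dderivI[OF has_derivative_diff[OF smooth_on_has_derivative[OF \<omega>X that] d\<Psi>[OF that]]] by simp
  have d2f: "dderiv (\<lambda>x. dderiv f x w) ?p v = dderiv (\<lambda>x. dderiv \<omega> x w) ?p v - d2 * fst v * fst w" for v w
  proof -
    have "((\<lambda>x. d1 (fst x) * fst w) has_derivative (\<lambda>v. d2 * fst v * fst w)) (at ?p)"
      by (rule has_derivative_mult_left) (use has_derivative_compose[OF bounded_linear_imp_has_derivative[OF bounded_linear_fst], of d1 "(*) d2" ?p UNIV]
        d2[unfolded has_field_derivative_def] in simp)
    then have "((\<lambda>x. dderiv \<omega> x w - d1 (fst x) * fst w) has_derivative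
        (\<lambda>v. dderiv (\<lambda>x. dderiv \<omega> x w) ?p v - d2 * fst v * fst w)) (at ?p)"
      by (intro has_derivative_diff smooth_on_has_derivative[OF smooth_on_dderiv[OF \<omega>X] X(2)])
    moreover have "dderiv (\<lambda>x. dderiv f x w) ?p = dderiv (\<lambda>x. dderiv \<omega> x w - d1 (fst x) * fst w) ?p"
      by (rule dderiv_cong[OF X(1,2) smooth_on_dderiv[OF f] df])
    ultimately show ?thesis by (simp add: dderivI)
  qed
  have minf: "f ?p \<le> f x" if "x \<in> X" for x using min[OF that] by (simp add: f_def)
  note crit = local_min_second_deriv_nonneg[OF X(1,2) f minf]
  \<comment> \<open>At the critical point the differential of \<omega> is that of \<Psi>, which
    makes the gradient term explicit.\<close>
  have d\<omega>: "dderiv \<omega> ?p v = d1 r * fst v" for v using crit(1)[of v] df[OF X(2), of v] by simp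
  \<comment> \<open>The second derivative of \<omega> minus the radial function, nonnegative by the
    second derivative test. The remaining part of \<open>hess\<close> is purely radial, with coth r
    coming from \<open>Gam_cyl\<close>.\<close>
  define Q where "Q = (\<lambda>v w. dderiv (\<lambda>x. dderiv f x w) ?p v)"
  have hess: "cc.hess ?p v w = Q v w + (d2 + cosh r / sinh r * d1 r) * (fst v * fst w)" for v w
    unfolding cc.hess_def d\<omega> Gam_cyl[OF p] Q_def d2f by (simp add: algebra_simps)
  have "linear (Q v)" for v
    unfolding Q_def d2f[abs_def]
    by (intro linear_compose_sub cc.dderiv2_lin[OF p]) (auto intro!: linearI simp: algebra_simps)
  moreover have "linear (\<lambda>v. Q v w)" for w
    unfolding Q_def using has_derivative_linear[OF smooth_on_has_derivative[OF smooth_on_dderiv[OF f] X(2)]] .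
  ultimately have Q: "(\<Sum>i\<in>Basis. Q i (sharp (cyl k) ?p i)) \<ge> 0"
    using crit(2) by (intro trace_psd_nonneg[OF p]) (auto simp: bilinear_def Q_def)
  have tr: "(\<Sum>i\<in>Basis. cc.hess ?p i (sharp (cyl k) ?p i)) =
      (\<Sum>i\<in>Basis. Q i (sharp (cyl k) ?p i)) + (d2 + cosh r / sinh r * d1 r) * (sinh r)\<^sup>2"
    unfolding hess sum.distrib sum_distrib_left[symmetric]
    by (simp add: sharp_cyl[OF p] sum_Basis_real_prod)
  have "cc.grad ?p = sharp (cyl k) ?p (d1 r, 0)"
    unfolding cc.grad_def d\<omega> by (simp add: sum_Basis_real_prod flip: zero_prod_def)
  then have grad: "dderiv \<omega> ?p (cc.grad ?p) = (sinh r)\<^sup>2 * (d1 r)\<^sup>2"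
    unfolding d\<omega> by (simp add: sharp_cyl[OF p] power2_eq_square)
  have dim: "real DIM(real \<times> 'f) = n" by (simp add: n_def)
  have "exp (2 * \<omega> ?p) * coord_scalar_curvature (\<lambda>x v w. exp (2 * \<omega> x) * cyl k x v w) ?p =
      coord_scalar_curvature k y
    - 2 * (n - 1) * ((\<Sum>i\<in>Basis. Q i (sharp (cyl k) ?p i)) + (d2 + cosh r / sinh r * d1 r) * (sinh r)\<^sup>2)
    - (n - 1) * (n - 2) * ((sinh r)\<^sup>2 * (d1 r)\<^sup>2)"
    using cc.coord_scalar_curvature_conf[OF p] unfolding dim tr grad coord_scalar_curvature_cyl[OF p] by simp
  moreover have "2 * (n - 1) * (\<Sum>i\<in>Basis. Q i (sharp (cyl k) ?p i)) \<ge> 0"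
    using Q by (simp add: n_def)
  moreover have "S \<le> C - s * (n - 1) * (2 * D + (n - 2) * e)"
    if "S = C - 2 * (n - 1) * (T + D * s) - (n - 1) * (n - 2) * (s * e)" "2 * (n - 1) * T \<ge> 0"
    for S C s D e T :: real
    using that by (simp add: algebra_simps)
  ultimately show ?thesis by blast
qed

subsection \<open>Charts of a Riemannian manifold\<close>

lemma coord_metric_cong:
  assumes "coord_metric U h" and eq: "\<And>x. x \<in> U \<Longrightarrow> h x = h' x"
  shows "coord_metric U h'"
proof -
  interpret coord_metric U h by fact
  show ?thesis
  proof
    show "smooth_on U (\<lambda>x. h' x v w)" for v w
      by (rule smooth_on_cong[OF open_U _ smooth]) (simp add: eq)
  qed (use open_U bilin sym pos eq in auto)
qed

lemma chart_props:
  assumes "smooth_manifold A" "i \<in> indices A"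
  shows "open (chart_dom A i)" and "open (chart_map A i ` chart_dom A i)"
    and "continuous_on (chart_dom A i) (chart_map A i)"
    and "continuous_on (chart_map A i ` chart_dom A i) (chart_inv A i)"
    and "p \<in> chart_dom A i \<Longrightarrow> chart_inv A i (chart_map A i p) = p"
    and "x \<in> chart_map A i ` chart_dom A i \<Longrightarrow> chart_map A i (chart_inv A i x) = x"
    and "x \<in> chart_map A i ` chart_dom A i \<Longrightarrow> chart_inv A i x \<in> chart_dom A i"
    and "inj_on (chart_map A i) (chart_dom A i)"
proof -
  have h: "homeomorphism (chart_dom A i) (chart_map A i ` chart_dom A i) (chart_map A i) (chart_inv A i)"
    and o: "open (chart_dom A i)" "open (chart_map A i ` chart_dom A i)"
    using assms unfolding smooth_manifold_def by auto
  show "open (chart_dom A i)" "open (chart_map A i ` chart_dom A i)" by (rule o)+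
  show "continuous_on (chart_dom A i) (chart_map A i)"
    "continuous_on (chart_map A i ` chart_dom A i) (chart_inv A i)"
    "p \<in> chart_dom A i \<Longrightarrow> chart_inv A i (chart_map A i p) = p"
    "x \<in> chart_map A i ` chart_dom A i \<Longrightarrow> chart_map A i (chart_inv A i x) = x"
    "x \<in> chart_map A i ` chart_dom A i \<Longrightarrow> chart_inv A i x \<in> chart_dom A i"
    using h unfolding homeomorphism_def by auto
  show "inj_on (chart_map A i) (chart_dom A i)"
    using h unfolding homeomorphism_def by (metis inj_on_inverseI)
qed

lemma coord_metric_chart:
  assumes "smooth_manifold A" "riemannian_metric A g" "i \<in> indices A"
  shows "coord_metric (chart_map A i ` chart_dom A i) (\<lambda>x. g i (chart_inv A i x))"
  using chart_props(2,7)[OF assms(1,3)] assms(2,3) unfolding riemannian_metric_def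
  by unfold_locales auto

lemma smooth_fun_continuous_on:
  assumes "smooth_manifold A" "smooth_fun A f"
  shows "continuous_on (carrier A) f"
  unfolding carrier_def
proof (rule continuous_on_open_UN)
  fix i assume i: "i \<in> indices A"
  note c = chart_props[OF assms(1) i]
  show "open (chart_dom A i)" by (rule c)
  have "continuous_on (chart_map A i ` chart_dom A i) (f \<circ> chart_inv A i)"
    using assms(2) i unfolding smooth_fun_def by (intro smooth_on_imp_continuous_on) auto
  then have "continuous_on (chart_dom A i) (\<lambda>p. (f \<circ> chart_inv A i) (chart_map A i p))"
    by (rule continuous_on_compose2[OF _ c(3)]) auto
  then show "continuous_on (chart_dom A i) f"
    by (rule continuous_on_cong[THEN iffD1, rotated 2]) (simp_all add: c(5))
qed

text \<open>Pairs of a chart and a natural number m index the open sets where the curvature in that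
  chart is below m. A finite subcover gives each point a chart with a controlled value, and the sum
  of the finitely many m dominates them all.\<close>

lemma coord_scalar_curvature_bounded:
  assumes N: "smooth_manifold N" "riemannian_metric N gN" "compact (carrier N)"
  obtains C where "C \<ge> 0" and "\<And>p. p \<in> carrier N \<Longrightarrow> \<exists>j\<in>indices N. p \<in> chart_dom N j \<and>
    coord_scalar_curvature (\<lambda>x. gN j (chart_inv N j x)) (chart_map N j p) \<le> C"
proof -
  define S where "S = (\<lambda>j p. coord_scalar_curvature (\<lambda>x. gN j (chart_inv N j x)) (chart_map N j p))"
  have cont: "continuous_on (chart_dom N j) (S j)" if j: "j \<in> indices N" for j
  proof -
    interpret coord_metric "chart_map N j ` chart_dom N j" "\<lambda>x. gN j (chart_inv N j x)"
      by (rule coord_metric_chart[OF N(1,2) j])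
    show ?thesis unfolding S_def
      by (rule continuous_on_compose2[OF continuous_on_coord_scalar_curvature chart_props(3)[OF N(1) j]]) auto
  qed
  define B where "B = (\<lambda>jm. {p \<in> chart_dom N (fst jm). S (fst jm) p < real (snd jm)})"
  have "open (B jm)" if "jm \<in> indices N \<times> UNIV" for jm
  proof -
    have "B jm = chart_dom N (fst jm) \<inter> S (fst jm) -` {..<real (snd jm)}" by (auto simp: B_def)
    then show ?thesis using that cont chart_props(1)[OF N(1)]
      by (auto intro!: continuous_open_preimage)
  qed
  moreover have "carrier N \<subseteq> (\<Union>jm\<in>indices N \<times> UNIV. B jm)"
  proof
    fix p assume "p \<in> carrier N"
    then obtain j where j: "j \<in> indices N" "p \<in> chart_dom N j" by (auto simp: carrier_def)
    obtain m where "S j p < real m" using reals_Archimedean2 by blast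
    then have "p \<in> B (j, m)" using j by (simp add: B_def)
    then show "p \<in> (\<Union>jm\<in>indices N \<times> UNIV. B jm)" using j by blast
  qed
  ultimately obtain D where D: "D \<subseteq> indices N \<times> UNIV" "finite D" "carrier N \<subseteq> (\<Union>jm\<in>D. B jm)"
    using compactE_image[OF N(3)] by metis
  define C where "C = (\<Sum>jm\<in>D. real (snd jm))"
  show thesis
  proof (rule that)
    show "C \<ge> 0" unfolding C_def by (intro sum_nonneg) simp
    fix p assume "p \<in> carrier N"
    then obtain jm where jm: "jm \<in> D" "p \<in> B jm" using D by blast
    have "real (snd jm) \<le> C" unfolding C_def using jm D by (intro member_le_sum) auto
    then have "p \<in> chart_dom N (fst jm)" "S (fst jm) p \<le> C" "fst jm \<in> indices N"
      using jm D by (auto simp: B_def)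
    then show "\<exists>j\<in>indices N. p \<in> chart_dom N j \<and>
      coord_scalar_curvature (\<lambda>x. gN j (chart_inv N j x)) (chart_map N j p) \<le> C"
      unfolding S_def by blast
  qed
qed

subsection \<open>The conical end in cone coordinates\<close>

locale conical_end =
  fixes M :: "('i, 'm::{t2_space,second_countable_topology}, 'e::euclidean_space) atlas"
    and g gt :: "('i, 'm, 'e) tensor2"
    and N :: "('j, 'k::{t2_space,second_countable_topology}, 'f::euclidean_space) atlas"
    and gN :: "('j, 'k, 'f) tensor2"
    and n :: nat
    and r0 :: real
    and E :: "'m set"
    and F :: "real \<times> 'k \<Rightarrow> 'm"
    and u :: "'m \<Rightarrow> real"
  assumes n: "n \<ge> 3" and dim_e: "DIM('e) = n" and dim_f: "DIM('f) = n - 1"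
    and M: "smooth_manifold M" "riemannian_metric M g"
    and N: "smooth_manifold N" "riemannian_metric N gN" "compact (carrier N)"
    and cone: "hyperbolic_conical_end M g N gN r0 E F"
    and u: "smooth_fun M u" and u_pos: "p \<in> carrier M \<Longrightarrow> u p > 0"
    and gt: "gt = conformal_metric (\<lambda>p. u p powr (4 / (real n - 2))) g"
begin

abbreviation "T \<equiv> truncated_hyp_cone N r0"

abbreviation V :: "'j \<Rightarrow> 'f set" where "V j \<equiv> chart_map N j ` chart_dom N j"

abbreviation W :: "'j \<Rightarrow> (real \<times> 'f) set" where "W j \<equiv> {r0<..} \<times> V j"

abbreviation kN :: "'j \<Rightarrow> 'f \<Rightarrow> 'f \<Rightarrow> 'f \<Rightarrow> real" where
  "kN j \<equiv> \<lambda>x. gN j (chart_inv N j x)"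

text \<open>\<open>F\<close> is read through a chart of N only. Its values stay points of M, so it
  is defined on the whole of \<open>W j\<close>, even where that meets several charts of M.\<close>

definition FW :: "'j \<Rightarrow> real \<times> 'f \<Rightarrow> 'm" where
  "FW j x = F (fst x, chart_inv N j (snd x))"

text \<open>Half the logarithm of the product of the conformal factor u^(4/(n-2)) and the factor
  sinh^2 r that separates the cone metric from \<open>cyl\<close>.\<close>

definition \<omega> :: "'j \<Rightarrow> real \<times> 'f \<Rightarrow> real" where
  "\<omega> j x = 2 / (real n - 2) * ln (u (FW j x)) + ln (sinh (fst x))"

definition H :: "'j \<Rightarrow> real \<times> 'f \<Rightarrow> real \<times> 'f \<Rightarrow> real \<times> 'f \<Rightarrow> real" where
  "H j = (\<lambda>x v w. exp (2 * \<omega> j x) * cyl (kN j) x v w)"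

lemma r0: "r0 \<ge> 0" using cone by (simp add: hyperbolic_conical_end_def)

lemma chart_dom_subset: "j \<in> indices N \<Longrightarrow> chart_dom N j \<subseteq> carrier N"
  by (auto simp: carrier_def)

lemma T_simps:
  "indices T = indices N"
  "j \<in> indices N \<Longrightarrow> chart_dom T j = {r0<..} \<times> chart_dom N j"
  "chart_map T j (r, p) = (r, chart_map N j p)"
  using r0 chart_dom_subset
  by (force simp: truncated_hyp_cone_def open_submanifold_def hyp_cone_def)+

lemma carrier_T: "carrier T = {r0<..} \<times> carrier N"
  unfolding carrier_def T_simps(1) using T_simps(2) by auto

lemma chart_inv_T:
  assumes "j \<in> indices N" "x \<in> W j"
  shows "chart_inv T j x = (fst x, chart_inv N j (snd x))"
proof -
  note c = chart_props[OF N(1) assms(1)]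
  have inj: "inj_on (chart_map T j) (chart_dom T j)"
    using inj_onD[OF c(8)] by (auto intro!: inj_onI simp: T_simps(2)[OF assms(1)] T_simps(3))
  have 1: "(fst x, chart_inv N j (snd x)) \<in> chart_dom T j"
    using assms c(7) by (auto simp: T_simps)
  have 2: "chart_map T j (fst x, chart_inv N j (snd x)) = x"
    using assms c(6)[of "snd x"] by (auto simp: T_simps(3))
  show ?thesis
    unfolding chart_inv_def[of T] using inv_into_f_f[OF inj 1] unfolding 2 .
qed

lemma sub_simps:
  "indices (open_submanifold M E) = indices M"
  "chart_dom (open_submanifold M E) i = chart_dom M i \<inter> E"
  "chart_map (open_submanifold M E) = chart_map M"
  "carrier (open_submanifold M E) = carrier M \<inter> E"
  by (auto simp: open_submanifold_def carrier_def)

lemma F_smooth: "smooth_map T (open_submanifold M E) F"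
  and F_pullback: "pulls_back T (hyp_cone_metric gN) (open_submanifold M E) g F"
  and F_bij: "bij_betw F (carrier T) (carrier (open_submanifold M E))"
  using cone by (auto simp: hyperbolic_conical_end_def riemannian_isometry_def diffeomorphism_def)

lemma F_cont: "continuous_on ({r0<..} \<times> carrier N) F"
  and F_mem: "r > r0 \<Longrightarrow> p \<in> carrier N \<Longrightarrow> F (r, p) \<in> carrier M \<inter> E"
  using F_smooth unfolding smooth_map_def carrier_T sub_simps by auto

text \<open>An end is a connected component, hence nonempty, and \<open>F\<close> maps onto
  it.\<close>

lemma N_nonempty: "carrier N \<noteq> {}"
proof -
  obtain K where K: "E \<in> components (carrier M - K)"
    using cone by (auto simp: hyperbolic_conical_end_def is_end_def)
  have "E \<noteq> {}" "E \<subseteq> carrier M"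
    using in_components_nonempty[OF K] in_components_subset[OF K] by auto
  then have "F ` carrier T \<noteq> {}" using F_bij by (auto simp: bij_betw_def sub_simps)
  then show ?thesis by (auto simp: carrier_T)
qed

lemma FW_cont: assumes j: "j \<in> indices N" shows "continuous_on (W j) (FW j)"
proof -
  note c = chart_props[OF N(1) j]
  have "continuous_on (W j) (\<lambda>x. (fst x, chart_inv N j (snd x)))"
    by (intro continuous_on_Pair continuous_on_fst continuous_on_id
        continuous_on_compose2[OF c(4) continuous_on_snd[OF continuous_on_id]]) auto
  then show ?thesis unfolding FW_def
    by (rule continuous_on_compose2[OF F_cont]) (use c(7) chart_dom_subset[OF j] in auto)
qed

lemma FW_mem:
  assumes j: "j \<in> indices N" and x: "x \<in> W j" shows "FW j x \<in> carrier M \<inter> E"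
proof -
  have "chart_inv N j (snd x) \<in> carrier N"
    using chart_props(7)[OF N(1) j, of "snd x"] chart_dom_subset[OF j] x by auto
  then show ?thesis unfolding FW_def using F_mem[of "fst x"] x by auto
qed

lemma open_W: "j \<in> indices N \<Longrightarrow> open (W j)"
  using chart_props(2)[OF N(1)] by (auto intro: open_Times)

text \<open>The part of a cone chart that is mapped into one chart of M; smoothness and the pullback
  identity of \<open>F\<close> are available on these pieces.\<close>

definition WM :: "'j \<Rightarrow> 'i \<Rightarrow> (real \<times> 'f) set" where
  "WM j i = W j \<inter> FW j -` chart_dom M i"

lemma open_WM: "j \<in> indices N \<Longrightarrow> i \<in> indices M \<Longrightarrow> open (WM j i)"
  unfolding WM_def using chart_props(1)[OF M(1)]
  by (intro continuous_open_preimage FW_cont open_W)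

lemma W_eq: "j \<in> indices N \<Longrightarrow> W j = (\<Union>i\<in>indices M. WM j i)"
  unfolding WM_def using FW_mem by (auto simp: carrier_def)

abbreviation \<Phi> :: "'j \<Rightarrow> 'i \<Rightarrow> real \<times> 'f \<Rightarrow> 'e" where
  "\<Phi> j i \<equiv> local_rep T (open_submanifold M E) F j i"

lemma \<Phi>_eq: "j \<in> indices N \<Longrightarrow> x \<in> W j \<Longrightarrow> \<Phi> j i x = chart_map M i (FW j x)"
  unfolding local_rep_def by (simp add: chart_inv_T sub_simps FW_def)

lemma smooth_\<Phi>:
  assumes j: "j \<in> indices N" and i: "i \<in> indices M"
  shows "smooth_on (WM j i) (\<Phi> j i)"
proof (rule smooth_on_subset)
  show "smooth_on (chart_map T j ` (chart_dom T j \<inter> F -` chart_dom (open_submanifold M E) i)) (\<Phi> j i)"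
    using F_smooth i j unfolding smooth_map_def T_simps(1) sub_simps(1) by auto
  show "WM j i \<subseteq> chart_map T j ` (chart_dom T j \<inter> F -` chart_dom (open_submanifold M E) i)"
  proof
    fix x assume x: "x \<in> WM j i"
    then have xW: "x \<in> W j" by (simp add: WM_def)
    note c = chart_props[OF N(1) j]
    have "x = chart_map T j (fst x, chart_inv N j (snd x))"
      using xW c(6)[of "snd x"] by (auto simp: T_simps(3))
    moreover have "(fst x, chart_inv N j (snd x)) \<in> chart_dom T j \<inter> F -` chart_dom (open_submanifold M E) i"
      using x xW c(7)[of "snd x"] FW_mem[OF j xW]
      by (auto simp: T_simps(2)[OF j] sub_simps WM_def FW_def)
    ultimately show "x \<in> chart_map T j ` (chart_dom T j \<inter> F -` chart_dom (open_submanifold M E) i)"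
      by (rule image_eqI)
  qed
qed

lemma \<Phi>_mem: "j \<in> indices N \<Longrightarrow> x \<in> WM j i \<Longrightarrow> \<Phi> j i x \<in> chart_map M i ` chart_dom M i"
  by (auto simp: \<Phi>_eq WM_def)

lemma chart_inv_\<Phi>:
  "j \<in> indices N \<Longrightarrow> i \<in> indices M \<Longrightarrow> x \<in> WM j i \<Longrightarrow> chart_inv M i (\<Phi> j i x) = FW j x"
  using chart_props(5)[OF M(1)] by (auto simp: \<Phi>_eq WM_def)

lemma smooth_u: assumes j: "j \<in> indices N" shows "smooth_on (W j) (\<lambda>x. u (FW j x))"
  unfolding W_eq[OF j]
proof (rule smooth_on_UN)
  fix i assume i: "i \<in> indices M"
  show "open (WM j i)" by (rule open_WM[OF j i])
  have "smooth_on (chart_map M i ` chart_dom M i) (u \<circ> chart_inv M i)"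
    using u i unfolding smooth_fun_def by auto
  then have "smooth_on (WM j i) (\<lambda>x. (u \<circ> chart_inv M i) (\<Phi> j i x))"
    by (intro smooth_on_compose[OF open_WM[OF j i] chart_props(2)[OF M(1) i] _ smooth_\<Phi>[OF j i]])
      (use \<Phi>_mem[OF j] in \<open>auto simp: o_def\<close>)
  then show "smooth_on (WM j i) (\<lambda>x. u (FW j x))"
    by (rule smooth_on_cong[OF open_WM[OF j i], rotated]) (simp add: chart_inv_\<Phi>[OF j i])
qed

lemma smooth_\<omega>: assumes j: "j \<in> indices N" shows "smooth_on (W j) (\<omega> j)"
proof -
  have "smooth_on (W j) (\<lambda>x. \<omega> j x)"
    unfolding \<omega>_def using r0
    by (intro smooth_on_add smooth_on_mult smooth_on_const smooth_on_ln_compose smooth_on_sinh_compose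
        smooth_on_fst smooth_u open_W j) (use FW_mem[OF j] u_pos in auto)
  then show ?thesis by simp
qed

lemma cylinder_W: "j \<in> indices N \<Longrightarrow> cylinder (V j) (kN j) r0"
  unfolding cylinder_def cylinder_axioms_def using coord_metric_chart[OF N(1,2)] r0 by blast

lemma coord_metric_H: assumes j: "j \<in> indices N" shows "coord_metric (W j) (H j)"
proof -
  interpret c: cylinder "V j" "kN j" r0 by (rule cylinder_W[OF j])
  interpret cc: conformal_change "W j" "cyl (kN j)" "\<omega> j" by unfold_locales (rule smooth_\<omega>[OF j])
  show ?thesis unfolding H_def by (rule cc.conf.coord_metric_axioms)
qed

lemma exp_\<omega>:
  assumes j: "j \<in> indices N" and x: "x \<in> W j"
  shows "exp (2 * \<omega> j x) = u (FW j x) powr (4 / (real n - 2)) * (sinh (fst x))\<^sup>2"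
proof -
  have s: "sinh (fst x) > 0" using x r0 by auto
  have "u (FW j x) > 0" using FW_mem[OF j x] u_pos by auto
  then have 1: "exp (4 / (real n - 2) * ln (u (FW j x))) = u (FW j x) powr (4 / (real n - 2))"
    by (simp add: powr_def)
  have 2: "exp (2 * ln (sinh (fst x))) = (sinh (fst x))\<^sup>2"
    unfolding exp_double using s by simp
  have "2 * \<omega> j x = 4 / (real n - 2) * ln (u (FW j x)) + 2 * ln (sinh (fst x))"
    by (simp add: \<omega>_def)
  then show ?thesis by (simp only: exp_add 1 2)
qed

text \<open>The pullback identity of \<open>F\<close> for the cone metric, multiplied by the
  conformal factor. It identifies \<open>H\<close> with the coordinate expression of the pulled-back
  metric \<open>gt\<close>.\<close>

lemma H_eq:
  assumes j: "j \<in> indices N" and i: "i \<in> indices M" and x: "x \<in> WM j i"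
  shows "H j x v w = gt i (chart_inv M i (\<Phi> j i x)) (dderiv (\<Phi> j i) x v) (dderiv (\<Phi> j i) x w)"
proof -
  have xW: "x \<in> W j" using x by (simp add: WM_def)
  note c = chart_props[OF N(1) j]
  let ?p = "(fst x, chart_inv N j (snd x))"
  have p: "?p \<in> chart_dom T j \<inter> F -` chart_dom (open_submanifold M E) i"
    using x xW c(7)[of "snd x"] FW_mem[OF j xW]
    by (auto simp: T_simps(2)[OF j] sub_simps WM_def FW_def)
  have px: "chart_map T j ?p = x" using xW c(6)[of "snd x"] by (auto simp: T_simps(3))
  have s: "sinh (fst x) > 0" using xW r0 by auto
  have "hyp_cone_metric gN j ?p v w = g i (F ?p) (dderiv (\<Phi> j i) x v) (dderiv (\<Phi> j i) x w)"
    using F_pullback[unfolded pulls_back_def T_simps(1) sub_simps(1), rule_format, OF j i p, of v w]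
    unfolding px Let_def .
  moreover have "hyp_cone_metric gN j ?p v w = (sinh (fst x))\<^sup>2 * cyl (kN j) x v w"
    unfolding hyp_cone_metric_def cyl_def using s by (simp add: case_prod_beta algebra_simps)
  ultimately show ?thesis
    unfolding H_def exp_\<omega>[OF j xW] chart_inv_\<Phi>[OF j i x] gt conformal_metric_def
    by (simp add: FW_def)
qed

lemma coord_metric_gt:
  assumes i: "i \<in> indices M"
  shows "coord_metric (chart_map M i ` chart_dom M i) (\<lambda>x. gt i (chart_inv M i x))"
proof -
  let ?\<omega> = "\<lambda>x. 2 / (real n - 2) * ln (u (chart_inv M i x))"
  note c = chart_props[OF M(1) i]
  interpret coord_metric "chart_map M i ` chart_dom M i" "\<lambda>x. g i (chart_inv M i x)"
    by (rule coord_metric_chart[OF M i])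
  have pos: "u (chart_inv M i x) > 0" if "x \<in> chart_map M i ` chart_dom M i" for x
    using c(7)[OF that] i u_pos by (auto simp: carrier_def)
  have "smooth_on (chart_map M i ` chart_dom M i) (\<lambda>x. u (chart_inv M i x))"
    using u i unfolding smooth_fun_def o_def by auto
  then interpret cc: conformal_change "chart_map M i ` chart_dom M i" "\<lambda>x. g i (chart_inv M i x)" ?\<omega>
    by unfold_locales (intro smooth_on_mult smooth_on_const smooth_on_ln_compose open_U pos)
  show ?thesis
  proof (rule coord_metric_cong[OF cc.conf.coord_metric_axioms])
    fix x assume "x \<in> chart_map M i ` chart_dom M i"
    then have "exp (2 * ?\<omega> x) = u (chart_inv M i x) powr (4 / (real n - 2))"
      using pos by (simp add: powr_def less_imp_neq[symmetric])
    then show "(\<lambda>v w. exp (2 * ?\<omega> x) * g i (chart_inv M i x) v w) = gt i (chart_inv M i x)"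
      unfolding gt conformal_metric_def by simp
  qed
qed

text \<open>For whichever chart \<open>some_chart\<close> selects at the image point, \<Phi> is a
  local isometry from \<open>H j\<close> to \<open>gt\<close> in that chart, so the coordinate
  formula has the same value in cone coordinates.\<close>

lemma scalar_curvature_cone:
  assumes j: "j \<in> indices N" and p: "p \<in> chart_dom N j" and r: "r > r0"
  shows "scalar_curvature M gt (F (r, p)) = coord_scalar_curvature (H j) (r, chart_map N j p)"
proof -
  let ?x = "(r, chart_map N j p)"
  have xW: "?x \<in> W j" using p r by auto
  have Fx: "FW j ?x = F (r, p)" unfolding FW_def by (simp add: chart_props(5)[OF N(1) j p])
  define i where "i = some_chart M (F (r, p))"
  have "\<exists>i. i \<in> indices M \<and> F (r, p) \<in> chart_dom M i"
    using FW_mem[OF j xW] unfolding Fx carrier_def by auto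
  then have "i \<in> indices M \<and> F (r, p) \<in> chart_dom M i"
    unfolding i_def some_chart_def by (rule someI_ex)
  then have i: "i \<in> indices M" "F (r, p) \<in> chart_dom M i" by auto
  have xWM: "?x \<in> WM j i" using xW i Fx by (simp add: WM_def)
  interpret H: coord_metric "W j" "H j" by (rule coord_metric_H[OF j])
  have sub: "WM j i \<subseteq> W j" by (simp add: WM_def)
  interpret HM: coord_metric "WM j i" "H j"
    by unfold_locales (use open_WM[OF j i(1)] sub H.bilin H.sym H.pos smooth_on_subset[OF H.smooth sub] in blast)+
  interpret G: coord_metric "chart_map M i ` chart_dom M i" "\<lambda>x. gt i (chart_inv M i x)"
    by (rule coord_metric_gt[OF i(1)])
  interpret coord_isometry "WM j i" "H j" "chart_map M i ` chart_dom M i" "\<lambda>x. gt i (chart_inv M i x)" "\<Phi> j i"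
  proof
    show "smooth_on (WM j i) (\<Phi> j i)" by (rule smooth_\<Phi>[OF j i(1)])
    show "\<Phi> j i ` WM j i \<subseteq> chart_map M i ` chart_dom M i" using \<Phi>_mem[OF j] by auto
    show "DIM(real \<times> 'f) = DIM('e)" using n dim_e dim_f by simp
  qed (rule H_eq[OF j i(1)])
  have "\<Phi> j i ?x = chart_map M i (F (r, p))" using \<Phi>_eq[OF j xW] Fx by simp
  then show ?thesis
    using coord_scalar_curvature_pullback[OF xWM]
    unfolding scalar_curvature_def i_def[symmetric] Let_def by simp
qed

text \<open>Since \<open>some_chart\<close> may jump from point to point, continuity is read off
  from the cone-coordinate formula and glued over the charts of N; compactness then makes the
  suprema of the theorem genuine upper bounds.\<close>

lemma bdd_scalar_curvature:
  assumes r: "r > r0"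
  shows "bdd_above ((\<lambda>p. \<bar>scalar_curvature M gt (F (r, p))\<bar>) ` carrier N)"
proof -
  have "continuous_on (\<Union>j\<in>indices N. chart_dom N j) (\<lambda>p. scalar_curvature M gt (F (r, p)))"
  proof (rule continuous_on_open_UN)
    fix j assume j: "j \<in> indices N"
    note c = chart_props[OF N(1) j]
    show "open (chart_dom N j)" by (rule c)
    interpret coord_metric "W j" "H j" by (rule coord_metric_H[OF j])
    have "continuous_on (chart_dom N j) (\<lambda>p. coord_scalar_curvature (H j) (r, chart_map N j p))"
      by (rule continuous_on_compose2[OF continuous_on_coord_scalar_curvature])
        (use r in \<open>auto intro!: continuous_intros c(3)\<close>)
    then show "continuous_on (chart_dom N j) (\<lambda>p. scalar_curvature M gt (F (r, p)))"
      by (rule continuous_on_cong[THEN iffD1, rotated 2]) (simp_all add: scalar_curvature_cone[OF j _ r])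
  qed
  then have "continuous_on (carrier N) (\<lambda>p. \<bar>scalar_curvature M gt (F (r, p))\<bar>)"
    unfolding carrier_def by (intro continuous_intros)
  then show ?thesis
    by (intro bounded_imp_bdd_above compact_imp_bounded compact_continuous_image N(3))
qed

lemma continuous_on_u: "continuous_on ({r0<..} \<times> carrier N) (\<lambda>x. u (F x))"
  by (rule continuous_on_compose2[OF smooth_fun_continuous_on[OF M(1) u] F_cont]) (use F_mem in auto)

lemma u_F_pos: "r > r0 \<Longrightarrow> p \<in> carrier N \<Longrightarrow> u (F (r, p)) > 0"
  using F_mem u_pos by auto

end

subsection \<open>A barrier decaying exponentially\<close>

text \<open>From exp (2 r) >= 3 and exp r >= 5/2. These uniform bounds allow one K to serve at all
  radii r >= 1.\<close>

lemma cosh_sinh_bounds: assumes "1 \<le> (r::real)" shows "cosh r \<le> 2 * sinh r" and "1 \<le> sinh r"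
proof -
  have "exp r * exp r = exp (2 * r)" by (simp add: mult_exp_exp)
  also have "exp (2 * r) \<ge> 1 + 2 * r" by (rule exp_ge_add_one_self)
  finally have "exp r * exp r \<ge> 3" using assms by simp
  then have "3 * exp (- r) \<le> exp r" by (simp add: exp_minus field_simps)
  then show "cosh r \<le> 2 * sinh r" by (simp add: cosh_def sinh_def field_simps)
  have "exp r \<ge> 5 / 2"
    using exp_lower_Taylor_quadratic[of r] assms one_le_power[OF assms, of 2] by linarith
  then have "exp (- r) \<le> 2 / 5" and "exp r \<ge> 5 / 2"
    by (auto simp: exp_minus field_simps)
  then show "1 \<le> sinh r" by (simp add: sinh_def)
qed

text \<open>The second-order expression in the conclusion of \<open>scalar_curvature_at_min\<close> for
  \<open>\<Psi> t = b ln (e\<^bsup>-Kt\<^esup> - e\<^bsup>-KR\<^esup>) + ln (sinh t)\<close> with \<open>b = 2 / (n - 2)\<close>; \<open>m\<close> is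
  minus the logarithmic derivative of \<open>e\<^bsup>-Kt\<^esup> - e\<^bsup>-KR\<^esup>\<close> and \<open>c = coth r\<close>, \<open>s = sinh r\<close>.\<close>

lemma barrier_inequality:
  fixes n b K m c s :: real
  assumes n: "n \<ge> 3" and b: "b = 2 / (n - 2)" and K: "K \<ge> 4 * n - 4" and m: "m \<ge> K"
    and c: "0 \<le> c" "c \<le> 2" "c\<^sup>2 = 1 + 1 / s\<^sup>2"
  shows "2 * (b * (K * m - m\<^sup>2) - 1 / s\<^sup>2 + c * (- b * m + c)) + (n - 2) * (- b * m + c)\<^sup>2 \<ge> b * K"
proof -
  have "n - 2 \<noteq> 0" using n by simp
  then have nb: "(n - 2) * b = 2"
    unfolding b times_divide_eq_right by (rule nonzero_mult_div_cancel_left)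
  have bp: "b > 0" using n b by simp
  have K1: "K \<ge> 1" using K n by simp
  \<comment> \<open>Since (n - 2) b = 2, the two terms in \<open>m\<^sup>2\<close> cancel. The
    relation between c and s reduces 2 c^2 - 2 / s^2 to the constant 2.\<close>
  have "2 * (b * (K * m - m\<^sup>2) - 1 / s\<^sup>2 + c * (- b * m + c)) + (n - 2) * (- b * m + c)\<^sup>2
    = 2 * b * (K * m - m\<^sup>2) - 2 / s\<^sup>2 - 2 * b * m * c + 2 * c\<^sup>2
      + ((n - 2) * b) * b * m\<^sup>2 - 2 * ((n - 2) * b) * m * c + (n - 2) * c\<^sup>2"
    by (simp add: power2_eq_square algebra_simps)
  also have "\<dots> = m * (2 * b * K - (2 * b + 4) * c) + 2 + (n - 2) * c\<^sup>2"
    unfolding nb using c(3) by (simp add: power2_eq_square algebra_simps)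
  finally have eq: "2 * (b * (K * m - m\<^sup>2) - 1 / s\<^sup>2 + c * (- b * m + c)) + (n - 2) * (- b * m + c)\<^sup>2
    = m * (2 * b * K - (2 * b + 4) * c) + 2 + (n - 2) * c\<^sup>2" .
  \<comment> \<open>The threshold 4 n - 4 makes b K at least 8 + 4 b, an upper bound of (2 b + 4) c
    for c at most 2; half of 2 b K therefore survives.\<close>
  have "b * K \<ge> b * (4 * n - 4)" using bp K by simp
  also have "b * (4 * n - 4) = 4 * ((n - 2) * b) + 4 * b" by (simp add: algebra_simps)
  finally have "b * K \<ge> 8 + 4 * b" by (simp add: nb)
  moreover have "(2 * b + 4) * c \<le> 4 * b + 8"
    using mult_left_mono[OF c(2), of "2 * b + 4"] bp by simp
  moreover have "y \<ge> 8 + 4 * b \<Longrightarrow> x \<le> 4 * b + 8 \<Longrightarrow> 2 * y - x \<ge> y" for x y by simp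
  ultimately have "2 * (b * K) - (2 * b + 4) * c \<ge> b * K" by blast
  then have "2 * b * K - (2 * b + 4) * c \<ge> b * K" by (simp only: mult.assoc)
  then have "m * (2 * b * K - (2 * b + 4) * c) \<ge> 1 * (b * K)"
    using m K1 bp by (intro mult_mono) auto
  moreover have "(n - 2) * c\<^sup>2 \<ge> 0" using n by simp
  ultimately show ?thesis unfolding eq by simp
qed

text \<open>\<open>m\<close> solves the Riccati equation m' = m^2 - K m, and it is at least K
  because subtracting exp (- K R) shrinks the denominator.\<close>

lemma barrier_derivatives:
  fixes b K R t :: real
  assumes "K > 0" "0 < t" "t < R"
  defines "m \<equiv> \<lambda>t. K * exp (- K * t) / (exp (- K * t) - exp (- K * R))"
  shows "((\<lambda>t. b * ln (exp (- K * t) - exp (- K * R)) + ln (sinh t))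
      has_real_derivative - b * m t + cosh t / sinh t) (at t)"
    and "((\<lambda>t. - b * m t + cosh t / sinh t)
      has_real_derivative b * (K * m t - (m t)\<^sup>2) - 1 / (sinh t)\<^sup>2) (at t)"
    and "m t \<ge> K"
proof -
  have p: "exp (- K * t) - exp (- K * R) > 0" using assms by simp
  have s: "sinh t > 0" using assms by simp
  show "((\<lambda>t. b * ln (exp (- K * t) - exp (- K * R)) + ln (sinh t))
      has_real_derivative - b * m t + cosh t / sinh t) (at t)"
    using p s unfolding m_def by (auto intro!: derivative_eq_intros)
  have "(m has_real_derivative (- (K * K * exp (- K * t)) * (exp (- K * t) - exp (- K * R))
      - K * exp (- K * t) * (- (K * exp (- K * t))))
      / ((exp (- K * t) - exp (- K * R)) * (exp (- K * t) - exp (- K * R)))) (at t)"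
    unfolding m_def using p by (auto intro!: derivative_eq_intros)
  also have "(- (K * K * exp (- K * t)) * (exp (- K * t) - exp (- K * R))
      - K * exp (- K * t) * (- (K * exp (- K * t))))
      / ((exp (- K * t) - exp (- K * R)) * (exp (- K * t) - exp (- K * R))) = (m t)\<^sup>2 - K * m t"
  proof -
    have "(- (K * K * x) * d - K * x * (- (K * x))) / (d * d) = (K * x / d)\<^sup>2 - K * (K * x / d)"
      if "d > 0" for x d :: real using that by (simp add: field_simps power2_eq_square)
    from this[OF p] show ?thesis by (simp add: m_def)
  qed
  finally have m': "(m has_real_derivative (m t)\<^sup>2 - K * m t) (at t)" .
  have "((\<lambda>t. cosh t / sinh t) has_real_derivative - 1 / (sinh t)\<^sup>2) (at t)"
    using s cosh_square_eq[of t]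
    by (auto intro!: derivative_eq_intros simp: field_simps power2_eq_square)
  from DERIV_add[OF DERIV_cmult[OF m', of "- b"] this]
  show "((\<lambda>t. - b * m t + cosh t / sinh t)
      has_real_derivative b * (K * m t - (m t)\<^sup>2) - 1 / (sinh t)\<^sup>2) (at t)"
    by (simp add: algebra_simps)
  show "m t \<ge> K" unfolding m_def using p assms(1) by (simp add: field_simps)
qed

lemma smooth_on_barrier:
  fixes b K R :: real
  assumes "K > 0"
  shows "smooth_on {0<..<R} (\<lambda>t. b * ln (exp (- K * t) - exp (- K * R)) + ln (sinh t))"
  by (intro smooth_on_add smooth_on_mult smooth_on_const smooth_on_ln_compose smooth_on_diff
      smooth_on_exp_compose smooth_on_sinh_compose smooth_on_id open_greaterThanLessThan)
    (use assms in auto)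

section \<open>Comparison of u with the barrier\<close>

context conical_end
begin

text \<open>\<open>\<omega> j x - \<Psi> (fst x)\<close> is b times the logarithm of u divided by
  the barrier, because ln sinh cancels. A minimum of the quotient is thus one to which
  \<open>scalar_curvature_at_min\<close> applies, and together with
  \<open>barrier_inequality\<close> it forces K to be at most CN + C0.\<close>

lemma no_interior_min:
  assumes CN: "CN \<ge> 0" "\<And>p. p \<in> carrier N \<Longrightarrow> \<exists>j\<in>indices N. p \<in> chart_dom N j \<and>
      coord_scalar_curvature (kN j) (chart_map N j p) \<le> CN"
    and C0: "u (F (r, p)) powr (4 / (real n - 2)) * \<bar>scalar_curvature M gt (F (r, p))\<bar> \<le> C0"
    and K: "K \<ge> 4 * real n - 4" "K > CN + C0"
    and r: "1 \<le> r" "r0 \<le> a" "0 \<le> a" "a < r" "r < R'" "R' \<le> R" and p: "p \<in> carrier N"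
    and min: "\<And>t q. a < t \<Longrightarrow> t < R' \<Longrightarrow> q \<in> carrier N \<Longrightarrow>
      u (F (r, p)) / (exp (- K * r) - exp (- K * R)) \<le> u (F (t, q)) / (exp (- K * t) - exp (- K * R))"
  shows False
proof -
  obtain j where j: "j \<in> indices N" "p \<in> chart_dom N j"
    "coord_scalar_curvature (kN j) (chart_map N j p) \<le> CN" using CN(2)[OF p] by blast
  note c = chart_props[OF N(1) j(1)]
  define b where "b = 2 / (real n - 2)"
  have b: "b > 0" using n by (simp add: b_def)
  have K0: "K > 0" using K n by linarith
  let ?y = "chart_map N j p"
  define X where "X = {a<..<R'} \<times> V j"
  define \<Psi> where "\<Psi> = (\<lambda>t. b * ln (exp (- K * t) - exp (- K * R)) + ln (sinh t))"
  define m where "m = (\<lambda>t. K * exp (- K * t) / (exp (- K * t) - exp (- K * R)))"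
  interpret c: cylinder "V j" "kN j" r0 by (rule cylinder_W[OF j(1)])
  have XW: "X \<subseteq> W j" using r by (auto simp: X_def)
  have pX: "(r, ?y) \<in> X" using r j by (auto simp: X_def)
  have A: "exp (2 * \<omega> j (r, ?y)) * coord_scalar_curvature (H j) (r, ?y)
    \<le> coord_scalar_curvature (kN j) ?y - (sinh r)\<^sup>2 * ((real DIM('f) + 1) - 1) *
      (2 * ((b * (K * m r - (m r)\<^sup>2) - 1 / (sinh r)\<^sup>2) + cosh r / sinh r * (- b * m r + cosh r / sinh r))
        + ((real DIM('f) + 1) - 2) * (- b * m r + cosh r / sinh r)\<^sup>2)"
    unfolding H_def
  proof (rule c.scalar_curvature_at_min[where J="{0<..<R}" and \<Psi>=\<Psi> and X=X])
    show "smooth_on (W j) (\<omega> j)" by (rule smooth_\<omega>[OF j(1)])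
    show "smooth_on {0<..<R} \<Psi>" unfolding \<Psi>_def by (rule smooth_on_barrier[OF K0])
    show "(\<Psi> has_real_derivative - b * m t + cosh t / sinh t) (at t)" if "t \<in> {0<..<R}" for t
      unfolding \<Psi>_def m_def using that by (intro barrier_derivatives(1) K0) auto
    show "((\<lambda>t. - b * m t + cosh t / sinh t)
      has_real_derivative b * (K * m r - (m r)\<^sup>2) - 1 / (sinh r)\<^sup>2) (at r)"
      unfolding m_def using r by (intro barrier_derivatives(2) K0) auto
    show "open X" unfolding X_def by (intro open_Times c) auto
    show "fst ` X \<subseteq> {0<..<R}" using r by (auto simp: X_def)
    show "(r, ?y) \<in> X" "X \<subseteq> W j" by (rule pX XW)+
    fix x assume x: "x \<in> X"
    have *: "\<omega> j x - \<Psi> (fst x) = b * ln (u (FW j x) / (exp (- K * fst x) - exp (- K * R)))"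
      and pos: "u (FW j x) / (exp (- K * fst x) - exp (- K * R)) > 0" if "x \<in> X" for x
    proof -
      have "u (FW j x) > 0" using u_pos FW_mem[OF j(1)] that XW by blast
      moreover have "exp (- K * fst x) - exp (- K * R) > 0" using that r K0 by (auto simp: X_def)
      ultimately show "\<omega> j x - \<Psi> (fst x) = b * ln (u (FW j x) / (exp (- K * fst x) - exp (- K * R)))"
        "u (FW j x) / (exp (- K * fst x) - exp (- K * R)) > 0"
        unfolding \<omega>_def \<Psi>_def b_def[symmetric] by (auto simp: ln_div algebra_simps)
    qed
    have "chart_inv N j (snd x) \<in> carrier N" "a < fst x" "fst x < R'"
      using x chart_dom_subset[OF j(1)] c(7)[of "snd x"] by (auto simp: X_def)
    from min[OF this(2,3,1)]
    have "u (FW j (r, ?y)) / (exp (- K * r) - exp (- K * R)) \<le> u (FW j x) / (exp (- K * fst x) - exp (- K * R))"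
      by (simp add: FW_def c(5)[OF j(2)])
    then have "ln (u (FW j (r, ?y)) / (exp (- K * r) - exp (- K * R))) \<le>
        ln (u (FW j x) / (exp (- K * fst x) - exp (- K * R)))"
      using pos[OF pX] by simp
    then show "\<omega> j (r, ?y) - \<Psi> r \<le> \<omega> j x - \<Psi> (fst x)"
      using *[OF pX] *[OF x] b by simp
  qed simp
  have S: "coord_scalar_curvature (H j) (r, ?y) = scalar_curvature M gt (F (r, p))"
    using scalar_curvature_cone[OF j(1,2)] r by simp
  have W: "exp (2 * \<omega> j (r, ?y)) = u (F (r, p)) powr (4 / (real n - 2)) * (sinh r)\<^sup>2"
    using exp_\<omega>[OF j(1), of "(r, ?y)"] pX XW by (auto simp: FW_def c(5)[OF j(2)])
  have dim: "real DIM('f) + 1 = real n" using dim_f n by (simp add: of_nat_diff)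
  have Q: "b * K \<le> 2 * ((b * (K * m r - (m r)\<^sup>2) - 1 / (sinh r)\<^sup>2) + cosh r / sinh r * (- b * m r + cosh r / sinh r))
        + (real n - 2) * (- b * m r + cosh r / sinh r)\<^sup>2"
  proof (rule barrier_inequality[OF _ b_def K(1)])
    show "m r \<ge> K" unfolding m_def using r by (intro barrier_derivatives(3)[where R=R] K0) auto
    have s: "sinh r > 0" using r(1) by simp
    show "0 \<le> cosh r / sinh r" by (intro divide_nonneg_pos s cosh_real_nonneg)
    show "cosh r / sinh r \<le> 2" using cosh_sinh_bounds(1)[OF r(1)] by (simp only: pos_divide_le_eq[OF s])
    show "(cosh r / sinh r)\<^sup>2 = 1 + 1 / (sinh r)\<^sup>2"
      using s by (simp only: power_divide cosh_square_eq add_divide_distrib) simp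
  qed (use n in simp)
  have sinh: "(sinh r)\<^sup>2 \<ge> 1" using cosh_sinh_bounds[OF r(1)] by (simp add: power2_eq_square mult_ge1_I)
  have "(sinh r)\<^sup>2 * (real n - 1) * (b * K) \<le> (sinh r)\<^sup>2 * (real n - 1) *
      (2 * ((b * (K * m r - (m r)\<^sup>2) - 1 / (sinh r)\<^sup>2) + cosh r / sinh r * (- b * m r + cosh r / sinh r))
        + (real n - 2) * (- b * m r + cosh r / sinh r)\<^sup>2)"
    using n by (intro mult_left_mono[OF Q] mult_nonneg_nonneg) auto
  with A[unfolded S W dim] j(3)
  have 1: "u (F (r, p)) powr (4 / (real n - 2)) * (sinh r)\<^sup>2 * scalar_curvature M gt (F (r, p))
    \<le> CN - (sinh r)\<^sup>2 * (real n - 1) * (b * K)"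
    by linarith
  \<comment> \<open>From here on every term carries the factor sinh^2 r: the coefficient (n - 1) b
    is dropped in favour of 1, and CN is enlarged using sinh r >= 1.\<close>
  have "(real n - 1) * b \<ge> 1" using n by (simp add: b_def field_simps)
  then have "(real n - 1) * b * K \<ge> K" using K0 by simp
  then have "(sinh r)\<^sup>2 * ((real n - 1) * b * K) \<ge> (sinh r)\<^sup>2 * K" by (intro mult_left_mono) auto
  moreover have "\<bar>u (F (r, p)) powr (4 / (real n - 2)) * scalar_curvature M gt (F (r, p))\<bar> \<le> C0"
    using C0 by (simp add: abs_mult)
  then have "u (F (r, p)) powr (4 / (real n - 2)) * scalar_curvature M gt (F (r, p)) \<ge> - C0"
    by linarith
  then have "(sinh r)\<^sup>2 * (u (F (r, p)) powr (4 / (real n - 2)) * scalar_curvature M gt (F (r, p))) \<ge> (sinh r)\<^sup>2 * (- C0)"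
    by (intro mult_left_mono) auto
  moreover have "CN \<le> (sinh r)\<^sup>2 * CN" using mult_right_mono[OF sinh CN(1)] by simp
  ultimately have "(sinh r)\<^sup>2 * K \<le> (sinh r)\<^sup>2 * (CN + C0)" using 1 by (simp add: algebra_simps)
  then show False using K(2) sinh by (simp add: mult_le_cancel_left)
qed

text \<open>If u fell below \<epsilon> times the barrier, the quotient would have a minimum less
  than \<epsilon>. It cannot lie at r1 by the choice of \<epsilon>, nor at the outer end, where the
  barrier is nearly zero, so it would be interior.\<close>

theorem exponential_lower_bound:
  assumes r1: "r1 > r0" "r1 \<ge> 1"
    and C0: "\<And>r p. r \<ge> r1 \<Longrightarrow> p \<in> carrier N \<Longrightarrow>
      u (F (r, p)) powr (4 / (real n - 2)) * \<bar>scalar_curvature M gt (F (r, p))\<bar> \<le> C0"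
  obtains \<epsilon> K where "\<epsilon> > 0" "\<And>r p. r \<ge> r1 \<Longrightarrow> p \<in> carrier N \<Longrightarrow> u (F (r, p)) \<ge> \<epsilon> * exp (- K * r)"
proof -
  obtain CN where CN: "CN \<ge> 0" "\<And>p. p \<in> carrier N \<Longrightarrow> \<exists>j\<in>indices N. p \<in> chart_dom N j \<and>
      coord_scalar_curvature (kN j) (chart_map N j p) \<le> CN"
    using coord_scalar_curvature_bounded[OF N] by metis
  \<comment> \<open>The first entry is the threshold of \<open>barrier_inequality\<close>; the
    second exceeds the curvature bounds of the section and of the conformal metric together.\<close>
  define K where "K = max (4 * real n - 4) (CN + C0 + 1)"
  have K: "K \<ge> 4 * real n - 4" "K > CN + C0" by (auto simp: K_def)
  have K0: "K > 0" using K n by linarith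
  have pos: "u (F x) > 0" if "x \<in> {r1..b} \<times> carrier N" for x b
    using that u_F_pos r1 by auto
  have cont: "continuous_on ({r1..b} \<times> carrier N) (\<lambda>x. u (F x))" for b
    by (rule continuous_on_subset[OF continuous_on_u]) (use r1 in auto)
  have attains: "\<exists>x\<in>{r1..b} \<times> carrier N. \<forall>y\<in>{r1..b} \<times> carrier N. f x \<le> f y"
    if "r1 \<le> b" "continuous_on ({r1..b} \<times> carrier N) f" for b and f :: "real \<times> 'k \<Rightarrow> real"
    by (rule continuous_attains_inf[OF _ _ that(2)]) (use N(3) N_nonempty that(1) in \<open>auto intro: compact_Times\<close>)
  obtain x1 where x1: "x1 \<in> {r1..r1} \<times> carrier N" "\<And>y. y \<in> {r1..r1} \<times> carrier N \<Longrightarrow> u (F x1) \<le> u (F y)"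
    using attains[OF order_refl cont] by blast
  define \<epsilon> where "\<epsilon> = u (F x1)"
  have \<epsilon>: "\<epsilon> > 0" unfolding \<epsilon>_def using pos[OF x1(1)] .
  have \<epsilon>1: "\<epsilon> * exp (- K * r1) \<le> u (F (r1, q))" if "q \<in> carrier N" for q
  proof -
    have "\<epsilon> * exp (- K * r1) \<le> \<epsilon> * 1" using \<epsilon> K0 r1 by (intro mult_left_mono) auto
    also have "\<dots> \<le> u (F (r1, q))" unfolding \<epsilon>_def using x1(2)[of "(r1, q)"] that by simp
    finally show ?thesis .
  qed
  have main: "\<epsilon> * (exp (- K * r) - exp (- K * R)) \<le> u (F (r, p))"
    if r: "r1 \<le> r" "r < R" and p: "p \<in> carrier N" for r R p
  proof (rule ccontr)
    let ?\<phi> = "\<lambda>t. exp (- K * t) - exp (- K * R)"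
    assume "\<not> ?thesis"
    then have less: "u (F (r, p)) < \<epsilon> * ?\<phi> r" by simp
    obtain x2 where x2: "x2 \<in> {r1..R} \<times> carrier N" "\<And>y. y \<in> {r1..R} \<times> carrier N \<Longrightarrow> u (F x2) \<le> u (F y)"
      using attains[OF _ cont] r by (metis less_eq_real_def order.trans)
    \<comment> \<open>The barrier tends to 0 at R while u has a positive minimum on the compact
      region up to R, so at some R' < R the scaled barrier lies below that minimum. Stopping at R'
      also keeps the denominator of the quotient positive.\<close>
    have "((\<lambda>t. \<epsilon> * ?\<phi> t) \<longlongrightarrow> \<epsilon> * ?\<phi> R) (at_left R)" by (intro tendsto_intros)
    then have "\<forall>\<^sub>F t in at_left R. \<epsilon> * ?\<phi> t < u (F x2)"
      using pos[OF x2(1)] by (intro order_tendstoD) auto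
    moreover have "\<forall>\<^sub>F t in at_left R. t \<in> {r<..<R}"
      using eventually_at_left_real[OF r(2)] .
    ultimately have "\<forall>\<^sub>F t in at_left R. \<epsilon> * ?\<phi> t < u (F x2) \<and> t \<in> {r<..<R}" by (rule eventually_conj)
    then obtain R' where R': "\<epsilon> * ?\<phi> R' < u (F x2)" "r < R'" "R' < R"
      using eventually_happens'[OF trivial_limit_at_left_real] by auto
    have \<phi>: "?\<phi> t > 0" if "t < R" for t using that K0 by simp
    have "continuous_on ({r1..R'} \<times> carrier N) (\<lambda>x. u (F x) / ?\<phi> (fst x))"
      using \<phi> R' by (intro continuous_intros cont) force+
    then obtain x where x: "x \<in> {r1..R'} \<times> carrier N"
      "\<And>y. y \<in> {r1..R'} \<times> carrier N \<Longrightarrow> u (F x) / ?\<phi> (fst x) \<le> u (F y) / ?\<phi> (fst y)"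
      using attains[of R' "\<lambda>x. u (F x) / ?\<phi> (fst x)"] r R' by auto
    obtain t q where tq: "x = (t, q)" "r1 \<le> t" "t \<le> R'" "q \<in> carrier N" using x(1) by auto
    have "u (F (t, q)) / ?\<phi> t \<le> u (F (r, p)) / ?\<phi> r" using x(2)[of "(r, p)"] r R' p tq by simp
    also have "\<dots> < \<epsilon>" using less \<phi>[OF r(2)] by (simp add: divide_less_eq)
    finally have small: "u (F (t, q)) < \<epsilon> * ?\<phi> t" using \<phi>[of t] tq R' by (simp add: divide_less_eq)
    have "t \<noteq> r1"
    proof
      assume "t = r1"
      moreover have "\<epsilon> * ?\<phi> r1 \<le> \<epsilon> * exp (- K * r1)" using \<epsilon> by simp
      ultimately show False using small \<epsilon>1[OF tq(4)] by simp
    qed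
    moreover have "t \<noteq> R'"
    proof
      assume "t = R'"
      moreover have "u (F x2) \<le> u (F (R', q))" using R' r tq by (intro x2(2)) auto
      ultimately show False using small R' by simp
    qed
    ultimately have t: "r1 < t" "t < R'" using tq by auto
    show False
    proof (rule no_interior_min[OF CN C0[OF tq(2,4)] K _ _ _ t _ tq(4)])
      show "u (F (t, q)) / ?\<phi> t \<le> u (F (t', q')) / ?\<phi> t'"
        if "r1 < t'" "t' < R'" "q' \<in> carrier N" for t' q'
        using x(2)[of "(t', q')"] that tq by simp
    qed (use r1 tq R' in auto)
  qed
  show thesis
  proof (rule that)
    \<comment> \<open>The choice R = r + 1 costs only the constant factor 1 - exp (- K).\<close>
    show "\<epsilon> * (1 - exp (- K)) > 0" using \<epsilon> K0 by simp
    fix r p assume "r \<ge> r1" "p \<in> carrier N"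
    then have "\<epsilon> * (exp (- K * r) - exp (- K * (r + 1))) \<le> u (F (r, p))" by (intro main) auto
    then show "\<epsilon> * (1 - exp (- K)) * exp (- K * r) \<le> u (F (r, p))"
      by (simp add: algebra_simps mult_exp_exp)
  qed
qed

end

section \<open>A bounded limsup contradicts the exponential lower bound on u, since \<alpha> grows
  superlinearly\<close>

theorem theorem14:
  fixes M :: "('i, 'm::{t2_space,second_countable_topology}, 'e::euclidean_space) atlas"
    and g gt :: "('i, 'm, 'e) tensor2"
    and N :: "('j, 'k::{t2_space,second_countable_topology}, 'f::euclidean_space) atlas"
    and gN :: "('j, 'k, 'f) tensor2"
    and n :: nat
    and r0 :: real
    and E :: "'m set"
    and F :: "real \<times> 'k \<Rightarrow> 'm"
    and u :: "'m \<Rightarrow> real"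
    and \<alpha> :: "real \<Rightarrow> real"
  assumes "n \<ge> 3" and "DIM('e) = n" and "DIM('f) = n - 1"
    and "riemannian_manifold M g" and "complete_metric M g"
    and "riemannian_manifold N gN" and "compact (carrier N)"
    and "hyperbolic_conical_end M g N gN r0 E F"
    and "smooth_fun M u" and "\<forall>p\<in>carrier M. u p > 0"
    and "gt = conformal_metric (\<lambda>p. u p powr (4 / (real n - 2))) g"
    and "\<forall>t\<ge>0. \<alpha> t > 0"
    and "filterlim (\<lambda>t. \<alpha> t / t) at_top at_top"
    and "(\<lambda>r. SUP x\<in>carrier N. \<bar>scalar_curvature M gt (F (r, x))\<bar>) \<in> O[at_top](\<lambda>r. exp (\<alpha> r))"
  shows "Limsup at_top
           (\<lambda>r. ereal (exp ((real n - 2) / 4 * \<alpha> r) * (SUP x\<in>carrier N. u (F (r, x))))) = \<infinity>"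
proof (rule ccontr)
  assume "\<not> ?thesis"
  then obtain C1 :: nat where "Limsup at_top (\<lambda>r. ereal (exp ((real n - 2) / 4 * \<alpha> r) *
      (SUP x\<in>carrier N. u (F (r, x))))) < ereal (real C1)"
    by (auto simp: less_PInf_Ex_of_nat)
  from Limsup_lessD[OF this]
  have ev1: "\<forall>\<^sub>F r in at_top. exp ((real n - 2) / 4 * \<alpha> r) * (SUP x\<in>carrier N. u (F (r, x))) < real C1"
    by simp
  obtain C2 where C2: "C2 > 0" and ev2: "\<forall>\<^sub>F r in at_top.
      norm (SUP x\<in>carrier N. \<bar>scalar_curvature M gt (F (r, x))\<bar>) \<le> C2 * norm (exp (\<alpha> r))"
    using assms(14) by (elim landau_o.bigE)
  interpret conical_end M g gt N gN n r0 E F u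
    using assms by unfold_locales (auto simp: riemannian_manifold_def)
  have n2: "real n - 2 > 0" using n by simp
  \<comment> \<open>Raising exp ((n - 2) / 4 * \<alpha>) u <= C1 to the power 4 / (n - 2) gives exp
    \<alpha> times u^(4/(n-2)) at most C1^(4/(n-2)), and the curvature is at most C2 exp
    \<alpha>.\<close>
  define C0 where "C0 = real C1 powr (4 / (real n - 2)) * C2"
  have bdd_u: "bdd_above ((\<lambda>x. u (F (r, x))) ` carrier N)" if "r > r0" for r
  proof -
    have "continuous_on (carrier N) (\<lambda>x. u (F (r, x)))"
      by (rule continuous_on_compose2[OF continuous_on_u, of _ "\<lambda>x. (r, x)"])
        (use that in \<open>auto intro!: continuous_intros\<close>)
    then show ?thesis
      by (intro bounded_imp_bdd_above compact_imp_bounded compact_continuous_image N(3))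
  qed
  have "\<forall>\<^sub>F r in at_top. r > r0 \<and> r \<ge> (1::real) \<and>
      (\<forall>p\<in>carrier N. exp ((real n - 2) / 4 * \<alpha> r) * u (F (r, p)) \<le> real C1 \<and>
        u (F (r, p)) powr (4 / (real n - 2)) * \<bar>scalar_curvature M gt (F (r, p))\<bar> \<le> C0)"
    using ev1 ev2 eventually_gt_at_top[of r0] eventually_ge_at_top[of 1]
  proof eventually_elim
    case (elim r)
    have "exp ((real n - 2) / 4 * \<alpha> r) * u (F (r, p)) \<le> real C1 \<and>
        u (F (r, p)) powr (4 / (real n - 2)) * \<bar>scalar_curvature M gt (F (r, p))\<bar> \<le> C0"
      if p: "p \<in> carrier N" for p
    proof
      have up: "u (F (r, p)) > 0" using u_F_pos elim p by simp
      have "u (F (r, p)) \<le> (SUP x\<in>carrier N. u (F (r, x)))"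
        by (rule cSUP_upper[OF p bdd_u[OF elim(3)]])
      then have "exp ((real n - 2) / 4 * \<alpha> r) * u (F (r, p)) \<le>
          exp ((real n - 2) / 4 * \<alpha> r) * (SUP x\<in>carrier N. u (F (r, x)))"
        by (rule mult_left_mono) simp
      then show C1: "exp ((real n - 2) / 4 * \<alpha> r) * u (F (r, p)) \<le> real C1" using elim(1) by linarith
      have "\<bar>scalar_curvature M gt (F (r, p))\<bar> \<le> (SUP x\<in>carrier N. \<bar>scalar_curvature M gt (F (r, x))\<bar>)"
        by (rule cSUP_upper[OF p bdd_scalar_curvature[OF elim(3)]])
      then have S: "\<bar>scalar_curvature M gt (F (r, p))\<bar> \<le> C2 * exp (\<alpha> r)" using elim(2) by simp
      have "exp (\<alpha> r) * u (F (r, p)) powr (4 / (real n - 2))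
          = (exp ((real n - 2) / 4 * \<alpha> r) * u (F (r, p))) powr (4 / (real n - 2))"
        using up n2 by (simp add: powr_mult exp_powr_real)
      also have "\<dots> \<le> real C1 powr (4 / (real n - 2))"
        using C1 up n2 by (intro powr_mono2) auto
      finally have U: "exp (\<alpha> r) * u (F (r, p)) powr (4 / (real n - 2)) \<le> real C1 powr (4 / (real n - 2))" .
      have "u (F (r, p)) powr (4 / (real n - 2)) * \<bar>scalar_curvature M gt (F (r, p))\<bar>
          \<le> u (F (r, p)) powr (4 / (real n - 2)) * (C2 * exp (\<alpha> r))"
        by (rule mult_left_mono[OF S]) simp
      also have "\<dots> = (exp (\<alpha> r) * u (F (r, p)) powr (4 / (real n - 2))) * C2" by simp
      also have "\<dots> \<le> C0" unfolding C0_def using C2 by (intro mult_right_mono[OF U]) simp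
      finally show "u (F (r, p)) powr (4 / (real n - 2)) * \<bar>scalar_curvature M gt (F (r, p))\<bar> \<le> C0" .
    qed
    then show ?case using elim by blast
  qed
  then obtain r1 where r1: "\<And>r. r \<ge> r1 \<Longrightarrow> r > r0 \<and> r \<ge> 1 \<and>
      (\<forall>p\<in>carrier N. exp ((real n - 2) / 4 * \<alpha> r) * u (F (r, p)) \<le> real C1 \<and>
        u (F (r, p)) powr (4 / (real n - 2)) * \<bar>scalar_curvature M gt (F (r, p))\<bar> \<le> C0)"
    unfolding eventually_at_top_linorder by blast
  obtain \<epsilon> K where \<epsilon>: "\<epsilon> > 0" and lower: "\<And>r p. r \<ge> r1 \<Longrightarrow> p \<in> carrier N \<Longrightarrow> u (F (r, p)) \<ge> \<epsilon> * exp (- K * r)"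
    by (rule exponential_lower_bound[of r1 C0]) (use r1 in blast)+
  obtain p where p: "p \<in> carrier N" using N_nonempty by blast
  have "\<forall>\<^sub>F r in at_top. \<alpha> r / r \<ge> (K + 1) * (4 / (real n - 2))"
    using assms(13) by (simp add: filterlim_at_top)
  moreover have "\<forall>\<^sub>F r in at_top. r \<ge> max r1 (real C1 / \<epsilon>)" by (rule eventually_ge_at_top)
  ultimately have "\<exists>r. \<alpha> r / r \<ge> (K + 1) * (4 / (real n - 2)) \<and> r \<ge> max r1 (real C1 / \<epsilon>)"
    by (intro eventually_happens'[OF trivial_limit_at_top_linorder] eventually_conj)
  then obtain r where elim: "\<alpha> r / r \<ge> (K + 1) * (4 / (real n - 2))" "r \<ge> max r1 (real C1 / \<epsilon>)"
    by blast
  have r: "r \<ge> r1" "r > 0" "r \<ge> real C1 / \<epsilon>" using elim(2) r1[of r] by auto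
  have "x = d / 4 * (y * (4 / d) * z)" if "d > 0" "x = y * z" for d x y z :: real
    using that by simp
  from this[OF n2 refl]
  have "(K + 1) * r = (real n - 2) / 4 * ((K + 1) * (4 / (real n - 2)) * r)" .
  also have "\<dots> \<le> (real n - 2) / 4 * \<alpha> r"
    using elim(1) r(2) n2 by (intro mult_left_mono) (simp_all add: pos_le_divide_eq)
  finally have le: "(K + 1) * r \<le> (real n - 2) / 4 * \<alpha> r" .
  \<comment> \<open>The bound imposed on \<alpha> r / r makes the exponential factor beat the decay
    rate K by one unit, so the product is at least \<epsilon> exp r; with r >= C1 / \<epsilon> this
    exceeds C1 because exp r >= 1 + r.\<close>
  have "\<epsilon> * exp r = exp ((K + 1) * r) * (\<epsilon> * exp (- K * r))"
    by (simp add: mult_exp_exp algebra_simps)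
  also have "\<dots> \<le> exp ((real n - 2) / 4 * \<alpha> r) * u (F (r, p))"
    using lower[OF r(1) p] le \<epsilon> by (intro mult_mono) auto
  also have "\<dots> \<le> real C1" using r1[OF r(1)] p by blast
  finally have "exp r \<le> real C1 / \<epsilon>" using \<epsilon> by (simp add: pos_le_divide_eq mult.commute)
  then show False using exp_ge_add_one_self[of r] r(3) by linarith
qed

end
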